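(* Let $1\le m\le n$ be integers, let $a_1,\dots,a_m>0$ be real numbers, let $(z_1,\dots,z_n)$ be the coordinates on $\mathbb{C}^n$ and let $o$ be the origin. The weight $\varphi=\log\sum_{i=1}^{m}|z_i|^{a_i}$ has decreasing equisingular approximations with analytic singularities near $o$ if and only if one of the following statements holds: (1) $\varphi$ has analytic singularity near $o$, i.e. there exists a real number $c>0$ such that $\frac{a_i}{c}$ is a positive rational number for every $i\in\{1,\dots,m\}$; (2) the equation $\sum_{i=1}^{m}\frac{x_i}{a_i}=1$ has no solution $(x_1,\dots,x_m)$ in positive integers.
   Context: For a plurisubharmonic function $\psi$ on a complex manifold, the multiplier ideal sheaf $\mathcal{I}(\psi)$ is the sheaf of germs of holomorphic functions $f$ such that $|f|^2e^{-2\psi}$ is locally integrable. A weight means a plurisubharmonic function. A weight $\psi$ has analytic singularity (analytic singularities) near $o$ if $\psi=c\log\sum_{j=1}^{N}|f_j|^2+O(1)$ near $o$, where $f_1,\dots,f_N$ are holomorphic functions near $o$ and $c>0$ is a real number. A weight $\varphi$ has decreasing equisingular approximations with analytic singularities near $o$ if on some neighborhood of $o$ there is a sequence of plurisubharmonic functions $\varphi_k$ ($k=1,2,\dots$), each with analytic singularities near $o$, which is decreasing in $k$ and converges pointwise to $\varphi$, such that $\mathcal{I}(\varphi_k)=\mathcal{I}(\varphi)$ on that neighborhood for every $k$. *)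

theory Defs
  imports "HOL-Analysis.Analysis"
begin

text \<open>
  Weights take values in \<open>[-\<infinity>, \<infinity>)\<close> and are represented by \<open>ereal\<close>-valued functions; only
  their values on the open set under consideration matter.
\<close>

definition ext_ln :: "real \<Rightarrow> ereal" where
  "ext_ln x = (if 0 < x then ereal (ln x) else -\<infinity>)"

definition ext_exp :: "ereal \<Rightarrow> ennreal" where
  "ext_exp x = (case x of ereal r \<Rightarrow> ennreal (exp r) | PInfty \<Rightarrow> top | MInfty \<Rightarrow> 0)"

text \<open>
  The Lebesgue integral as positive part minus negative part (\<open>e2ennreal\<close> sends negative
  arguments to 0).  It is only applied to functions that are bounded above on a bounded
  interval, so the subtrahend alone can be infinite.
\<close>

definition ext_integral :: "real set \<Rightarrow> (real \<Rightarrow> ereal) \<Rightarrow> ereal" where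
  "ext_integral A g =
     enn2ereal (\<integral>\<^sup>+ t \<in> A. e2ennreal (g t) \<partial>lborel) - enn2ereal (\<integral>\<^sup>+ t \<in> A. e2ennreal (- g t) \<partial>lborel)"

text \<open>
  Holomorphy in several variables: at every point there is a Frechet derivative that is
  complex linear.
\<close>

definition holomorphic_several :: "(complex^'n::finite \<Rightarrow> complex) \<Rightarrow> (complex^'n) set \<Rightarrow> bool" where
  "holomorphic_several f V \<longleftrightarrow>
     (\<forall>z\<in>V. \<exists>D. (f has_derivative D) (at z) \<and> (\<forall>c v. D (c *s v) = c * D v))"

text \<open>
  Upper semicontinuity together with the sub-mean value inequality on every closed disc, contained
  in \<open>U\<close>, of a complex line.  A function that is \<open>-\<infinity>\<close> on a whole component of \<open>U\<close> is admitted.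
\<close>

definition plurisubharmonic_on :: "(complex^'n::finite) set \<Rightarrow> (complex^'n \<Rightarrow> ereal) \<Rightarrow> bool" where
  "plurisubharmonic_on U u \<longleftrightarrow>
     (\<forall>z\<in>U. u z < \<infinity>) \<and>
     (\<forall>z\<in>U. Limsup (at z within U) u \<le> u z) \<and>
     (\<forall>p w. (\<forall>t::complex. norm t \<le> 1 \<longrightarrow> p + t *s w \<in> U) \<longrightarrow>
        u p \<le> ext_integral {0..2*pi} (\<lambda>\<theta>. u (p + cis \<theta> *s w)) / ereal (2*pi))"

text \<open>
  The stalk at \<open>x\<close> of the multiplier ideal sheaf.  A germ is represented by total functions, the
  stalk being closed under changing a function away from a neighbourhood of \<open>x\<close>.  Hence
  equality of these sets is equality of ideals of germs, and two multiplier ideal sheaves agree on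
  an open set iff their stalks agree at each of its points.
\<close>

definition multiplier_ideal :: "(complex^'n::finite \<Rightarrow> ereal) \<Rightarrow> complex^'n \<Rightarrow> (complex^'n \<Rightarrow> complex) set" where
  "multiplier_ideal \<psi> x =
     {f. \<exists>V. open V \<and> x \<in> V \<and> holomorphic_several f V \<and>
        (\<integral>\<^sup>+ z \<in> V. ennreal ((norm (f z))\<^sup>2) * ext_exp (- 2 * \<psi> z) \<partial>lborel) < \<infinity>}"

definition analytic_singularities_near :: "(complex^'n::finite \<Rightarrow> ereal) \<Rightarrow> complex^'n \<Rightarrow> bool" where
  "analytic_singularities_near \<psi> p \<longleftrightarrow>
     (\<exists>V (N::nat) f (c::real) (C::real).
        open V \<and> p \<in> V \<and> plurisubharmonic_on V \<psi> \<and>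
        1 \<le> N \<and> (\<forall>j\<in>{1..N}. holomorphic_several (f j) V) \<and> 0 < c \<and>
        (\<forall>z\<in>V. ereal c * ext_ln (\<Sum>j=1..N. (norm (f j z))\<^sup>2) - ereal C \<le> \<psi> z \<and>
               \<psi> z \<le> ereal c * ext_ln (\<Sum>j=1..N. (norm (f j z))\<^sup>2) + ereal C))"

definition decreasing_equisingular_approx_near :: "(complex^'n::finite \<Rightarrow> ereal) \<Rightarrow> complex^'n \<Rightarrow> bool" where
  "decreasing_equisingular_approx_near \<phi> p \<longleftrightarrow>
     (\<exists>U (\<phi>s :: nat \<Rightarrow> complex^'n \<Rightarrow> ereal).
        open U \<and> p \<in> U \<and> plurisubharmonic_on U \<phi> \<and>
        (\<forall>k. plurisubharmonic_on U (\<phi>s k)) \<and>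
        (\<forall>k. analytic_singularities_near (\<phi>s k) p) \<and>
        (\<forall>k. \<forall>z\<in>U. \<phi>s (Suc k) z \<le> \<phi>s k z) \<and>
        (\<forall>z\<in>U. (\<lambda>k. \<phi>s k z) \<longlonglongrightarrow> \<phi> z) \<and>
        (\<forall>k. \<forall>x\<in>U. multiplier_ideal (\<phi>s k) x = multiplier_ideal \<phi> x))"

text \<open>
  The coordinates of \<open>complex^'n\<close> are indexed by the type \<open>'n\<close>; \<open>idx\<close>, which is to be a bijection
  from \<open>{1..CARD('n)}\<close>, numbers them, so that \<open>z $ idx i\<close> is the coordinate \<open>z_i\<close>.
\<close>

definition log_sum_weight :: "(nat \<Rightarrow> 'n::finite) \<Rightarrow> nat \<Rightarrow> (nat \<Rightarrow> real) \<Rightarrow> complex^'n \<Rightarrow> ereal" where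
  "log_sum_weight idx m a z = ext_ln (\<Sum>i=1..m. norm (z $ idx i) powr a i)"

end

theory Submission
  imports Defs "HOL-Complex_Analysis.Complex_Analysis" "HOL-Computational_Algebra.Fundamental_Theorem_Algebra"
begin

unbundle no fps_syntax

text \<open>
  Put \<open>S = \<Sum> \<bar>z\<^sub>i\<bar> powr a\<^sub>i\<close>.  By weighted homogeneity \<open>\<bar>z^\<alpha>\<bar>\<^sup>2 / S\<^sup>2\<close> is locally integrable at the
  origin iff \<open>\<Sum> (\<alpha>\<^sub>i + 1) / a\<^sub>i > 1\<close>.

  If the equation has no solution, rational exponents slightly below \<open>a\<^sub>i\<close> put the same monomials on
  each side of this threshold.  Multiplier ideals of toric weights are determined by monomials:
  averaging over roots of unity splits a function into pieces that are, to leading order, a monomial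
  times a function of the remaining coordinates.

  Conversely, let \<open>\<Sum> x\<^sub>i / a\<^sub>i = 1\<close> and let \<open>\<psi> = c log \<Sum> \<bar>f\<^sub>j\<bar>\<^sup>2 + O(1)\<close> be the first approximant.  Since
  \<open>\<psi>\<close> lies above the weight, some \<open>f\<^sub>j\<close> has order at most \<open>a\<^sub>i / 2c\<close> on the \<open>i\<close>-th axis.  If the order is
  strictly smaller for some \<open>i\<close>, then off a set whose relative volume is a power of \<open>S\<close> the density
  \<open>exp (- 2\<psi>)\<close> is smaller than \<open>1 / S\<^sup>2\<close> by a power of \<open>S\<close>, so \<open>z^(x - 1)\<close> lies in the multiplier
  ideal of \<open>\<psi>\<close> but not in that of the weight.
  Hence all orders are equal to \<open>a\<^sub>i / 2c\<close>, and the exponents are commensurable.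
\<close>

section \<open>Lebesgue measure on complex vectors\<close>

text \<open>At the critical value \<open>\<Sum> x\<^sub>i / a\<^sub>i = 1\<close> the integral of
  the squared monomial diverges only because the shells \<open>S \<approx> exp (- k)\<close>
  contribute comparable amounts. Any gain of a power of \<open>S\<close> restores convergence. This
  is why a strictly smaller order on a single axis is fatal, and why the first approximant and the
  stalk at the origin suffice for the converse.

  The obstacle in the other direction is to reach monomials from a function at every point where the
  first \<open>m\<close> coordinates vanish. Averaging over \<open>N\<close>-th roots of unity, with
  \<open>N\<close> larger than every exponent, needs only finite sums and one-variable Taylor
  expansions. What it fails to separate carries an extra factor \<open>z\<^sub>i ^ N\<close>, and
  since \<open>N > a\<^sub>i\<close> this factor alone gives integrability. The leading coefficient
  is not a number but a function of the remaining coordinates, so integrability is tested near each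
  point of the singular locus separately, with constants independent of that point.\<close>

definition upd :: "complex^'n \<Rightarrow> 'n \<Rightarrow> complex \<Rightarrow> complex^'n" where
  "upd z l w = (\<chi> k. if k = l then w else z $ k)"

lemma upd_nth [simp]: "upd z l w $ k = (if k = l then w else z $ k)"
  by (simp add: upd_def)

lemma upd_same [simp]: "upd z l (z $ l) = z"
  by (simp add: vec_eq_iff)

lemma upd_upd [simp]: "upd (upd z l v) l w = upd z l w"
  by (simp add: vec_eq_iff)

lemma measurable_vec_lambda_PiM:
  "(\<lambda>f. \<chi> k::'n::finite. f k) \<in> borel_measurable (\<Pi>\<^sub>M k\<in>UNIV. (lborel :: complex measure))"
proof (rule borel_measurable_euclidean_space[THEN iffD2], intro ballI)
  fix b :: "complex^'n" assume "b \<in> Basis"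
  then obtain k u where b: "b = axis k u" "u \<in> Basis" by (auto simp: Basis_vec_def)
  have "(\<lambda>f. f k) \<in> borel_measurable (\<Pi>\<^sub>M k\<in>(UNIV::'n set). (lborel :: complex measure))"
    by measurable
  then show "(\<lambda>f. (\<chi> k::'n. f k) \<bullet> b) \<in> borel_measurable (\<Pi>\<^sub>M k\<in>UNIV. (lborel :: complex measure))"
    by (simp add: b inner_axis) 
qed

lemma prod_Basis_vec:
  fixes g :: "complex^'n::finite \<Rightarrow> real"
  shows "(\<Prod>b\<in>Basis. g b) = (\<Prod>k\<in>UNIV. \<Prod>u\<in>Basis. g (axis k u))"
proof -
  have eq: "(Basis :: (complex^'n) set) = (\<lambda>(k,u). axis k u) ` (UNIV \<times> Basis)"
    by (auto simp: Basis_vec_def)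
  have inj: "inj_on (\<lambda>(k,u). axis k u :: complex^'n) (UNIV \<times> Basis)"
    by (auto simp: inj_on_def axis_eq_axis)
  show ?thesis unfolding eq prod.reindex[OF inj] by (simp add: prod.cartesian_product case_prod_unfold)
qed

text \<open>A box in \<open>complex^'n\<close> is a product of planar boxes, so the product measure
  assigns it the correct volume. The identity gives access to Fubini one coordinate at a
  time.\<close>

lemma lborel_eq_distr_PiM:
  "(lborel :: (complex^'n::finite) measure) =
     distr (\<Pi>\<^sub>M k\<in>UNIV. lborel) borel (\<lambda>f. \<chi> k. f k)"
proof (rule lborel_eqI)
  fix l u :: "complex^'n" assume le: "\<And>b. b \<in> Basis \<Longrightarrow> l \<bullet> b \<le> u \<bullet> b"
  interpret product_sigma_finite "\<lambda>k::'n. (lborel :: complex measure)" ..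
  have le2: "l $ k \<bullet> b \<le> u $ k \<bullet> b" if "b \<in> Basis" for k b
    using le[of "axis k b"] that by (simp add: inner_axis axis_in_Basis_iff)
  have eq: "(\<lambda>f. \<chi> k. f k) -` box l u \<inter> space (\<Pi>\<^sub>M k\<in>(UNIV::'n set). (lborel::complex measure)) = (\<Pi>\<^sub>E k\<in>UNIV. box (l $ k) (u $ k))"
    by (auto simp: box_def space_PiM Basis_vec_def inner_axis PiE_iff)
  have "emeasure (distr (\<Pi>\<^sub>M k\<in>UNIV. lborel) borel (\<lambda>f. \<chi> k. f k)) (box l u)
      = (\<Prod>k\<in>UNIV. emeasure lborel (box (l $ k) (u $ k)))"
    by (subst emeasure_distr) (auto simp: measurable_vec_lambda_PiM eq intro!: emeasure_PiM)
  also have "\<dots> = ennreal (\<Prod>b\<in>Basis. (u - l) \<bullet> b)"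
    unfolding prod_Basis_vec using le2
    by (subst prod_ennreal[symmetric]) (auto simp: inner_diff_left inner_axis emeasure_lborel_box intro!: prod_nonneg prod.cong)
  finally show "emeasure (distr (\<Pi>\<^sub>M k\<in>UNIV. lborel) borel (\<lambda>f. \<chi> k. f k)) (box l u) = (\<Prod>b\<in>Basis. (u - l) \<bullet> b)" .
qed simp

lemma product_set_borel:
  assumes "\<And>k. A k \<in> sets borel"
  shows "{z :: complex^'n::finite. \<forall>k. z $ k \<in> A k} \<in> sets borel"
proof -
  have nm: "(\<lambda>z::complex^'n. z $ k) \<in> borel_measurable borel" for k
    by (intro borel_measurable_continuous_onI continuous_intros)
  have "{z :: complex^'n. \<forall>k. z $ k \<in> A k} = (\<Inter>k. (\<lambda>z. z $ k) -` A k)" by auto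
  also have "\<dots> \<in> sets borel"
    using measurable_sets[OF nm assms] by auto
  finally show ?thesis .
qed

lemma emeasure_lborel_product:
  assumes "\<And>k. A k \<in> sets borel"
  shows "emeasure lborel {z :: complex^'n::finite. \<forall>k. z $ k \<in> A k} = (\<Prod>k\<in>UNIV. emeasure lborel (A k))"
proof -
  interpret product_sigma_finite "\<lambda>k::'n. (lborel :: complex measure)" ..
  have m: "{z :: complex^'n. \<forall>k. z $ k \<in> A k} \<in> sets borel" by (rule product_set_borel[OF assms])
  have eq: "(\<lambda>f. \<chi> k. f k) -` {z :: complex^'n. \<forall>k. z $ k \<in> A k} \<inter> space (\<Pi>\<^sub>M k\<in>(UNIV::'n set). (lborel::complex measure)) = (\<Pi>\<^sub>E k\<in>UNIV. A k)"
    by (auto simp: space_PiM PiE_iff)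
  have "emeasure lborel {z :: complex^'n. \<forall>k. z $ k \<in> A k}
      = emeasure (distr (\<Pi>\<^sub>M k\<in>UNIV. lborel) borel (\<lambda>f. \<chi> k::'n. f k)) {z :: complex^'n. \<forall>k. z $ k \<in> A k}"
    by (subst lborel_eq_distr_PiM) (rule refl)
  also have "\<dots> = emeasure (\<Pi>\<^sub>M k\<in>(UNIV::'n set). (lborel::complex measure)) (\<Pi>\<^sub>E k\<in>UNIV. A k)"
    unfolding eq[symmetric] by (rule emeasure_distr[OF measurable_vec_lambda_PiM]) (simp add: m)
  also have "\<dots> = (\<Prod>k\<in>UNIV. emeasure lborel (A k))"
    by (rule emeasure_PiM) (use assms in auto)
  finally show ?thesis .
qed

text \<open>Fubini with the \<open>i\<close>-th coordinate innermost: each slice has measure at most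
  \<open>\<kappa>\<close>, and it is empty as soon as another coordinate \<open>k\<close> leaves
  \<open>B k\<close>. It serves for sets whose slices lie near the zeros of a polynomial.\<close>

lemma emeasure_slice_le:
  fixes A :: "(complex^'n::finite) set"
  assumes A: "A \<in> sets borel" and sub: "\<And>z k. z \<in> A \<Longrightarrow> k \<noteq> i \<Longrightarrow> z $ k \<in> B k"
    and B: "\<And>k. B k \<in> sets borel"
    and slice: "\<And>z. emeasure lborel {w. upd z i w \<in> A} \<le> \<kappa>"
  shows "emeasure lborel A \<le> \<kappa> * (\<Prod>k\<in>UNIV-{i}. emeasure lborel (B k))"
proof -
  interpret product_sigma_finite "\<lambda>k::'n. (lborel :: complex measure)" ..
  let ?J = "UNIV - {i}"
  have U: "UNIV = insert i ?J" by auto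
  have "emeasure lborel A = (\<integral>\<^sup>+ f. indicator A (\<chi> k. f k) \<partial>(\<Pi>\<^sub>M k\<in>UNIV. lborel))"
    apply (subst lborel_eq_distr_PiM)
    apply (subst nn_integral_indicator[symmetric])
    using A apply simp
    apply (subst nn_integral_distr)
    using A apply (simp_all add: measurable_vec_lambda_PiM)
    done
  also have "\<dots> = (\<integral>\<^sup>+ f. indicator A (\<chi> k. f k) \<partial>(\<Pi>\<^sub>M k\<in>insert i ?J. lborel))"
    using U by simp
  also have "\<dots> = (\<integral>\<^sup>+ x. (\<integral>\<^sup>+ w. indicator A (\<chi> k. (x(i := w)) k) \<partial>lborel) \<partial>(\<Pi>\<^sub>M k\<in>?J. lborel))"
  proof (rule product_nn_integral_insert)
    show "(\<lambda>f. indicator A (\<chi> k. f k)) \<in> borel_measurable (\<Pi>\<^sub>M k\<in>insert i ?J. lborel :: complex measure)"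
      using U measurable_compose[OF measurable_vec_lambda_PiM borel_measurable_indicator[OF A]] by metis
  qed auto
  also have "\<dots> \<le> (\<integral>\<^sup>+ x. \<kappa> * (\<Prod>k\<in>?J. indicator (B k) (x k)) \<partial>(\<Pi>\<^sub>M k\<in>?J. lborel))"
  proof (rule nn_integral_mono)
    fix x :: "'n \<Rightarrow> complex"
    let ?z = "(\<chi> k. x k) :: complex^'n"
    have e: "(\<chi> k. (x(i := w)) k) = upd ?z i w" for w by (simp add: vec_eq_iff)
    show "(\<integral>\<^sup>+ w. indicator A (\<chi> k. (x(i := w)) k) \<partial>lborel) \<le> \<kappa> * (\<Prod>k\<in>?J. indicator (B k) (x k))"
    proof (cases "\<forall>k\<in>?J. x k \<in> B k")
      case True
      have c: "{w. upd ?z i w \<in> A} \<in> sets borel"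
      proof -
        have "(\<lambda>w. upd ?z i w) \<in> borel_measurable borel"
          unfolding upd_def
            by (intro borel_measurable_continuous_onI continuous_on_vec_lambda) (case_tac "k = i", auto intro!: continuous_intros)
        from measurable_sets[OF this A] show ?thesis by (simp add: vimage_def)
      qed
      have "(\<integral>\<^sup>+ w. indicator A (upd ?z i w) \<partial>lborel) = (\<integral>\<^sup>+ w. indicator {w. upd ?z i w \<in> A} w \<partial>lborel)"
        by (auto intro!: nn_integral_cong simp: indicator_def)
      also have "\<dots> = emeasure lborel {w. upd ?z i w \<in> A}" using c by simp
      finally show ?thesis unfolding e using slice[of ?z] True by simp
    next
      case False
      then obtain k where k: "k \<noteq> i" "x k \<notin> B k" by auto
      then have "upd ?z i w \<notin> A" for w using sub[of "upd ?z i w" k] by auto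
      then show ?thesis unfolding e by simp
    qed
  qed
  also have "\<dots> = \<kappa> * (\<integral>\<^sup>+ x. (\<Prod>k\<in>?J. indicator (B k) (x k)) \<partial>(\<Pi>\<^sub>M k\<in>?J. lborel))"
  proof (rule nn_integral_cmult, rule borel_measurable_prod_ennreal)
    fix k assume "k \<in> ?J"
    then show "(\<lambda>x. indicator (B k) (x k)) \<in> borel_measurable (\<Pi>\<^sub>M k\<in>?J. lborel)"
      by (intro measurable_compose[OF measurable_component_singleton borel_measurable_indicator]) (auto simp: B)
  qed
  also have "\<dots> = \<kappa> * (\<Prod>k\<in>?J. emeasure lborel (B k))"
    using B by (subst product_nn_integral_prod) auto
  finally show ?thesis .
qed

section \<open>Rotation invariance of Lebesgue measure\<close>

lemma lborel_complex_eq_distr: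
  "(lborel :: complex measure) = distr (lborel :: (real^2) measure) borel (\<lambda>v. Complex (v $ 1) (v $ 2))"
proof (rule lborel_eqI)
  have m: "(\<lambda>v::real^2. Complex (v $ 1) (v $ 2)) \<in> borel_measurable borel"
    by (intro borel_measurable_continuous_onI continuous_intros)
  fix l u :: complex assume le: "\<And>b. b \<in> Basis \<Longrightarrow> l \<bullet> b \<le> u \<bullet> b"
  let ?l = "vector [Re l, Im l] :: real^2" and ?u = "vector [Re u, Im u] :: real^2"
  have eq: "(\<lambda>v. Complex (v $ 1) (v $ 2)) -` box l u = box ?l ?u"
    by (auto simp: box_def Basis_complex_def Basis_vec_def inner_axis forall_2)
  have "emeasure lborel (box ?l ?u) = (\<Prod>b\<in>Basis. (?u - ?l) \<bullet> b)"
  proof (rule emeasure_lborel_box)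
    fix b :: "real^2" assume "b \<in> Basis"
    then have "b = axis 1 1 \<or> b = axis 2 1" by (auto simp: Basis_vec_def) (metis exhaust_2)
    then show "?l \<bullet> b \<le> ?u \<bullet> b"
      using le[of 1] le[of \<i>] by (auto simp: inner_axis Basis_complex_def)
  qed
  also have "(\<Prod>b\<in>Basis. (?u - ?l) \<bullet> b) = (\<Prod>b\<in>Basis. (u - l) \<bullet> b)"
  proof -
    have B: "(Basis :: (real^2) set) = {axis 1 1, axis 2 1}"
      by (auto simp: Basis_vec_def) (metis exhaust_2)
    have ne: "axis 1 1 \<noteq> (axis 2 1 :: real^2)" by (simp add: axis_eq_axis)
    show ?thesis unfolding B Basis_complex_def using ne by (simp add: inner_axis inner_diff_left)
  qed
  finally show "emeasure (distr (lborel :: (real^2) measure) borel (\<lambda>v. Complex (v $ 1) (v $ 2))) (box l u) = (\<Prod>b\<in>Basis. (u - l) \<bullet> b)"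
    using m by (simp add: emeasure_distr eq)
qed simp

text \<open>Read in \<open>real^2\<close>, multiplication by a unimodular number is an orthogonal
  map, and the set on the left is the image of the box under multiplication by
  \<open>inverse \<omega>\<close>; orthogonal maps preserve volume.\<close>

lemma emeasure_lborel_complex_rotate:
  fixes \<omega> :: complex
  assumes "norm \<omega> = 1"
  shows "emeasure lborel {w. \<omega> * w \<in> box l u} = emeasure lborel (box l u)"
proof -
  define \<iota> :: "real^2 \<Rightarrow> complex" where "\<iota> v = Complex (v $ 1) (v $ 2)" for v
  define \<kappa> :: "complex \<Rightarrow> real^2" where "\<kappa> w = vector [Re w, Im w]" for w
  have [simp]: "\<iota> (\<kappa> w) = w" "\<kappa> (\<iota> v) = v" for w v
    by (simp_all add: \<iota>_def \<kappa>_def vec_eq_iff forall_2)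
  have m: "\<iota> \<in> borel_measurable borel"
    unfolding \<iota>_def by (intro borel_measurable_continuous_onI continuous_intros)
  have E: "emeasure lborel S = emeasure lborel (\<iota> -` S)" if "S \<in> sets borel" for S
    by (subst lborel_complex_eq_distr) (use m that in \<open>simp add: emeasure_distr \<iota>_def[abs_def]\<close>)
  define T where "T v = \<kappa> (inverse \<omega> * \<iota> v)" for v
  have nm: "norm (\<kappa> w) = norm w" for w
    by (simp add: \<kappa>_def norm_vec_def L2_set_def sum_2 cmod_def)
  have nm2: "norm (\<iota> v) = norm v" for v
    using nm[of "\<iota> v"] by simp
  have lin: "linear T"
    by (rule linearI) (simp_all add: T_def \<kappa>_def \<iota>_def vec_eq_iff forall_2 algebra_simps add_divide_distrib)
  have T: "orthogonal_transformation T"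
    unfolding orthogonal_transformation using lin assms by (simp add: T_def nm nm2 norm_mult norm_inverse)
  let ?B = "box l u" and ?C = "{w. \<omega> * w \<in> box l u}"
  have \<omega>: "\<omega> \<noteq> 0" using assms by auto
  have mC: "?C \<in> sets borel"
    using measurable_sets[of "\<lambda>w. \<omega> * w" borel borel ?B] by (simp add: vimage_def)
  have img: "\<iota> -` ?C = T ` (\<iota> -` ?B)"
  proof (intro set_eqI iffI)
    fix v assume "v \<in> \<iota> -` ?C"
    then have "\<kappa> (\<omega> * \<iota> v) \<in> \<iota> -` ?B" "v = T (\<kappa> (\<omega> * \<iota> v))"
      using \<omega> by (auto simp: T_def field_simps)
    then show "v \<in> T ` (\<iota> -` ?B)" by blast
  next
    fix v assume "v \<in> T ` (\<iota> -` ?B)"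
    then show "v \<in> \<iota> -` ?C" using \<omega> by (auto simp: T_def field_simps)
  qed
  have sB: "\<iota> -` ?B \<in> sets borel" and sC: "\<iota> -` ?C \<in> sets borel"
    using measurable_sets[OF m] measurable_sets[OF m mC] by auto
  have fB: "emeasure lborel (\<iota> -` ?B) < \<infinity>"
    by (subst E[symmetric]) (use emeasure_bounded_finite[OF bounded_box, of l u] in simp_all)
  have lB: "\<iota> -` ?B \<in> lmeasurable"
    using sB fB by (intro fmeasurableI) (auto)
  have lC: "\<iota> -` ?C \<in> lmeasurable"
    unfolding img by (rule measurable_orthogonal_image[OF T lB])
  have "emeasure lebesgue (\<iota> -` ?C) = emeasure lebesgue (\<iota> -` ?B)"
    using measure_orthogonal_image[OF T lB] lB lC unfolding img
    by (metis emeasure_eq_measure2)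
  then show ?thesis using E mC sB sC by simp
qed

text \<open>The preimage of a box is a product whose \<open>i\<close>-th factor is a rotated
  rectangle, in general not a box; hence the product formula for arbitrary Borel factors.\<close>

lemma lborel_distr_rotate:
  fixes i :: "'n::finite"
  assumes "norm \<omega> = 1"
  shows "distr lborel borel (\<lambda>z :: complex^'n. upd z i (\<omega> * z $ i)) = lborel"
proof (rule lborel_eqI[symmetric])
  have m: "(\<lambda>z :: complex^'n. upd z i (\<omega> * z $ i)) \<in> borel_measurable borel"
    unfolding upd_def
    by (intro borel_measurable_continuous_onI continuous_on_vec_lambda) (case_tac "k = i", auto intro!: continuous_intros)
  fix l u :: "complex^'n" assume le: "\<And>b. b \<in> Basis \<Longrightarrow> l \<bullet> b \<le> u \<bullet> b"
  let ?A = "\<lambda>k. if k = i then {w. \<omega> * w \<in> box (l $ i) (u $ i)} else box (l $ k) (u $ k)"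
  have bx: "box l u = {z. \<forall>k. z $ k \<in> box (l $ k) (u $ k)}"
    by (auto simp: box_def Basis_vec_def inner_axis)
  have bx2: "(\<lambda>z. upd z i (\<omega> * z $ i)) -` box l u = {z :: complex^'n. \<forall>k. z $ k \<in> ?A k}"
    unfolding bx by auto
  have mA: "?A k \<in> sets borel" for k
    using measurable_sets[of "\<lambda>w. \<omega> * w" borel borel "box (l $ i) (u $ i)"] by (simp add: vimage_def)
  have "emeasure (distr lborel borel (\<lambda>z. upd z i (\<omega> * z $ i))) (box l u) = emeasure lborel {z :: complex^'n. \<forall>k. z $ k \<in> ?A k}"
    by (subst emeasure_distr) (use m in \<open>auto simp: bx[symmetric] bx2\<close>)
  also have "\<dots> = (\<Prod>k\<in>UNIV. emeasure lborel (?A k))"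
    by (rule emeasure_lborel_product[OF mA])
  also have "\<dots> = (\<Prod>k\<in>UNIV. emeasure lborel (box (l $ k) (u $ k)))"
    by (intro prod.cong) (auto simp: emeasure_lborel_complex_rotate[OF assms])
  also have "\<dots> = emeasure lborel {z :: complex^'n. \<forall>k. z $ k \<in> box (l $ k) (u $ k)}"
    by (subst emeasure_lborel_product) auto
  also have "\<dots> = ennreal (\<Prod>b\<in>Basis. (u - l) \<bullet> b)"
    unfolding bx[symmetric] using le by simp
  finally show "emeasure (distr lborel borel (\<lambda>z :: complex^'n. upd z i (\<omega> * z $ i))) (box l u) = (\<Prod>b\<in>Basis. (u - l) \<bullet> b)" .
qed simp

lemma nn_integral_rotate:
  fixes i :: "'n::finite" and F :: "complex^'n \<Rightarrow> ennreal"
  assumes "norm \<omega> = 1" and F: "F \<in> borel_measurable borel"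
  shows "(\<integral>\<^sup>+ z. F (upd z i (\<omega> * z $ i)) \<partial>lborel) = (\<integral>\<^sup>+ z. F z \<partial>lborel)"
proof -
  have m: "(\<lambda>z :: complex^'n. upd z i (\<omega> * z $ i)) \<in> borel_measurable borel"
    unfolding upd_def
    by (intro borel_measurable_continuous_onI continuous_on_vec_lambda) (case_tac "k = i", auto intro!: continuous_intros)
  show ?thesis
    by (subst (2) lborel_distr_rotate[OF assms(1), of i, symmetric], subst nn_integral_distr) (use m F in auto)
qed

section \<open>Plurisubharmonicity of toric weights\<close>

text \<open>For \<open>x \<le> 0\<close> the values of \<open>f\<close> eventually fall below every
  \<open>exp r\<close>, so those of \<open>ext_ln\<close> fall below every \<open>r\<close>. Thus
  \<open>ext_ln\<close> is continuous on the whole line, including the point zero.\<close>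

lemma tendsto_ext_ln:
  assumes "(f \<longlongrightarrow> x) F"
  shows "((\<lambda>t. ext_ln (f t)) \<longlongrightarrow> ext_ln x) F"
proof (cases "0 < x")
  case True
  have "((\<lambda>t. ereal (ln (f t))) \<longlongrightarrow> ereal (ln x)) F"
    using assms True by (intro tendsto_ereal tendsto_ln) auto
  moreover have "\<forall>\<^sub>F t in F. ereal (ln (f t)) = ext_ln (f t)"
    using order_tendstoD(1)[OF assms True] by eventually_elim (simp add: ext_ln_def)
  ultimately have "((\<lambda>t. ext_ln (f t)) \<longlongrightarrow> ereal (ln x)) F"
    by (rule Lim_transform_eventually)
  then show ?thesis using True by (simp add: ext_ln_def)
next
  case False
  have "\<forall>\<^sub>F t in F. ext_ln (f t) < ereal r" for r
  proof -
    have "x < exp r" using False exp_gt_zero[of r] by linarith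
    from order_tendstoD(2)[OF assms this] show ?thesis
    proof eventually_elim
      case (elim t)
      then have "0 < f t \<Longrightarrow> ln (f t) < r" by (metis exp_gt_zero ln_exp ln_less_cancel_iff)
      then show ?case by (simp add: ext_ln_def)
    qed
  qed
  then show ?thesis using False by (simp add: ext_ln_def tendsto_MInfty)
qed

lemma continuous_on_ext_ln [continuous_intros]:
  "continuous_on S f \<Longrightarrow> continuous_on S (\<lambda>t. ext_ln (f t))"
  unfolding continuous_on_def using tendsto_ext_ln by blast

lemma ext_ln_mono: "x \<le> y \<Longrightarrow> ext_ln x \<le> ext_ln y"
  by (auto simp: ext_ln_def)

lemma borel_measurable_ext_ln [measurable]: "ext_ln \<in> borel_measurable borel"
  by (intro borel_measurable_continuous_onI continuous_on_ext_ln continuous_on_id)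

text \<open>The mean value property at the centre of the unit circle for
  \<open>Ln (1 + q * z)\<close>, which vanishes at \<open>z = 0\<close>, followed by taking real
  parts. The bound on \<open>q\<close> keeps \<open>1 + q * z\<close> in the right half plane, away
  from the branch cut.\<close>

lemma has_integral_ln_norm_one_plus:
  assumes "norm q < 1"
  shows "((\<lambda>\<theta>. ln (norm (1 + q * cis \<theta>))) has_integral 0) {0..2*pi}"
proof -
  have nz: "1 + q * z \<noteq> 0 \<and> Re (1 + q * z) > 0" if "norm z \<le> 1" for z
  proof -
    have "norm (q * z) < 1" using assms that
      by (metis mult.commute mult_left_le_one_le norm_ge_zero norm_mult order.strict_trans1)
    then have "\<bar>Re (q * z)\<bar> < 1" using abs_Re_le_cmod order.strict_trans1 by blast
    then show ?thesis by (auto simp: complex_eq_iff)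
  qed
  have nz2: "1 + q * z \<notin> \<real>\<^sub>\<le>\<^sub>0" if "norm z \<le> 1" for z
    using nz[OF that] by (auto simp: complex_nonpos_Reals_iff)
  have c: "continuous_on (cball 0 1) (\<lambda>z. Ln (1 + q * z))"
    using nz2 by (intro continuous_intros) auto
  have h: "(\<lambda>z. Ln (1 + q * z)) holomorphic_on ball 0 1"
    using nz2 by (intro holomorphic_intros) auto
  have "((\<lambda>u. Ln (1 + q * u) / (u - 0)) has_contour_integral (2 * of_real pi * \<i> * Ln (1 + q * 0))) (circlepath 0 1)"
    by (rule Cauchy_integral_circlepath[OF c h]) simp
  then have "((\<lambda>t. \<i> * Ln (1 + q * cis t)) has_integral 0) {0..2*pi}"
    unfolding circlepath_def by (subst (asm) has_contour_integral_part_circlepath_iff) (auto simp: field_simps)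
  from has_integral_mult_right[OF this, of "-\<i>"]
  have "((\<lambda>t. Ln (1 + q * cis t)) has_integral 0) {0..2*pi}"
    by (simp add: mult.assoc[symmetric])
  from has_integral_linear[OF this bounded_linear_Re]
  have "((\<lambda>t. Re (Ln (1 + q * cis t))) has_integral 0) {0..2*pi}"
    by (simp add: o_def)
  then show ?thesis
    by (rule has_integral_eq[rotated]) (use nz in \<open>auto simp: Re_Ln\<close>)
qed

text \<open>The larger of the two terms is factored out. If it is \<open>p\<close>, the mean value
  is exactly \<open>ln (norm p)\<close>; if it is \<open>w\<close>, it is
  \<open>ln (norm w)\<close>, which is larger. With equal moduli the circle may pass through zero;
  such circles are reached later by a limit.\<close>

lemma ln_norm_mean_value:
  assumes "p \<noteq> 0" and "norm p \<noteq> norm w"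
  obtains J where "((\<lambda>\<theta>. ln (norm (p + cis \<theta> * w))) has_integral J) {0..2*pi}"
    "2 * pi * ln (norm p) \<le> J" and "\<And>\<theta>. p + cis \<theta> * w \<noteq> 0"
proof -
  have ne: "p + cis \<theta> * w \<noteq> 0" for \<theta>
  proof
    assume "p + cis \<theta> * w = 0"
    then have "p = - (cis \<theta> * w)" by (simp add: eq_neg_iff_add_eq_0)
    then show False using assms(2) by (simp add: norm_mult)
  qed
  have const: "((\<lambda>\<theta>. c + f \<theta>) has_integral 2 * pi * c) {0..2*pi}" if "(f has_integral 0) {0..2*pi}" for c :: real and f
    using has_integral_add[OF has_integral_const_real[of c 0 "2*pi"] that] by simp
  show ?thesis
  proof (cases "norm w < norm p")
    case True
    let ?q = "w / p"
    have q: "norm ?q < 1" using True assms(1) by (simp add: norm_divide)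
    have "ln (norm (p + cis \<theta> * w)) = ln (norm p) + ln (norm (1 + ?q * cis \<theta>))" for \<theta>
    proof -
      have e: "p + cis \<theta> * w = p * (1 + ?q * cis \<theta>)" using assms(1) by (simp add: field_simps)
      then have "1 + ?q * cis \<theta> \<noteq> 0" using ne[of \<theta>] by auto
      then show ?thesis unfolding e norm_mult using assms(1) by (simp add: ln_mult)
    qed
    then have "((\<lambda>\<theta>. ln (norm (p + cis \<theta> * w))) has_integral 2 * pi * ln (norm p)) {0..2*pi}"
      using const[OF has_integral_ln_norm_one_plus[OF q], of "ln (norm p)"] by simp
    then show ?thesis using that ne by blast
  next
    case False
    then have lt: "norm p < norm w" and w: "w \<noteq> 0" using assms by auto
    \<comment> \<open>Factoring out \<open>cis \<theta> * w\<close> leaves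
      \<open>cis (-\<theta>)\<close>; conjugation, which does not change the modulus, turns it back
      into \<open>cis \<theta>\<close>.\<close>
    let ?q = "cnj (p / w)"
    have q: "norm ?q < 1" using lt w by (simp add: norm_divide)
    have "ln (norm (p + cis \<theta> * w)) = ln (norm w) + ln (norm (1 + ?q * cis \<theta>))" for \<theta>
    proof -
      have "p + cis \<theta> * w = cis \<theta> * w * (1 + p / w * cis (-\<theta>))"
        using w by (simp add: distrib_left cis_mult mult_ac)
      then have "norm (p + cis \<theta> * w) = norm w * norm (1 + p / w * cis (-\<theta>))"
        by (simp add: norm_mult)
      also have "norm (1 + p / w * cis (-\<theta>)) = norm (cnj (1 + p / w * cis (-\<theta>)))" by (rule complex_mod_cnj[symmetric])
      also have "cnj (1 + p / w * cis (-\<theta>)) = 1 + ?q * cis \<theta>" by (simp add: cis_cnj)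
      finally have e: "norm (p + cis \<theta> * w) = norm w * norm (1 + ?q * cis \<theta>)" .
      then have "1 + ?q * cis \<theta> \<noteq> 0" using ne[of \<theta>] by auto
      then show ?thesis unfolding e using w by (simp add: ln_mult)
    qed
    then have "((\<lambda>\<theta>. ln (norm (p + cis \<theta> * w))) has_integral 2 * pi * ln (norm w)) {0..2*pi}"
      using const[OF has_integral_ln_norm_one_plus[OF q], of "ln (norm w)"] by simp
    moreover have "2 * pi * ln (norm p) \<le> 2 * pi * ln (norm w)"
      using lt assms(1) w by (intro mult_left_mono) simp_all
    ultimately show ?thesis using that ne by blast
  qed
qed

text \<open>The function \<open>M - g\<close> is nonnegative, so its integral needs no splitting and
  can be estimated by Fatou's lemma. Adding the positive part of \<open>g\<close> to it gives
  \<open>M\<close> plus the negative part, and all four integrals are finite, so the difference in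
  \<open>ext_integral\<close> can be recovered.\<close>

lemma ext_integral_lower_bound:
  fixes g :: "real \<Rightarrow> ereal"
  assumes g [measurable]: "g \<in> borel_measurable borel" and M: "0 \<le> M" "\<And>t. g t \<le> ereal M" and ab: "a \<le> b"
    and le: "(\<integral>\<^sup>+ t\<in>{a..b}. e2ennreal (ereal M - g t) \<partial>lborel) \<le> ennreal ((b - a) * (M - L))"
    and LM: "L \<le> M"
  shows "ereal ((b - a) * L) \<le> ext_integral {a..b} g"
proof -
  let ?A = "{a..b}"
  define X where "X = (\<integral>\<^sup>+ t\<in>?A. e2ennreal (ereal M - g t) \<partial>lborel)"
  define P where "P = (\<integral>\<^sup>+ t\<in>?A. e2ennreal (g t) \<partial>lborel)"
  define N where "N = (\<integral>\<^sup>+ t\<in>?A. e2ennreal (- g t) \<partial>lborel)"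
  have pt: "e2ennreal (ereal M - g t) + e2ennreal (g t) = ennreal M + e2ennreal (- g t)" for t
  proof (cases "g t")
    case (real r)
    then have "r \<le> M" using M(2)[of t] by simp
    then show ?thesis using real M(1)
      by (cases "r \<ge> 0") (auto simp: ennreal_neg ennreal_plus[symmetric] simp del: ennreal_plus)
  next
    case PInf then show ?thesis using M(2)[of t] by simp
  next
    case MInf then show ?thesis by (simp add: e2ennreal_neg)
  qed
  have "X + P = (\<integral>\<^sup>+ t. e2ennreal (ereal M - g t) * indicator ?A t + e2ennreal (g t) * indicator ?A t \<partial>lborel)"
    unfolding X_def P_def by (rule nn_integral_add[symmetric]) measurable
  also have "\<dots> = (\<integral>\<^sup>+ t. ennreal M * indicator ?A t + e2ennreal (- g t) * indicator ?A t \<partial>lborel)"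
    by (simp add: pt flip: distrib_right)
  also have "\<dots> = (\<integral>\<^sup>+ t. ennreal M * indicator ?A t \<partial>lborel) + N"
    unfolding N_def by (rule nn_integral_add) measurable
  also have "(\<integral>\<^sup>+ t. ennreal M * indicator ?A t \<partial>lborel) = ennreal (M * (b - a))"
    using ab M by (simp add: nn_integral_cmult_indicator ennreal_mult)
  finally have eq: "X + P = ennreal (M * (b - a)) + N" .
  have "P \<le> (\<integral>\<^sup>+ t. ennreal M * indicator ?A t \<partial>lborel)"
    unfolding P_def using M e2ennreal_mono by (intro nn_integral_mono mult_right_mono) (auto simp flip: e2ennreal_ereal)
  also have "\<dots> < top" using ab by (simp add: nn_integral_cmult_indicator ennreal_mult_less_top)
  finally have P: "P < top" .
  have X: "X < top" using le unfolding X_def[symmetric] by (simp add: order.strict_trans1)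
  have "N < top" using eq P X by (metis ennreal_add_less_top less_top top.not_eq_extremum ennreal_add_eq_top)
  then obtain x p n where r: "X = ennreal x" "0 \<le> x" "P = ennreal p" "0 \<le> p" "N = ennreal n" "0 \<le> n"
    using X P by (metis ennreal_cases less_irrefl)
  have "x + p = M * (b - a) + n"
    using eq r M ab by (simp flip: ennreal_plus)
  moreover have "x \<le> (b - a) * (M - L)"
    using le ab LM r unfolding X_def[symmetric] by (simp add: ennreal_le_iff)
  ultimately have "(b - a) * L \<le> p - n" by (simp add: algebra_simps)
  moreover have "ext_integral ?A g = ereal (p - n)"
    unfolding ext_integral_def P_def[symmetric] N_def[symmetric] using r by simp
  ultimately show ?thesis by simp
qed

section \<open>Toric weights and the mean value inequality\<close>

definition toric_weight :: "'n set \<Rightarrow> ('n \<Rightarrow> real) \<Rightarrow> complex^'n::finite \<Rightarrow> ereal" where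
  "toric_weight I A z = ext_ln (\<Sum>l\<in>I. norm (z $ l) powr A l)"

lemma continuous_on_sum_powr:
  fixes f :: "'a::topological_space \<Rightarrow> complex^'n::finite"
  assumes "\<forall>l\<in>I. 0 < A l" and f: "continuous_on S f"
  shows "continuous_on S (\<lambda>t. \<Sum>l\<in>I. norm (f t $ l) powr A l)"
  using assms by (intro continuous_on_sum continuous_on_powr' continuous_intros) auto

text \<open>Gibbs' inequality: a tangent of the convex function log-sum-exp lies below it, with
  equality when \<open>S\<close> is the sum and \<open>lam l = x l / S\<close>. It follows from
  \<open>ln t \<le> t - 1\<close> at \<open>t = x l / (lam l * S)\<close>.\<close>

lemma log_sum_tangent:
  fixes x lam :: "'a \<Rightarrow> real"
  assumes "finite J" "\<And>l. l \<in> J \<Longrightarrow> 0 < x l" "\<And>l. l \<in> J \<Longrightarrow> 0 < lam l" "(\<Sum>l\<in>J. lam l) = 1"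
    and S: "(\<Sum>l\<in>J. x l) \<le> S" and J: "J \<noteq> {}"
  shows "(\<Sum>l\<in>J. lam l * (ln (x l) - ln (lam l))) \<le> ln S"
proof -
  have "0 < (\<Sum>l\<in>J. x l)" using assms by (intro sum_pos) auto
  then have S0: "0 < S" using S by simp
  have "(\<Sum>l\<in>J. lam l * (ln (x l) - ln (lam l))) - ln S = (\<Sum>l\<in>J. lam l * (ln (x l) - ln (lam l) - ln S))"
    using assms(4) by (simp add: right_diff_distrib sum_subtractf sum_distrib_right[symmetric])
  also have "\<dots> \<le> (\<Sum>l\<in>J. x l / S - lam l)"
  proof (rule sum_mono)
    fix l assume l: "l \<in> J"
    have "ln (x l) - ln (lam l) - ln S = ln (x l / (lam l * S))"
      using assms(2,3)[OF l] S0 by (simp add: ln_div ln_mult)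
    also have "\<dots> \<le> x l / (lam l * S) - 1"
      using assms(2,3)[OF l] S0 by (intro ln_le_minus_one) simp
    finally have "lam l * (ln (x l) - ln (lam l) - ln S) \<le> lam l * (x l / (lam l * S) - 1)"
      using assms(3)[OF l] by (intro mult_left_mono) auto
    also have "\<dots> = x l / S - lam l" using assms(3)[OF l] S0 by (simp add: field_simps)
    finally show "lam l * (ln (x l) - ln (lam l) - ln S) \<le> x l / S - lam l" .
  qed
  also have "\<dots> = (\<Sum>l\<in>J. x l) / S - 1"
    using assms(4) by (simp add: sum_subtractf sum_divide_distrib)
  also have "\<dots> \<le> 0" using S S0 by simp
  finally show ?thesis by simp
qed

text \<open>
  On a circle avoiding the zeros of the relevant coordinates, the tangent inequality of log-sum-exp at the
  centre reduces the mean value inequality to that of \<open>ln \<bar>p + t w\<bar>\<close>.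
\<close>

lemma toric_weight_circle_bound:
  fixes p w :: "complex^'n::finite" and A :: "'n \<Rightarrow> real" and I
  defines "S \<equiv> \<lambda>z :: complex^'n. \<Sum>l\<in>I. norm (z $ l) powr A l"
  assumes A: "\<forall>l\<in>I. 0 < A l" and Sp: "0 < S p"
    and M: "\<And>\<theta>. S (p + cis \<theta> *s w) \<le> exp M"
    and ne: "\<And>l. l \<in> I \<Longrightarrow> p $ l \<noteq> 0 \<Longrightarrow> norm (p $ l) \<noteq> norm (w $ l)"
  shows "(\<integral>\<^sup>+ \<theta>\<in>{0..2*pi}. e2ennreal (ereal M - ext_ln (S (p + cis \<theta> *s w))) \<partial>lborel)
           \<le> ennreal (2 * pi * (M - ln (S p)))"
proof -
  define J where "J = {l\<in>I. p $ l \<noteq> 0}"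
  \<comment> \<open>These weights make the tangent inequality an equality at \<open>p\<close>, so
    that integrating it loses nothing at the centre.\<close>
  define lam where "lam l = norm (p $ l) powr A l / S p" for l
  have fin: "finite J" by simp
  have SJ: "S p = (\<Sum>l\<in>J. norm (p $ l) powr A l)"
    unfolding S_def J_def by (rule sum.mono_neutral_right) auto
  have Jne: "J \<noteq> {}" using Sp SJ by auto
  have lam: "0 < lam l" if "l \<in> J" for l using that Sp by (simp add: lam_def J_def)
  have lam1: "(\<Sum>l\<in>J. lam l) = 1"
    unfolding lam_def using Sp SJ by (simp flip: sum_divide_distrib)
  have "\<exists>K. ((\<lambda>\<theta>. ln (norm (p $ l + cis \<theta> * w $ l))) has_integral K) {0..2*pi} \<and>
      2 * pi * ln (norm (p $ l)) \<le> K \<and> (\<forall>\<theta>. p $ l + cis \<theta> * w $ l \<noteq> 0)" if "l \<in> J" for l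
  proof -
    have "p $ l \<noteq> 0" "norm (p $ l) \<noteq> norm (w $ l)" using that ne by (auto simp: J_def)
    from ln_norm_mean_value[OF this] show ?thesis by metis
  qed
  then obtain K where K: "\<And>l. l \<in> J \<Longrightarrow> ((\<lambda>\<theta>. ln (norm (p $ l + cis \<theta> * w $ l))) has_integral K l) {0..2*pi}"
      "\<And>l. l \<in> J \<Longrightarrow> 2 * pi * ln (norm (p $ l)) \<le> K l"
      "\<And>l \<theta>. l \<in> J \<Longrightarrow> p $ l + cis \<theta> * w $ l \<noteq> 0"
    by metis
  define h where "h \<theta> = M - (\<Sum>l\<in>J. lam l * (A l * ln (norm (p $ l + cis \<theta> * w $ l)) - ln (lam l)))" for \<theta>
  have SJle: "(\<Sum>l\<in>J. norm (p $ l + cis \<theta> * w $ l) powr A l) \<le> S (p + cis \<theta> *s w)" for \<theta>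
    unfolding S_def by (auto intro!: sum_mono2 simp: J_def)
  have Spos: "0 < S (p + cis \<theta> *s w)" for \<theta>
  proof -
    have "0 < (\<Sum>l\<in>J. norm (p $ l + cis \<theta> * w $ l) powr A l)"
      using K(3) fin Jne by (intro sum_pos) auto
    then show ?thesis using SJle[of \<theta>] by simp
  qed
  have tan: "M - ln (S (p + cis \<theta> *s w)) \<le> h \<theta>" for \<theta>
  proof -
    have "(\<Sum>l\<in>J. lam l * (ln (norm (p $ l + cis \<theta> * w $ l) powr A l) - ln (lam l))) \<le> ln (S (p + cis \<theta> *s w))"
      by (rule log_sum_tangent[OF fin _ lam lam1 SJle Jne]) (use K(3) in auto)
    then show ?thesis unfolding h_def using K(3) by (simp add: ln_powr cong: sum.cong)
  qed
  have h0: "0 \<le> h \<theta>" for \<theta>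
  proof -
    have "ln (S (p + cis \<theta> *s w)) \<le> M" using M[of \<theta>] Spos[of \<theta>] by (metis exp_gt_zero ln_exp ln_le_cancel_iff)
    then show ?thesis using tan[of \<theta>] by simp
  qed
  define H where "H = 2 * pi * M - (\<Sum>l\<in>J. lam l * (A l * K l - 2 * pi * ln (lam l)))"
  have hI: "(h has_integral H) {0..2*pi}"
  proof -
    have c: "((\<lambda>\<theta>. c) has_integral 2 * pi * c) {0..2*pi}" for c :: real
      using has_integral_const_real[of c 0 "2*pi"] by simp
    show ?thesis unfolding h_def[abs_def] H_def
      by (intro has_integral_diff has_integral_sum has_integral_mult_right c K fin)
  qed
  have hm: "h \<in> borel_measurable borel"
    unfolding h_def[abs_def] using K(3) by (intro borel_measurable_continuous_onI continuous_intros) auto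
  have Hle: "H \<le> 2 * pi * (M - ln (S p))"
  proof -
    have "2 * pi * ln (S p) = (\<Sum>l\<in>J. lam l * (2 * pi * ln (S p)))"
      using lam1 by (simp flip: sum_distrib_right)
    also have "\<dots> = (\<Sum>l\<in>J. lam l * (A l * (2 * pi * ln (norm (p $ l))) - 2 * pi * ln (lam l)))"
    proof (rule sum.cong[OF refl])
      fix l assume l: "l \<in> J"
      have e: "ln (lam l) = A l * ln (norm (p $ l)) - ln (S p)"
        unfolding lam_def using l Sp by (simp add: ln_div ln_powr J_def)
      show "lam l * (2 * pi * ln (S p)) = lam l * (A l * (2 * pi * ln (norm (p $ l))) - 2 * pi * ln (lam l))"
        unfolding e by (simp add: algebra_simps)
    qed
    also have "\<dots> \<le> (\<Sum>l\<in>J. lam l * (A l * K l - 2 * pi * ln (lam l)))"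
      using K(2) lam A by (intro sum_mono mult_left_mono diff_right_mono) (auto simp: J_def less_imp_le)
    finally show ?thesis by (simp add: H_def algebra_simps)
  qed
  have "(\<integral>\<^sup>+ \<theta>\<in>{0..2*pi}. e2ennreal (ereal M - ext_ln (S (p + cis \<theta> *s w))) \<partial>lborel)
      \<le> (\<integral>\<^sup>+ \<theta>. ennreal (indicator {0..2*pi} \<theta> * h \<theta>) \<partial>lborel)"
  proof (rule nn_integral_mono)
    fix \<theta> :: real
    show "e2ennreal (ereal M - ext_ln (S (p + cis \<theta> *s w))) * indicator {0..2*pi} \<theta> \<le> ennreal (indicator {0..2*pi} \<theta> * h \<theta>)"
      using tan[of \<theta>] Spos[of \<theta>] by (auto simp: ext_ln_def indicator_def intro!: ennreal_leI)
  qed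
  also have "\<dots> = (\<integral>\<^sup>+ \<theta>. ennreal (h \<theta>) * indicator {0..2*pi} \<theta> \<partial>lborel)"
    by (auto intro!: nn_integral_cong simp: indicator_def)
  also have "\<dots> = ennreal H"
    using hm h0 hI by (intro nn_integral_has_integral_lebesgue') auto
  also have "\<dots> \<le> ennreal (2 * pi * (M - ln (S p)))" using Hle by (rule ennreal_leI)
  finally show ?thesis .
qed

text \<open>The circle bound excludes circles on which a coordinate nonzero at the centre may
  vanish. Circles shrunk by \<open>r k < 1\<close> satisfy its hypothesis for all large
  \<open>k\<close>, and Fatou's lemma for the functions \<open>G k\<close> passes to the full
  radius.\<close>

lemma toric_weight_sub_mean_value:
  fixes p w :: "complex^'n::finite"
  assumes A: "\<forall>l\<in>I. 0 < A l"
  shows "toric_weight I A p \<le> ext_integral {0..2*pi} (\<lambda>\<theta>. toric_weight I A (p + cis \<theta> *s w)) / ereal (2*pi)"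
proof -
  define S where "S z = (\<Sum>l\<in>I. norm (z $ l) powr A l)" for z :: "complex^'n"
  show ?thesis
  proof (cases "0 < S p")
    case False
    then show ?thesis by (simp add: toric_weight_def ext_ln_def S_def)
  next
    case True
    define B where "B = (\<Sum>l\<in>I. (norm (p $ l) + norm (w $ l)) powr A l)"
    \<comment> \<open>The outer maximum secures \<open>0 \<le> M\<close>, as
      \<open>ext_integral_lower_bound\<close> demands.\<close>
    define M where "M = max 0 (ln (max 1 B))"
    have M: "S (p + (of_real r * cis \<theta>) *s w) \<le> exp M" if "\<bar>r\<bar> \<le> 1" for r \<theta>
    proof -
      have "S (p + (of_real r * cis \<theta>) *s w) \<le> B"
        unfolding S_def B_def
      proof (rule sum_mono, rule powr_mono2)
        fix l assume "l \<in> I"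
        show "norm ((p + (of_real r * cis \<theta>) *s w) $ l) \<le> norm (p $ l) + norm (w $ l)"
          using that by (auto intro!: order_trans[OF norm_triangle_ineq] mult_left_le_one_le simp: norm_mult)
      qed (use A in \<open>auto simp: less_imp_le\<close>)
      also have "\<dots> \<le> max 1 B" by simp
      also have "\<dots> = exp (ln (max 1 B))" by simp
      also have "\<dots> \<le> exp M" unfolding M_def by (subst exp_le_cancel_iff) simp
      finally show ?thesis .
    qed
    have M': "S (p + cis \<theta> *s w) \<le> exp M" for \<theta> using M[of 1 \<theta>] by simp
    have M0: "0 \<le> M" by (simp add: M_def)
    define r where "r k = 1 - inverse (real (Suc k))" for k
    have rlim: "r \<longlonglongrightarrow> 1"
      unfolding r_def using tendsto_diff[OF tendsto_const[of 1] LIMSEQ_inverse_real_of_nat] by simp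
    have r01: "0 \<le> r k" "r k < 1" for k by (auto simp: r_def field_simps)
    define G where "G k \<theta> = e2ennreal (ereal M - ext_ln (S (p + (of_real (r k) * cis \<theta>) *s w)))" for k \<theta>
    have Sc: "continuous_on T (\<lambda>t. S (f t))" if "continuous_on T f" for T :: "real set" and f
      unfolding S_def by (rule continuous_on_sum_powr[OF A that])
    have cw: "continuous_on UNIV (\<lambda>\<theta>. p + (c * cis \<theta>) *s w)" for c
      unfolding vector_scalar_mult_def
      by (intro continuous_intros continuous_on_vec_lambda)
    have Sm: "(\<lambda>\<theta>. S (p + (c * cis \<theta>) *s w)) \<in> borel_measurable borel" for c
      by (intro borel_measurable_continuous_onI Sc cw)
    have Gm [measurable]: "G k \<in> borel_measurable borel" for k
      unfolding G_def[abs_def] using Sm by measurable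
    have Glim: "(\<lambda>k. G k \<theta>) \<longlonglongrightarrow> e2ennreal (ereal M - ext_ln (S (p + cis \<theta> *s w)))" for \<theta>
    proof -
      have a: "continuous_on UNIV (\<lambda>s::real. p + (of_real s * cis \<theta>) *s w)"
        unfolding vector_scalar_mult_def by (intro continuous_intros continuous_on_vec_lambda)
      have "isCont (\<lambda>s. S (p + (of_real s * cis \<theta>) *s w)) 1"
        using Sc[OF a] by (simp add: continuous_on_eq_continuous_at)
      from isCont_tendsto_compose[OF this rlim]
      have "(\<lambda>k. S (p + (of_real (r k) * cis \<theta>) *s w)) \<longlonglongrightarrow> S (p + cis \<theta> *s w)" by simp
      from tendsto_ext_ln[OF this]
      have "(\<lambda>k. ereal M - ext_ln (S (p + (of_real (r k) * cis \<theta>) *s w))) \<longlonglongrightarrow> ereal M - ext_ln (S (p + cis \<theta> *s w))"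
        by (intro tendsto_diff_ereal_general) auto
      then show ?thesis unfolding G_def
        by (intro tendsto_e2ennrealI)
    qed
    \<comment> \<open>If the moduli agree at full radius, shrinking separates them at once because
      \<open>r k < 1\<close>; otherwise they differ in the limit and hence eventually.\<close>
    have ev: "\<forall>\<^sub>F k in sequentially. \<forall>l\<in>I. p $ l \<noteq> 0 \<longrightarrow> norm (p $ l) \<noteq> norm ((of_real (r k) *s w) $ l)"
    proof (rule eventually_ball_finite)
      show "\<forall>l\<in>I. \<forall>\<^sub>F k in sequentially. p $ l \<noteq> 0 \<longrightarrow> norm (p $ l) \<noteq> norm ((of_real (r k) *s w) $ l)"
      proof
        fix l
        have lim: "(\<lambda>k. norm ((of_real (r k) *s w) $ l)) \<longlonglongrightarrow> norm (w $ l)"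
          using tendsto_mult[OF rlim tendsto_const[of "norm (w $ l)"]] r01 by (simp add: norm_mult)
        show "\<forall>\<^sub>F k in sequentially. p $ l \<noteq> 0 \<longrightarrow> norm (p $ l) \<noteq> norm ((of_real (r k) *s w) $ l)"
        proof (cases "norm (p $ l) = norm (w $ l)")
          case True
          then have "p $ l \<noteq> 0 \<longrightarrow> norm (p $ l) \<noteq> norm ((of_real (r k) *s w) $ l)" for k
            using r01[of k] by (auto simp: norm_mult)
          then show ?thesis by simp
        next
          case False
          from tendsto_imp_eventually_ne[OF lim False[symmetric]] show ?thesis
            by eventually_elim auto
        qed
      qed
    qed simp
    have "\<forall>\<^sub>F k in sequentially. (\<integral>\<^sup>+ \<theta>\<in>{0..2*pi}. G k \<theta> \<partial>lborel) \<le> ennreal (2 * pi * (M - ln (S p)))"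
      using ev
    proof eventually_elim
      case (elim k)
      have e: "cis \<theta> *s (of_real (r k) *s w) = (of_real (r k) * cis \<theta>) *s w" for \<theta>
        by (simp add: vec_eq_iff mult_ac)
      show ?case unfolding G_def e[symmetric] S_def
      proof (rule toric_weight_circle_bound[OF A])
        show "(\<Sum>l\<in>I. norm ((p + cis \<theta> *s (complex_of_real (r k) *s w)) $ l) powr A l) \<le> exp M" for \<theta>
          using M[of "r k" \<theta>] r01[of k] unfolding e S_def by simp
      qed (use True elim in \<open>auto simp: S_def\<close>)
    qed
    then have "(\<integral>\<^sup>+ \<theta>. liminf (\<lambda>k. G k \<theta> * indicator {0..2*pi} \<theta>) \<partial>lborel) \<le> ennreal (2 * pi * (M - ln (S p)))"
      by (intro order_trans[OF nn_integral_liminf] order_trans[OF Liminf_le_Limsup] Limsup_bounded) auto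
    moreover have "liminf (\<lambda>k. G k \<theta> * indicator {0..2*pi} \<theta>) = e2ennreal (ereal M - ext_ln (S (p + cis \<theta> *s w))) * indicator {0..2*pi} \<theta>" for \<theta>
      using Glim[of \<theta>] by (intro lim_imp_Liminf) (auto simp: indicator_def)
    ultimately have le: "(\<integral>\<^sup>+ \<theta>\<in>{0..2*pi}. e2ennreal (ereal M - ext_ln (S (p + cis \<theta> *s w))) \<partial>lborel) \<le> ennreal (2 * pi * (M - ln (S p)))"
      by simp
    have "S p \<le> exp M" using M[of 0 0] by simp
    then have LM: "ln (S p) \<le> M" using True by (metis exp_gt_zero ln_exp ln_le_cancel_iff)
    have "ereal ((2*pi - 0) * ln (S p)) \<le> ext_integral {0..2*pi} (\<lambda>\<theta>. ext_ln (S (p + cis \<theta> *s w)))"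
    proof (rule ext_integral_lower_bound[OF _ M0])
      show "(\<lambda>\<theta>. ext_ln (S (p + cis \<theta> *s w))) \<in> borel_measurable borel"
        using Sm[of 1] by simp
      show "ext_ln (S (p + cis t *s w)) \<le> ereal M" for t
        using ext_ln_mono[OF M'[of t]] by (simp add: ext_ln_def)
    qed (use le LM in auto)
    then have "ereal (ln (S p)) \<le> ext_integral {0..2*pi} (\<lambda>\<theta>. ext_ln (S (p + cis \<theta> *s w))) / ereal (2*pi)"
      by (subst ereal_le_divide_pos) auto
    then show ?thesis using True by (simp add: toric_weight_def S_def ext_ln_def)
  qed
qed

lemma plurisubharmonic_toric_weight:
  fixes U :: "(complex^'n::finite) set"
  assumes A: "\<forall>l\<in>I. 0 < A l"
  shows "plurisubharmonic_on U (toric_weight I A)"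
proof -
  have c: "continuous_on UNIV (toric_weight I A :: complex^'n \<Rightarrow> ereal)"
    unfolding toric_weight_def by (intro continuous_intros continuous_on_sum_powr A continuous_on_id)
  have "Limsup (at z within U) (toric_weight I A) \<le> toric_weight I A z" for z :: "complex^'n"
  proof (cases "trivial_limit (at z within U)")
    case False
    have "(toric_weight I A \<longlongrightarrow> toric_weight I A z) (at z within U)"
      using continuous_on_subset[OF c] c by (meson UNIV_I continuous_on_def tendsto_within_subset subset_UNIV)
    then show ?thesis using False lim_imp_Limsup by fastforce
  next
    case True
    then show ?thesis unfolding True by (simp add: Limsup_bot)
  qed
  then show ?thesis
    using toric_weight_sub_mean_value[OF A]
    by (auto simp: plurisubharmonic_on_def toric_weight_def ext_ln_def)
qed

section \<open>Integrability of monomials\<close>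

lemma ext_exp_toric:
  "ext_exp (- 2 * ext_ln s) = (if 0 < s then ennreal (1 / s\<^sup>2) else top)"
proof -
  have "exp (- (2 * ln s)) = 1 / s\<^sup>2" if "0 < s"
  proof -
    have "exp (2 * ln s) = s\<^sup>2" unfolding exp_double using that by simp
    then show ?thesis by (simp add: exp_minus inverse_eq_divide)
  qed
  moreover have "- (2 * (-\<infinity>)) = (\<infinity>::ereal)" "- (2::ereal) * -\<infinity> = \<infinity>" by simp_all
  moreover have "-2 * ereal r = ereal (- 2 * r)" for r by (metis numeral_eq_ereal times_ereal.simps(1) uminus_ereal.simps(1))
  ultimately show ?thesis by (simp add: ext_ln_def ext_exp_def)
qed

lemma ext_exp_mono: "x \<le> y \<Longrightarrow> ext_exp x \<le> ext_exp y"
  by (cases x; cases y) (auto simp: ext_exp_def ennreal_leI)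

lemma ext_exp_minus_mono: "x \<le> y \<Longrightarrow> ext_exp (- 2 * y) \<le> ext_exp (- 2 * x)"
  by (intro ext_exp_mono) (cases x; cases y; auto)

lemma AE_nonzero_coordinates:
  fixes c :: "complex^'n::finite"
  shows "AE z in lborel. \<forall>l. z $ l \<noteq> c $ l"
proof -
  have "AE z :: complex^'n in lborel. z $ l \<noteq> c $ l" for l
  proof (rule AE_I)
    have "emeasure lborel {z :: complex^'n. \<forall>k. z $ k \<in> (if k = l then {c $ l} else UNIV)} = 0"
      by (subst emeasure_lborel_product) (auto intro!: prod_zero)
    moreover have "{z :: complex^'n. \<forall>k. z $ k \<in> (if k = l then {c $ l} else UNIV)} = {z. z $ l = c $ l}" by auto
    ultimately show "emeasure lborel {z :: complex^'n. z $ l = c $ l} = 0" by simp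
    have "closed {z :: complex^'n. z $ l = c $ l}" by (intro closed_Collect_eq continuous_intros)
    then show "{z :: complex^'n. z $ l = c $ l} \<in> sets lborel" by simp
  qed auto
  then show ?thesis by (simp add: AE_all_countable)
qed

lemma emeasure_ball_complex: "0 \<le> r \<Longrightarrow> emeasure lborel (ball (c::complex) r) = ennreal (pi * r\<^sup>2)"
  by (simp add: emeasure_ball unit_ball_vol_2)

lemma emeasure_cball_complex: "0 \<le> r \<Longrightarrow> emeasure lborel (cball (c::complex) r) = ennreal (pi * r\<^sup>2)"
  by (simp add: emeasure_cball unit_ball_vol_2)

text \<open>Two families allow two bounds on the same shell: a good bound on a set
  \<open>T k\<close> of full size and a poor one on a small exceptional set \<open>B k\<close>. An
  almost everywhere cover is enough, so points where the weight is \<open>-\<infinity>\<close> can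
  be ignored.\<close>

lemma nn_integral_finite_by_cover:
  fixes F :: "'a \<Rightarrow> ennreal"
  assumes T: "\<And>k::nat. T k \<in> sets M" and B: "\<And>k::nat. B k \<in> sets M"
    and cover: "AE z in M. z \<in> V \<longrightarrow> (\<exists>k. (z \<in> T k \<and> F z \<le> c k) \<or> (z \<in> B k \<and> F z \<le> d k))"
    and c: "\<And>k. c k * emeasure M (T k) \<le> ennreal (g k)" "summable g" "\<And>k. 0 \<le> g k"
    and d: "\<And>k. d k * emeasure M (B k) \<le> ennreal (h k)" "summable h" "\<And>k. 0 \<le> h k"
  shows "(\<integral>\<^sup>+ z\<in>V. F z \<partial>M) < \<infinity>"
proof -
  let ?G = "\<lambda>k z. c k * indicator (T k) z + d k * indicator (B k) z"
  have "(\<integral>\<^sup>+ z\<in>V. F z \<partial>M) \<le> (\<integral>\<^sup>+ z. (\<Sum>k. ?G k z) \<partial>M)"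
  proof (rule nn_integral_mono_AE, use cover in eventually_elim)
    case (elim z)
    show ?case
    proof (cases "z \<in> V")
      case True
      then obtain k where k: "(z \<in> T k \<and> F z \<le> c k) \<or> (z \<in> B k \<and> F z \<le> d k)" using elim by blast
      then have "F z \<le> ?G k z" by (auto simp: indicator_def add_increasing add_increasing2)
      also have "\<dots> = (\<Sum>j\<in>{k}. ?G j z)" by simp
      also have "\<dots> \<le> (\<Sum>k. ?G k z)" by (rule sum_le_suminf) auto
      finally show ?thesis using True by simp
    qed simp
  qed
  also have "\<dots> = (\<Sum>k. \<integral>\<^sup>+ z. ?G k z \<partial>M)"
    using T B by (intro nn_integral_suminf) auto
  also have "\<dots> = (\<Sum>k. c k * emeasure M (T k) + d k * emeasure M (B k))"
    using T B by (intro suminf_cong) (simp add: nn_integral_add nn_integral_cmult_indicator)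
  also have "\<dots> \<le> (\<Sum>k. ennreal (g k + h k))"
    using c d by (intro suminf_le) (auto intro: add_mono)
  also have "\<dots> = ennreal (\<Sum>k. g k + h k)"
    using c d by (intro suminf_ennreal2 summable_add) auto
  also have "\<dots> < \<infinity>" by simp
  finally show ?thesis .
qed

lemma summable_exp_minus:
  assumes "0 < (s::real)" shows "summable (\<lambda>k. C * exp (- s * real k))"
proof -
  have "exp (- s * real k) = exp (- s) ^ k" for k by (metis exp_of_nat_mult mult.commute)
  moreover have "summable (\<lambda>k. exp (- s) ^ k)" using assms by (intro summable_geometric) simp
  ultimately show ?thesis by (simp add: summable_mult)
qed

lemma shell_index:
  assumes "0 < s" "s \<le> exp (- real k0)"
  obtains k where "k0 \<le> k" "exp (- (real k + 1)) < s" "s \<le> exp (- real k)"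
proof -
  define k where "k = nat \<lfloor>- ln s\<rfloor>"
  have "ln s \<le> - real k0" using assms by (metis exp_gt_zero ln_exp ln_le_cancel_iff)
  then have a: "real k0 \<le> - ln s" by simp
  then have "real k \<le> - ln s" "- ln s < real k + 1" "k0 \<le> k" unfolding k_def by linarith+
  then have "s \<le> exp (- real k)" "exp (- (real k + 1)) < s"
    using assms(1) by (smt (verit) exp_le_cancel_iff exp_less_cancel_iff exp_ln)+
  then show ?thesis using that \<open>k0 \<le> k\<close> by blast
qed

lemma powr_le_exp_imp:
  assumes "0 < a" "x powr a \<le> exp (- real k)" "0 \<le> x"
  shows "x \<le> exp (- real k / a)"
proof -
  have "(x powr a) powr (1 / a) \<le> exp (- real k) powr (1 / a)"
    using assms by (intro powr_mono2) auto
  moreover have "(x powr a) powr (1 / a) = x" using assms by (simp add: powr_powr)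
  moreover have "exp (- real k) powr (1 / a) = exp (- real k / a)" by (simp add: powr_def)
  ultimately show ?thesis by simp
qed

text \<open>The condition \<open>\<Sum> \<bar>z\<^sub>l\<bar> powr A l \<le> exp (- k)\<close>
  confines each coordinate in \<open>I\<close> to the given disc. The box is larger than the shell,
  but its volume has the right exponential rate, which is what the sums over \<open>k\<close> depend
  on.\<close>

definition shell_box :: "'n set \<Rightarrow> ('n \<Rightarrow> real) \<Rightarrow> complex^'n::finite \<Rightarrow> real \<Rightarrow> nat \<Rightarrow> (complex^'n) set" where
  "shell_box I A p R k = {z. \<forall>l. z $ l \<in> (if l \<in> I then cball 0 (exp (- real k / A l)) else ball (p $ l) R)}"

lemma shell_box_measurable: "shell_box I A p R k \<in> sets borel"
  unfolding shell_box_def by (rule product_set_borel) auto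

lemma emeasure_shell_box:
  assumes "0 \<le> R"
  shows "emeasure lborel (shell_box I A p R k)
      = ennreal ((\<Prod>l\<in>I. pi) * (\<Prod>l\<in>-I. pi * R\<^sup>2) * exp (- 2 * real k * (\<Sum>l\<in>I. 1 / A l)))"
proof -
  have "emeasure lborel (shell_box I A p R k) = (\<Prod>l\<in>UNIV. emeasure lborel (if l \<in> I then cball 0 (exp (- real k / A l)) else ball (p $ l) R))"
    unfolding shell_box_def by (rule emeasure_lborel_product) auto
  also have "\<dots> = (\<Prod>l\<in>UNIV. ennreal (if l \<in> I then pi * (exp (- real k / A l))\<^sup>2 else pi * R\<^sup>2))"
    using assms by (intro prod.cong) (auto simp: emeasure_ball_complex emeasure_cball_complex)
  also have "\<dots> = ennreal (\<Prod>l\<in>UNIV. (if l \<in> I then pi * (exp (- real k / A l))\<^sup>2 else pi * R\<^sup>2))"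
    by (intro prod_ennreal) auto
  also have "(\<Prod>l\<in>UNIV. (if l \<in> I then pi * (exp (- real k / A l))\<^sup>2 else pi * R\<^sup>2))
      = (\<Prod>l\<in>I. pi * (exp (- real k / A l))\<^sup>2) * (\<Prod>l\<in>-I. pi * R\<^sup>2)"
    by (simp add: prod.If_cases Collect_mem_eq Compl_eq)
  also have "(\<Prod>l\<in>I. pi * (exp (- real k / A l))\<^sup>2) = (\<Prod>l\<in>I. pi) * exp (- 2 * real k * (\<Sum>l\<in>I. 1 / A l))"
    by (simp add: prod.distrib sum_distrib_left exp_sum flip: exp_double)
  finally show ?thesis by (simp add: mult_ac)
qed

text \<open>Summation over shells: squared monomial, density and volume have exponents adding up to
  \<open>- s * k\<close> with \<open>s = 2 * (\<Sum> (\<beta> l + 1) / A l - 1)\<close>, positive by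
  hypothesis. The weight depends only on the coordinates in \<open>I\<close>, so the centre may be
  any of their common zeros.\<close>

lemma toric_monomial_integrable:
  fixes p :: "complex^'n::finite" and \<beta> :: "'n \<Rightarrow> nat"
  assumes A: "\<forall>l\<in>I. 0 < A l" and I: "I \<noteq> {}" and p: "\<forall>l\<in>I. p $ l = 0"
    and sum: "1 < (\<Sum>l\<in>I. (real (\<beta> l) + 1) / A l)"
    and R: "0 < R" and small: "\<And>z :: complex^'n. z \<in> V \<Longrightarrow> (\<Sum>l\<in>I. norm (z $ l) powr A l) \<le> 1"
    and V: "\<And>(z :: complex^'n) l. z \<in> V \<Longrightarrow> l \<notin> I \<Longrightarrow> norm (z $ l - p $ l) < R"
  shows "(\<integral>\<^sup>+ z\<in>V. ennreal ((\<Prod>l\<in>I. norm (z $ l) ^ \<beta> l)\<^sup>2) * ext_exp (- 2 * toric_weight I A z) \<partial>lborel) < \<infinity>"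
proof -
  let ?S = "\<lambda>z::complex^'n. \<Sum>l\<in>I. norm (z $ l) powr A l"
  define c where "c k = exp (- 2 * real k * (\<Sum>l\<in>I. real (\<beta> l) / A l)) * exp (2 * (real k + 1))" for k :: nat
  define K where "K = (\<Prod>l\<in>I. pi) * (\<Prod>l\<in>-I. pi * R\<^sup>2)"
  define s where "s = 2 * ((\<Sum>l\<in>I. (real (\<beta> l) + 1) / A l) - 1)"
  define g where "g k = K * exp 2 * exp (- s * real k)" for k
  have K: "0 \<le> K" unfolding K_def by (intro mult_nonneg_nonneg prod_nonneg) auto
  have s: "0 < s" using sum by (simp add: s_def)
  have g: "summable g" "\<And>k. 0 \<le> g k"
    unfolding g_def using K summable_exp_minus[OF s] by simp_all
  have cm: "ennreal (c k) * emeasure lborel (shell_box I A p R k) \<le> ennreal (g k)" for k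
  proof -
    have "ennreal (c k) * emeasure lborel (shell_box I A p R k) = ennreal (c k * (K * exp (- 2 * real k * (\<Sum>l\<in>I. 1 / A l))))"
      using R by (subst emeasure_shell_box) (auto simp: K_def c_def ennreal_mult')
    also have "c k * (K * exp (- 2 * real k * (\<Sum>l\<in>I. 1 / A l))) = g k"
      unfolding c_def g_def s_def by (simp add: add_divide_distrib sum.distrib algebra_simps flip: exp_add)
    finally show ?thesis by simp
  qed
  \<comment> \<open>One bound suffices here, so both families of the covering lemma are the
    same.\<close>
  have "AE z in lborel. z \<in> V \<longrightarrow> (\<exists>k. (z \<in> shell_box I A p R k \<and>
      ennreal ((\<Prod>l\<in>I. norm (z $ l) ^ \<beta> l)\<^sup>2) * ext_exp (- 2 * toric_weight I A z) \<le> ennreal (c k)) \<or>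
    (z \<in> shell_box I A p R k \<and>
      ennreal ((\<Prod>l\<in>I. norm (z $ l) ^ \<beta> l)\<^sup>2) * ext_exp (- 2 * toric_weight I A z) \<le> ennreal (c k)))"
    using AE_nonzero_coordinates[of 0]
  proof eventually_elim
    case (elim z)
    show ?case
    proof
      assume z: "z \<in> V"
      have S0: "0 < ?S z" using elim I by (intro sum_pos) auto
      obtain k where k: "exp (- (real k + 1)) < ?S z" "?S z \<le> exp (- real k)"
        using shell_index[OF S0, of 0] small[OF z] by auto
      have b: "norm (z $ l) \<le> exp (- real k / A l)" if l: "l \<in> I" for l
      proof (rule powr_le_exp_imp)
        have "norm (z $ l) powr A l \<le> ?S z" using l by (intro member_le_sum) auto
        then show "norm (z $ l) powr A l \<le> exp (- real k)" using k by simp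
      qed (use A l in auto)
      have zb: "z \<in> shell_box I A p R k"
        using b V[OF z] by (auto simp: shell_box_def dist_norm norm_minus_commute)
      have "(\<Prod>l\<in>I. norm (z $ l) ^ \<beta> l) \<le> (\<Prod>l\<in>I. exp (- real k / A l) ^ \<beta> l)"
        using b by (intro prod_mono) (auto intro: power_mono)
      also have "\<dots> = exp (- real k * (\<Sum>l\<in>I. real (\<beta> l) / A l))"
        by (simp add: sum_distrib_left exp_sum flip: exp_of_nat_mult)
          (simp add: mult_ac)
      finally have "(\<Prod>l\<in>I. norm (z $ l) ^ \<beta> l)\<^sup>2 \<le> (exp (- real k * (\<Sum>l\<in>I. real (\<beta> l) / A l)))\<^sup>2"
        by (intro power_mono prod_nonneg) auto
      also have "\<dots> = exp (- 2 * real k * (\<Sum>l\<in>I. real (\<beta> l) / A l))"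
        by (simp add: mult.assoc flip: exp_double)
      finally have 1: "(\<Prod>l\<in>I. norm (z $ l) ^ \<beta> l)\<^sup>2 \<le> exp (- 2 * real k * (\<Sum>l\<in>I. real (\<beta> l) / A l))" .
      have "(exp (- (real k + 1)))\<^sup>2 \<le> (?S z)\<^sup>2" using k by (intro power_mono) auto
      then have "1 / (?S z)\<^sup>2 \<le> 1 / (exp (- (real k + 1)))\<^sup>2" by (intro divide_left_mono) (use S0 in auto)
      also have "\<dots> = exp (2 * (real k + 1))" 
      proof -
        have "(exp (- (real k + 1)))\<^sup>2 = exp (- (2 * (real k + 1)))" by (simp flip: exp_double)
        then show ?thesis by (simp only: exp_minus) (simp add: inverse_eq_divide)
      qed
      finally have 2: "1 / (?S z)\<^sup>2 \<le> exp (2 * (real k + 1))" .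
      have "ennreal ((\<Prod>l\<in>I. norm (z $ l) ^ \<beta> l)\<^sup>2) * ext_exp (- 2 * toric_weight I A z) \<le> ennreal (c k)"
        unfolding toric_weight_def ext_exp_toric using S0 mult_mono[OF 1 2]
        by (simp add: ennreal_leI c_def flip: ennreal_mult')
      then show "\<exists>k. (z \<in> shell_box I A p R k \<and>
      ennreal ((\<Prod>l\<in>I. norm (z $ l) ^ \<beta> l)\<^sup>2) * ext_exp (- 2 * toric_weight I A z) \<le> ennreal (c k)) \<or>
    (z \<in> shell_box I A p R k \<and>
      ennreal ((\<Prod>l\<in>I. norm (z $ l) ^ \<beta> l)\<^sup>2) * ext_exp (- 2 * toric_weight I A z) \<le> ennreal (c k))"
        using zb by blast
    qed
  qed
  then show ?thesis
    by (rule nn_integral_finite_by_cover[rotated 2, OF _ cm g cm g]) (simp_all add: shell_box_measurable)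
qed

text \<open>Disjoint products of annuli \<open>B k\<close>, shrinking anisotropically, each
  contribute at least the same \<open>\<delta>\<close>. Asking only for a lower bound on
  \<open>g\<close> off the coordinate hyperplanes covers functions that merely dominate a monomial
  near a point \<open>p\<close> of the singular locus.\<close>

lemma toric_monomial_not_integrable:
  fixes p :: "complex^'n::finite" and \<beta> :: "'n \<Rightarrow> nat" and g :: "complex^'n \<Rightarrow> complex"
  assumes A: "\<forall>l\<in>I. 0 < A l" and I: "I \<noteq> {}" and p: "\<forall>l\<in>I. p $ l = 0"
    and sum: "(\<Sum>l\<in>I. (real (\<beta> l) + 1) / A l) \<le> 1"
    and V: "open V" "p \<in> V" and c0: "0 < c0"
    and lower: "\<And>z. z \<in> V \<Longrightarrow> \<forall>l\<in>I. z $ l \<noteq> 0 \<Longrightarrow> c0 * (\<Prod>l\<in>I. norm (z $ l) ^ \<beta> l) \<le> norm (g z)"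
  shows "(\<integral>\<^sup>+ z\<in>V. ennreal ((norm (g z))\<^sup>2) * ext_exp (- 2 * toric_weight I A z) \<partial>lborel) = \<infinity>"
proof -
  let ?F = "\<lambda>z. ennreal ((norm (g z))\<^sup>2) * ext_exp (- 2 * toric_weight I A z)"
  let ?S = "\<lambda>z::complex^'n. \<Sum>l\<in>I. norm (z $ l) powr A l"
  obtain e where e: "0 < e" "ball p e \<subseteq> V" using V open_contains_ball by blast
  define r where "r = min 1 (e / (1 + real CARD('n)))"
  have r: "0 < r" "r \<le> 1" "r * real CARD('n) < e"
    using e by (auto simp: r_def min_def field_simps)
  have box: "z \<in> V" if "\<And>l. norm (z $ l - p $ l) < r" for z
  proof -
    have "norm (z - p) \<le> (\<Sum>l\<in>UNIV. norm ((z - p) $ l))" unfolding norm_vec_def by (rule L2_set_le_sum) simp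
    also have "\<dots> \<le> (\<Sum>l\<in>(UNIV::'n set). r)" using that by (intro sum_mono) (auto simp: less_imp_le)
    also have "\<dots> < e" using r by (simp add: mult.commute)
    finally show ?thesis using e by (auto simp: dist_norm norm_minus_commute)
  qed
  \<comment> \<open>In direction \<open>l\<close> the radii shrink by
    \<open>exp (- 1 / A l)\<close>, so that \<open>norm (z $ l) powr A l\<close> drops by the factor
    \<open>exp (- 1)\<close> in all directions of \<open>I\<close> at once.\<close>
  define \<rho> where "\<rho> k l = r * exp (- real k / A l)" for k l
  have \<rho>0: "0 < \<rho> k l" for k l using r by (simp add: \<rho>_def)
  have \<rho>r: "\<rho> k l \<le> r" if "l \<in> I" for k l
    using r A that by (auto simp: \<rho>_def intro!: mult_left_le divide_nonneg_pos)
  have \<rho>mono: "\<rho> j l \<le> \<rho> k l" if "l \<in> I" "k \<le> j" for j k l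
    using r A that by (auto simp: \<rho>_def divide_right_mono less_imp_le)
  define D where "D k l = (if l \<in> I then ball 0 (\<rho> k l) - ball 0 (\<rho> (Suc k) l) else ball (p $ l) r)" for k l
  define B where "B k = {z. \<forall>l. z $ l \<in> D k l}" for k
  have Dm: "D k l \<in> sets borel" for k l by (simp add: D_def)
  have Bm: "B k \<in> sets borel" for k unfolding B_def by (rule product_set_borel[OF Dm])
  have BV: "B k \<subseteq> V" for k
  proof
    fix z assume z: "z \<in> B k"
    show "z \<in> V"
    proof (rule box)
      fix l
      have zD: "z $ l \<in> D k l" using z by (simp add: B_def)
      show "norm (z $ l - p $ l) < r"
      proof (cases "l \<in> I")
        case True
        then show ?thesis using zD \<rho>r[OF True, of k] p by (simp add: D_def)
      next
        case False
        then show ?thesis using zD by (simp add: D_def dist_norm norm_minus_commute)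
      qed
    qed
  qed
  obtain i where i: "i \<in> I" using I by auto
  have disj: "j = k" if "z \<in> B j" "z \<in> B k" for z j k
  proof -
    have "\<not> j < k" if "z \<in> B j" "z \<in> B k" for j k
    proof
      assume "j < k"
      then have "\<rho> k i \<le> \<rho> (Suc j) i" using i by (intro \<rho>mono) auto
      moreover have "z $ i \<in> D j i" "z $ i \<in> D k i" using that by (auto simp: B_def)
      ultimately show False using i by (auto simp: D_def)
    qed
    then show ?thesis using that by (metis linorder_neqE_nat)
  qed
  define b where "b = c0 * (\<Prod>l\<in>I. (r * exp (- 1 / A l)) ^ \<beta> l)"
  define M where "M = (\<Prod>l\<in>I. pi * r\<^sup>2 * (1 - exp (- 2 / A l))) * (\<Prod>l\<in>-I. pi * r\<^sup>2)"
  define d where "d k = (b * exp (- real k * (\<Sum>l\<in>I. real (\<beta> l) / A l)))\<^sup>2 * (exp (real k) / real (card I))\<^sup>2" for k :: nat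
  have b0: "0 < b" unfolding b_def using c0 r by (intro mult_pos_pos prod_pos) auto
  have M0: "0 < M" unfolding M_def using r A by (intro mult_pos_pos prod_pos) auto
  have card0: "0 < card I" using I by (simp add: card_gt_0_iff)
  have lowF: "ennreal (d k) \<le> ?F z" if z: "z \<in> B k" for z k
  proof -
    have n: "\<rho> (Suc k) l \<le> norm (z $ l)" "norm (z $ l) < \<rho> k l" if "l \<in> I" for l
    proof -
      have "z $ l \<in> D k l" using z by (simp add: B_def)
      then show "\<rho> (Suc k) l \<le> norm (z $ l)" "norm (z $ l) < \<rho> k l" using that by (auto simp: D_def)
    qed
    have nz: "\<forall>l\<in>I. z $ l \<noteq> 0"
    proof
      fix l assume "l \<in> I"
      then show "z $ l \<noteq> 0" using n[of l] \<rho>0[of "Suc k" l] by auto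
    qed
    have "b * exp (- real k * (\<Sum>l\<in>I. real (\<beta> l) / A l)) = c0 * (\<Prod>l\<in>I. \<rho> (Suc k) l ^ \<beta> l)"
    proof -
      have "exp (- real k * (\<Sum>l\<in>I. real (\<beta> l) / A l)) = (\<Prod>l\<in>I. exp (- real k / A l) ^ \<beta> l)"
        by (simp add: sum_distrib_left exp_sum flip: exp_of_nat_mult) (simp add: mult_ac)
      moreover have "\<rho> (Suc k) l = (r * exp (- 1 / A l)) * exp (- real k / A l)" for l
        unfolding \<rho>_def by (simp add: mult.assoc flip: exp_add) (simp add: diff_divide_distrib)
      ultimately show ?thesis by (simp add: b_def power_mult_distrib prod.distrib mult.assoc)
    qed
    also have "\<dots> \<le> c0 * (\<Prod>l\<in>I. norm (z $ l) ^ \<beta> l)"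
    proof (intro mult_left_mono prod_mono conjI)
      fix l assume l: "l \<in> I"
      show "0 \<le> \<rho> (Suc k) l ^ \<beta> l" using \<rho>0[of "Suc k" l] by simp
      show "\<rho> (Suc k) l ^ \<beta> l \<le> norm (z $ l) ^ \<beta> l"
        using n(1)[OF l] \<rho>0[of "Suc k" l] by (intro power_mono) simp_all
    qed (use c0 in simp)
    also have "\<dots> \<le> norm (g z)" by (rule lower[OF subsetD[OF BV z] nz])
    finally have 1: "(b * exp (- real k * (\<Sum>l\<in>I. real (\<beta> l) / A l)))\<^sup>2 \<le> (norm (g z))\<^sup>2"
      using b0 by (intro power_mono) auto
    have S0: "0 < ?S z" using nz I by (intro sum_pos) auto
    have "?S z \<le> (\<Sum>l\<in>I. exp (- real k))"
    proof (rule sum_mono)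
      fix l assume l: "l \<in> I"
      have "norm (z $ l) \<le> exp (- real k / A l)"
      proof -
        have "r * exp (- real k / A l) \<le> 1 * exp (- real k / A l)" using r by (intro mult_right_mono) auto
        then show ?thesis using n(2)[OF l] unfolding \<rho>_def by linarith
      qed
      then have "norm (z $ l) powr A l \<le> exp (- real k / A l) powr A l"
        using A l by (intro powr_mono2) (simp_all add: order_less_imp_le)
      also have "\<dots> = exp (- real k)" using A l by (auto simp: powr_def)
      finally show "norm (z $ l) powr A l \<le> exp (- real k)" .
    qed
    then have "?S z \<le> real (card I) * exp (- real k)" by simp
    then have "(?S z)\<^sup>2 \<le> (real (card I) * exp (- real k))\<^sup>2" using S0 by (intro power_mono) auto
    then have "1 / (real (card I) * exp (- real k))\<^sup>2 \<le> 1 / (?S z)\<^sup>2"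
      using S0 card0 by (intro divide_left_mono mult_pos_pos zero_less_power) auto
    moreover have "1 / (real (card I) * exp (- real k))\<^sup>2 = (exp (real k) / real (card I))\<^sup>2"
      by (simp add: exp_minus power_mult_distrib power_divide divide_simps)
    ultimately have 2: "(exp (real k) / real (card I))\<^sup>2 \<le> 1 / (?S z)\<^sup>2" by simp
    show ?thesis unfolding toric_weight_def ext_exp_toric d_def using S0 mult_mono[OF 1 2]
      by (simp add: ennreal_leI flip: ennreal_mult')
  qed
  have vol: "emeasure lborel (B k) = ennreal (M * exp (- 2 * real k * (\<Sum>l\<in>I. 1 / A l)))" for k
  proof -
    have "emeasure lborel (B k) = (\<Prod>l\<in>UNIV. emeasure lborel (D k l))"
      unfolding B_def by (rule emeasure_lborel_product[OF Dm])
    also have "\<dots> = (\<Prod>l\<in>UNIV. ennreal (if l \<in> I then pi * r\<^sup>2 * (1 - exp (- 2 / A l)) * exp (- 2 * real k * (1 / A l)) else pi * r\<^sup>2))"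
    proof (rule prod.cong[OF refl])
      fix l
      show "emeasure lborel (D k l) = ennreal (if l \<in> I then pi * r\<^sup>2 * (1 - exp (- 2 / A l)) * exp (- 2 * real k * (1 / A l)) else pi * r\<^sup>2)"
      proof (cases "l \<in> I")
        case True
        have "emeasure lborel (ball 0 (\<rho> k l) - ball (0::complex) (\<rho> (Suc k) l)) = ennreal (pi * (\<rho> k l)\<^sup>2) - ennreal (pi * (\<rho> (Suc k) l)\<^sup>2)"
          using \<rho>mono[OF True, of k "Suc k"] \<rho>0[of "Suc k" l] \<rho>0[of k l]
          by (subst emeasure_Diff) (auto simp: emeasure_ball_complex)
        also have "\<dots> = ennreal (pi * (\<rho> k l)\<^sup>2 - pi * (\<rho> (Suc k) l)\<^sup>2)"
          by (rule ennreal_minus) simp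
        also have "pi * (\<rho> k l)\<^sup>2 - pi * (\<rho> (Suc k) l)\<^sup>2 = pi * r\<^sup>2 * (1 - exp (- 2 / A l)) * exp (- 2 * real k * (1 / A l))"
        proof -
          have "(\<rho> k l)\<^sup>2 = r\<^sup>2 * exp (- 2 * real k * (1 / A l))"
            by (simp add: \<rho>_def power_mult_distrib flip: exp_double)
          moreover have "(\<rho> (Suc k) l)\<^sup>2 = r\<^sup>2 * (exp (- 2 / A l) * exp (- 2 * real k * (1 / A l)))"
            by (simp add: \<rho>_def power_mult_distrib flip: exp_double exp_add) (simp add: diff_divide_distrib add_divide_distrib algebra_simps)
          ultimately show ?thesis by (simp add: algebra_simps)
        qed
        finally show ?thesis using True by (simp add: D_def)
      next
        case False
        then show ?thesis using r by (simp add: D_def emeasure_ball_complex)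
      qed
    qed
    also have "\<dots> = ennreal (\<Prod>l\<in>UNIV. if l \<in> I then pi * r\<^sup>2 * (1 - exp (- 2 / A l)) * exp (- 2 * real k * (1 / A l)) else pi * r\<^sup>2)"
      using A by (intro prod_ennreal) auto
    also have "(\<Prod>l\<in>UNIV. if l \<in> I then pi * r\<^sup>2 * (1 - exp (- 2 / A l)) * exp (- 2 * real k * (1 / A l)) else pi * r\<^sup>2)
       = (\<Prod>l\<in>I. pi * r\<^sup>2 * (1 - exp (- 2 / A l)) * exp (- 2 * real k * (1 / A l))) * (\<Prod>l\<in>-I. pi * r\<^sup>2)"
      by (simp add: prod.If_cases Collect_mem_eq Compl_eq)
    also have "\<dots> = M * exp (- 2 * real k * (\<Sum>l\<in>I. 1 / A l))"
      by (simp only: prod.distrib M_def exp_sum[OF finite] sum_distrib_left) simp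
    finally show ?thesis .
  qed
  define \<delta> where "\<delta> = M * (b / real (card I))\<^sup>2"
  have \<delta>: "0 < \<delta>" using M0 b0 card0 unfolding \<delta>_def by (intro mult_pos_pos zero_less_power divide_pos_pos) auto
  have each: "ennreal \<delta> \<le> ennreal (d k) * emeasure lborel (B k)" for k
  proof -
    define s where "s = (\<Sum>l\<in>I. (real (\<beta> l) + 1) / A l)"
    define u where "u = (\<Sum>l\<in>I. real (\<beta> l) / A l)"
    define v where "v = (\<Sum>l\<in>I. 1 / A l)"
    have suv: "s = u + v" by (simp add: s_def u_def v_def add_divide_distrib sum.distrib)
    \<comment> \<open>The lower bound for the \<open>k\<close>-th contribution has exponent
      \<open>2 * k * (1 - s)\<close>. At the critical value \<open>s = 1\<close> it is constant in
      \<open>k\<close>, which is enough for divergence.\<close>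
    have "0 \<le> 2 * real k * (1 - s)" using sum by (simp add: s_def)
    then have "1 \<le> exp (2 * real k * (1 - s))" by simp
    then have "\<delta> * 1 \<le> \<delta> * exp (2 * real k * (1 - s))"
      using \<delta> by (intro mult_left_mono) simp_all
    also have "exp (2 * real k * (1 - s)) = (exp (- real k * u))\<^sup>2 * (exp (real k))\<^sup>2 * exp (- 2 * real k * v)"
      by (simp add: suv algebra_simps flip: exp_double exp_add)
    also have "\<delta> * ((exp (- real k * u))\<^sup>2 * (exp (real k))\<^sup>2 * exp (- 2 * real k * v)) = d k * (M * exp (- 2 * real k * v))"
      unfolding \<delta>_def d_def u_def[symmetric] power_mult_distrib power_divide by simp
    finally have "ennreal \<delta> \<le> ennreal (d k * (M * exp (- 2 * real k * v)))" by (simp add: ennreal_leI)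
    also have "\<dots> = ennreal (d k) * emeasure lborel (B k)"
      unfolding vol v_def by (rule ennreal_mult') (simp add: d_def)
    finally show ?thesis .
  qed
  have "ennreal (real n * \<delta>) \<le> (\<integral>\<^sup>+ z\<in>V. ?F z \<partial>lborel)" for n :: nat
  proof -
    have "ennreal (real n * \<delta>) = ennreal (\<Sum>k<n. \<delta>)" by simp
    also have "\<dots> = (\<Sum>k<n. ennreal \<delta>)" using \<delta> by (intro sum_ennreal[symmetric]) simp
    also have "\<dots> \<le> (\<Sum>k<n. ennreal (d k) * emeasure lborel (B k))" by (rule sum_mono) (rule each)
    also have "\<dots> = (\<integral>\<^sup>+ z. (\<Sum>k<n. ennreal (d k) * indicator (B k) z) \<partial>lborel)"
    proof (subst nn_integral_sum)
      show "(\<lambda>z. ennreal (d k) * indicator (B k) z) \<in> borel_measurable lborel" for k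
        using Bm[of k] by simp
      show "(\<Sum>k<n. ennreal (d k) * emeasure lborel (B k)) = (\<Sum>k<n. \<integral>\<^sup>+ z. ennreal (d k) * indicator (B k) z \<partial>lborel)"
        using Bm by (intro sum.cong refl nn_integral_cmult_indicator[symmetric]) simp
    qed
    also have "\<dots> \<le> (\<integral>\<^sup>+ z\<in>V. ?F z \<partial>lborel)"
    proof (rule nn_integral_mono)
      fix z :: "complex^'n"
      show "(\<Sum>k<n. ennreal (d k) * indicator (B k) z) \<le> ?F z * indicator V z"
      proof (cases "\<exists>k. z \<in> B k")
        case True
        then obtain k where k: "z \<in> B k" by auto
        have "ennreal (d j) * indicator (B j) z = (if j = k then ennreal (d k) else 0)" for j
        proof (cases "j = k")
          case False
          then have "z \<notin> B j" using disj[OF _ k] by blast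
          then show ?thesis using False by simp
        qed (use k in simp)
        then have "(\<Sum>j<n. ennreal (d j) * indicator (B j) z) = (\<Sum>j<n. if j = k then ennreal (d k) else 0)"
          by (rule sum.cong[OF refl])
        also have "\<dots> \<le> ennreal (d k)" by (simp add: sum.delta)
        also have "\<dots> \<le> ?F z" by (rule lowF[OF k])
        also have "\<dots> = ?F z * indicator V z" using subsetD[OF BV k] by simp
        finally show ?thesis .
      qed simp
    qed
    finally show ?thesis .
  qed
  note bound = this
  show ?thesis
  proof (rule ccontr)
    assume "(\<integral>\<^sup>+ z\<in>V. ?F z \<partial>lborel) \<noteq> \<infinity>"
    then obtain y where y: "(\<integral>\<^sup>+ z\<in>V. ?F z \<partial>lborel) = ennreal y" "0 \<le> y"
      by (cases "(\<integral>\<^sup>+ z\<in>V. ?F z \<partial>lborel)") auto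
    obtain n where "y / \<delta> < real n" using reals_Archimedean2 by blast
    then have "y < real n * \<delta>" using \<delta> by (simp add: pos_divide_less_eq)
    moreover have "real n * \<delta> \<le> y" using bound[of n] y by (simp add: ennreal_le_iff)
    ultimately show False by simp
  qed
qed

section \<open>Taylor expansions and polydiscs\<close>

definition taylor_coeff :: "(complex \<Rightarrow> complex) \<Rightarrow> nat \<Rightarrow> complex" where
  "taylor_coeff F q = (deriv ^^ q) F 0 / fact q"

text \<open>Cauchy's inequality on the disc of radius \<open>R / 2\<close>, on whose closure
  \<open>F\<close> is continuous; this is the origin of the factor 2.\<close>

lemma taylor_coeff_bound:
  assumes F: "F holomorphic_on ball 0 R" and R: "0 < R" and M: "\<And>w. norm w < R \<Longrightarrow> norm (F w) \<le> M"
  shows "norm (taylor_coeff F q) \<le> M * (2 / R) ^ q"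
proof -
  have sub: "cball 0 (R/2) \<subseteq> ball 0 R" "ball 0 (R/2) \<subseteq> ball 0 R" using R by auto
  have "norm ((deriv ^^ q) F 0) \<le> fact q * M / (R/2) ^ q"
  proof (rule Cauchy_inequality)
    show "F holomorphic_on ball 0 (R/2)" using F sub holomorphic_on_subset by blast
    show "continuous_on (cball 0 (R/2)) F"
      using F sub holomorphic_on_imp_continuous_on continuous_on_subset by blast
  qed (use R M in auto)
  then have "norm (taylor_coeff F q) \<le> fact q * M / (R/2) ^ q / fact q"
    unfolding taylor_coeff_def norm_divide norm_fact by (rule divide_right_mono) simp
  also have "\<dots> = M * (2 / R) ^ q" by (simp add: power_divide)
  finally show ?thesis .
qed

lemma taylor_remainder_bound:
  assumes F: "F holomorphic_on ball 0 R" and R: "0 < R" and M: "\<And>w. norm w < R \<Longrightarrow> norm (F w) \<le> M"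
    and w: "norm w \<le> R / 4"
  shows "norm (F w - (\<Sum>q<n. taylor_coeff F q * w ^ q)) \<le> 2 * M * (2 * norm w / R) ^ n"
proof -
  define x where "x = 2 * norm w / R"
  \<comment> \<open>The restriction to \<open>R / 4\<close> keeps the ratio of the geometric series
    at most 1/2, so that its sum is at most 2.\<close>
  have x: "0 \<le> x" "x \<le> 1/2" using w R by (auto simp: x_def field_simps)
  have "norm (F 0) \<le> M" using M[of 0] R by simp
  then have M0: "0 \<le> M" by (rule order_trans[OF norm_ge_zero])
  have "(\<lambda>q. taylor_coeff F q * w ^ q) sums F w"
    using holomorphic_power_series[OF F, of w] w R by (simp add: taylor_coeff_def)
  from sums_split_initial_segment[OF this, of n]
  have s: "(\<lambda>q. taylor_coeff F (q + n) * w ^ (q + n)) sums (F w - (\<Sum>q<n. taylor_coeff F q * w ^ q))" .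
  have le: "norm (taylor_coeff F (q + n) * w ^ (q + n)) \<le> M * x ^ n * x ^ q" for q
  proof -
    have "norm (taylor_coeff F (q + n) * w ^ (q + n)) \<le> M * (2 / R) ^ (q + n) * norm w ^ (q + n)"
      unfolding norm_mult norm_power by (intro mult_right_mono taylor_coeff_bound[OF F R M]) auto
    also have "\<dots> = M * x ^ n * x ^ q"
      by (simp add: x_def power_add power_divide power_mult_distrib mult_ac)
    finally show ?thesis .
  qed
  have g: "(\<lambda>q. M * x ^ n * x ^ q) sums (M * x ^ n * (1 / (1 - x)))"
    using x by (intro sums_mult geometric_sums) auto
  have "norm (F w - (\<Sum>q<n. taylor_coeff F q * w ^ q)) \<le> M * x ^ n * (1 / (1 - x))"
    unfolding sums_unique[OF s] sums_unique[OF g] by (rule norm_suminf_le[OF le sums_summable[OF g]])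
  also have "\<dots> \<le> M * x ^ n * 2"
    using x M0 by (intro mult_left_mono) (auto simp: field_simps)
  finally show ?thesis by (simp add: x_def mult_ac)
qed

lemma taylor_coeff_diff:
  assumes "F holomorphic_on ball 0 R" "G holomorphic_on ball 0 R" "0 < R"
  shows "taylor_coeff (\<lambda>w. F w - G w) q = taylor_coeff F q - taylor_coeff G q"
  using higher_deriv_diff[OF assms(1,2) open_ball, of 0 q] assms(3)
  by (simp add: taylor_coeff_def diff_divide_distrib)

text \<open>At a point whose distance from all roots is at least \<open>\<delta>\<close>, each of
  the \<open>p\<close> linear factors has modulus at least \<open>\<delta>\<close>. The sublevel set
  therefore lies in at most \<open>p\<close> discs of radius \<open>\<delta>\<close>.\<close>

lemma emeasure_poly_sublevel:
  fixes c :: "nat \<Rightarrow> complex"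
  assumes c: "c p \<noteq> 0" and \<delta>: "0 \<le> \<delta>"
  shows "emeasure lborel {w. norm (\<Sum>q\<le>p. c q * w ^ q) < norm (c p) * \<delta> ^ p} \<le> ennreal (real p * (pi * \<delta>\<^sup>2))"
proof -
  define P where "P = (\<Sum>q\<le>p. monom (c q) q)"
  have cf: "coeff P q = (if q \<le> p then c q else 0)" for q
    by (simp add: P_def coeff_sum if_distrib cong: if_cong)
  have deg: "degree P = p"
    by (rule antisym) (auto intro!: degree_le le_degree simp: cf c)
  have P0: "P \<noteq> 0" using c cf[of p] by auto
  obtain X where X: "size X = p" "P = smult (lead_coeff P) (\<Prod>x\<in>#X. [:-x, 1:])"
    using alg_closed_imp_factorization[OF P0] deg by auto
  have Pw: "poly P w = (\<Sum>q\<le>p. c q * w ^ q)" for w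
    by (simp add: P_def poly_sum poly_monom)
  have nP: "norm (poly P w) = norm (c p) * (\<Prod>x\<in>#X. norm (w - x))" for w
  proof -
    have "poly P w = c p * (\<Prod>x\<in>#X. w - x)"
      by (subst X(2)) (simp add: poly_prod_mset deg cf image_mset.compositionality o_def)
    moreover have "norm (\<Prod>x\<in>#Y. w - x) = (\<Prod>x\<in>#Y. norm (w - x))" for Y
      by (induction Y) (auto simp: norm_mult)
    ultimately show ?thesis by (simp add: norm_mult)
  qed
  have sub: "{w. norm (\<Sum>q\<le>p. c q * w ^ q) < norm (c p) * \<delta> ^ p} \<subseteq> (\<Union>x\<in>set_mset X. ball x \<delta>)"
  proof (rule subsetI, rule ccontr)
    fix w assume w: "w \<in> {w. norm (\<Sum>q\<le>p. c q * w ^ q) < norm (c p) * \<delta> ^ p}" "w \<notin> (\<Union>x\<in>set_mset X. ball x \<delta>)"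
    have "\<delta> ^ size Y \<le> (\<Prod>x\<in>#Y. norm (w - x))" if "set_mset Y \<subseteq> set_mset X" for Y
      using that
    proof (induction Y)
      case (add y Y)
      then have "\<delta> \<le> norm (w - y)" using w(2) by (force simp: dist_norm norm_minus_commute not_less)
      then show ?case using add \<delta> by (auto intro!: mult_mono)
    qed simp
    from this[of X] have "norm (c p) * \<delta> ^ p \<le> norm (poly P w)"
      unfolding nP by (intro mult_left_mono) (auto simp: X)
    then show False using w(1) by (simp add: Pw)
  qed
  have "emeasure lborel {w. norm (\<Sum>q\<le>p. c q * w ^ q) < norm (c p) * \<delta> ^ p} \<le> emeasure lborel (\<Union>x\<in>set_mset X. ball x \<delta>)"
    by (rule emeasure_mono[OF sub]) auto
  also have "\<dots> \<le> (\<Sum>x\<in>set_mset X. emeasure lborel (ball x \<delta>))"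
    by (rule emeasure_subadditive_finite) auto
  also have "\<dots> = (\<Sum>x\<in>set_mset X. ennreal (pi * \<delta>\<^sup>2))"
    using \<delta> by (simp add: emeasure_ball_complex)
  also have "\<dots> = ennreal (\<Sum>x\<in>set_mset X. pi * \<delta>\<^sup>2)" by (rule sum_ennreal) simp
  also have "\<dots> = ennreal (real (card (set_mset X)) * (pi * \<delta>\<^sup>2))" by simp
  also have "\<dots> \<le> ennreal (real p * (pi * \<delta>\<^sup>2))"
  proof -
    have "card (set_mset Y) \<le> size Y" for Y :: "complex multiset"
      by (induction Y) (auto simp: card_insert_if)
    from this[of X] show ?thesis using X(1) by (intro ennreal_leI mult_right_mono) auto
  qed
  finally show ?thesis .
qed

section \<open>Polydiscs and one-variable slices\<close>

definition polydisc :: "complex^'n::finite \<Rightarrow> real \<Rightarrow> (complex^'n) set" where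
  "polydisc p R = {z. \<forall>l. norm (z $ l - p $ l) < R}"

lemma open_polydisc: "open (polydisc p R)"
proof -
  have "polydisc p R = (\<Inter>l. {z. norm (z $ l - p $ l) < R})" by (auto simp: polydisc_def)
  moreover have "open {z. norm (z $ l - p $ l) < R}" for l
    by (intro open_Collect_less continuous_intros)
  ultimately show ?thesis by (auto intro!: open_INT)
qed

lemma centre_in_polydisc: "0 < R \<Longrightarrow> p \<in> polydisc p R"
  by (simp add: polydisc_def)

lemma polydisc_mono: "R \<le> R' \<Longrightarrow> polydisc p R \<subseteq> polydisc p R'"
  unfolding polydisc_def using order.strict_trans2 by blast

lemma half_polydisc_subset:
  fixes p x :: "complex^'n::finite"
  assumes p: "p \<in> polydisc x (R / 2)"
  shows "polydisc p (R / 2) \<subseteq> polydisc x R"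
proof
  fix y assume y: "y \<in> polydisc p (R / 2)"
  show "y \<in> polydisc x R" unfolding polydisc_def
  proof (intro CollectI allI)
    fix l
    have "norm (y $ l - x $ l) \<le> norm (y $ l - p $ l) + norm (p $ l - x $ l)"
      using norm_triangle_ineq[of "y $ l - p $ l" "p $ l - x $ l"] by simp
    moreover have "norm (y $ l - p $ l) < R / 2" "norm (p $ l - x $ l) < R / 2"
      using y p by (auto simp: polydisc_def)
    ultimately show "norm (y $ l - x $ l) < R" by linarith
  qed
qed

lemma norm_vec_le_sum: "norm z \<le> (\<Sum>l\<in>UNIV. norm (z $ l))"
  unfolding norm_vec_def by (rule L2_set_le_sum) simp

lemma polydisc_subset_ball:
  fixes p :: "complex^'n::finite"
  shows "polydisc p (e / (1 + real CARD('n))) \<subseteq> ball p e"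
proof
  fix z assume z: "z \<in> polydisc p (e / (1 + real CARD('n)))"
  then have "0 < e / (1 + real CARD('n))" unfolding polydisc_def using norm_ge_zero order.strict_trans1 by blast
  then have e: "0 < e" by (simp add: zero_less_divide_iff)
  have "norm (z - p) \<le> (\<Sum>l\<in>UNIV. norm ((z - p) $ l))" by (rule norm_vec_le_sum)
  also have "\<dots> \<le> (\<Sum>l\<in>(UNIV::'n set). e / (1 + real CARD('n)))"
    using z by (intro sum_mono) (simp add: polydisc_def order_less_imp_le)
  also have "\<dots> < e" using e by (simp add: field_simps)
  finally show "z \<in> ball p e" by (simp add: dist_norm norm_minus_commute)
qed

lemma open_contains_polydisc:
  fixes V :: "(complex^'n::finite) set"
  assumes "open V" "p \<in> V"
  obtains R where "0 < R" "R \<le> 1" "closure (polydisc p R) \<subseteq> V"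
proof -
  obtain e where e: "0 < e" "cball p e \<subseteq> V" using assms open_contains_cball by blast
  let ?R = "min 1 (e / (1 + real CARD('n)))"
  have "polydisc p ?R \<subseteq> ball p e" using polydisc_subset_ball polydisc_mono by (metis min.cobounded2 subset_trans)
  then have "closure (polydisc p ?R) \<subseteq> cball p e"
    by (meson ball_subset_cball closed_cball closure_minimal subset_trans)
  then show ?thesis using that[of ?R] e by auto
qed

lemma bounded_polydisc: "bounded (polydisc (p :: complex^'n::finite) R)"
proof -
  have "R = (R * (1 + real CARD('n))) / (1 + real CARD('n))" by simp
  then have "polydisc p R \<subseteq> ball p (R * (1 + real CARD('n)))"
    using polydisc_subset_ball[of p "R * (1 + real CARD('n))"] by simp
  then show ?thesis using bounded_ball bounded_subset by blast
qed

lemma compact_closure_polydisc: "compact (closure (polydisc (p :: complex^'n::finite) R))"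
  using bounded_polydisc compact_closure by blast

lemma holomorphic_several_continuous_on:
  "holomorphic_several f V \<Longrightarrow> continuous_on V f"
  unfolding holomorphic_several_def
  by (meson continuous_at_imp_continuous_on has_derivative_continuous)

lemma holomorphic_several_bounded_on_polydisc:
  fixes f :: "complex^'n::finite \<Rightarrow> complex"
  assumes "holomorphic_several f V" "closure (polydisc x R) \<subseteq> V"
  shows "\<exists>M. \<forall>z\<in>polydisc x R. norm (f z) \<le> M"
proof -
  have "compact (f ` closure (polydisc x R))"
    using continuous_on_subset[OF holomorphic_several_continuous_on[OF assms(1)] assms(2)] compact_closure_polydisc
    by (rule compact_continuous_image)
  then obtain M where "\<And>y. y \<in> f ` closure (polydisc x R) \<Longrightarrow> norm y \<le> M"
    using compact_imp_bounded bounded_iff by metis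
  then show ?thesis using closure_subset by blast
qed

lemma holomorphic_several_subset:
  "holomorphic_several f V \<Longrightarrow> W \<subseteq> V \<Longrightarrow> holomorphic_several f W"
  unfolding holomorphic_several_def by blast

lemma continuous_on_upd [continuous_intros]:
  assumes "continuous_on S f" "continuous_on S g"
  shows "continuous_on S (\<lambda>t. upd (f t) l (g t))"
  unfolding upd_def
proof (rule continuous_on_vec_lambda)
  show "continuous_on S (\<lambda>t. if k = l then g t else f t $ k)" for k
    using assms by (cases "k = l") (auto intro!: continuous_intros)
qed

lemma holomorphic_several_slice:
  assumes f: "holomorphic_several f V" and S: "\<And>w. w \<in> S \<Longrightarrow> upd z l w \<in> V"
  shows "(\<lambda>w. f (upd z l w)) holomorphic_on S"
proof -
  have "(\<lambda>w. f (upd z l w)) field_differentiable at w" if w: "w \<in> S" for w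
  proof -
    obtain D where D: "(f has_derivative D) (at (upd z l w))" "\<And>c v. D (c *s v) = c * D v"
      using f S[OF w] unfolding holomorphic_several_def by blast
    have u: "upd z l = (\<lambda>w. upd z l 0 + w *s axis l 1)"
      by (rule ext) (auto simp: vec_eq_iff axis_def)
    have "((\<lambda>w. w *s axis l 1 :: complex^'a) has_derivative (\<lambda>w. w *s axis l 1)) (at w)"
      by (rule linear_imp_has_derivative)
         (auto intro!: linearI simp: vec_eq_iff distrib_right)
    then have "(upd z l has_derivative (\<lambda>w. w *s axis l 1)) (at w)"
      by (subst u) (auto intro!: derivative_eq_intros)
    from has_derivative_compose[OF this D(1)]
    have "((\<lambda>w. f (upd z l w)) has_derivative (\<lambda>h. D (axis l 1) * h)) (at w)"
      by (simp add: D(2) mult.commute)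
    then show ?thesis unfolding field_differentiable_def has_field_derivative_def by blast
  qed
  then show ?thesis by (simp add: field_differentiable_at_within holomorphic_on_def)
qed

section \<open>Integrability below the order on an axis\<close>

lemma upd_in_polydisc:
  fixes z p :: "complex^'n::finite"
  assumes "z \<in> polydisc p r" "norm (w - p $ i) < R" "r \<le> R"
  shows "upd z i w \<in> polydisc p R"
  using assms unfolding polydisc_def by (auto intro: order.strict_trans2)

text \<open>Neighbouring slices are uniformly close on the whole disc, by uniform continuity of
  \<open>f\<close> on a compact polydisc; the Cauchy estimate for their difference carries this over
  to the \<open>p\<close>-th coefficient.\<close>

lemma taylor_coeff_slice_lower_bound:
  fixes f :: "complex^'n::finite \<Rightarrow> complex"
  assumes f: "holomorphic_several f V" and R: "0 < R" "closure (polydisc 0 R) \<subseteq> V"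
    and c: "taylor_coeff (\<lambda>w. f (upd 0 i w)) p \<noteq> 0"
  obtains r where "0 < r" "r \<le> R / 4"
    "\<And>z. z \<in> polydisc 0 r \<Longrightarrow>
       norm (taylor_coeff (\<lambda>w. f (upd 0 i w)) p) / 2 \<le> norm (taylor_coeff (\<lambda>w. f (upd z i w)) p)"
proof -
  let ?c = "\<lambda>z. taylor_coeff (\<lambda>w. f (upd z i w)) p"
  let ?K = "closure (polydisc (0::complex^'n) R)"
  have sub: "polydisc 0 R \<subseteq> V" using R closure_subset by blast
  have hol: "(\<lambda>w. f (upd z i w)) holomorphic_on ball 0 R" if "z \<in> polydisc 0 R" for z
  proof (rule holomorphic_several_slice[OF f])
    fix w :: complex assume "w \<in> ball 0 R"
    then show "upd z i w \<in> V" using upd_in_polydisc[OF that, of w i R] sub by auto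
  qed
  \<comment> \<open>Calibrated so that the Cauchy estimate allows a change by exactly half the
    coefficient at the origin.\<close>
  define e where "e = norm (?c 0) / 2 / (2 / R) ^ p"
  have e: "0 < e" unfolding e_def using c R by (intro divide_pos_pos zero_less_power) auto
  have "uniformly_continuous_on ?K f"
    using compact_uniformly_continuous[OF continuous_on_subset[OF holomorphic_several_continuous_on[OF f] R(2)] compact_closure_polydisc] .
  then obtain d where d: "0 < d" "\<And>x y. x \<in> ?K \<Longrightarrow> y \<in> ?K \<Longrightarrow> dist y x < d \<Longrightarrow> dist (f y) (f x) < e"
    unfolding uniformly_continuous_on_def using e by metis
  define r where "r = min (R / 4) (d / (1 + real CARD('n)))"
  have r: "0 < r" unfolding r_def using R d by simp
  have r4: "r \<le> R / 4" unfolding r_def by (rule min.cobounded1)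
  have rR: "r \<le> R" using r4 R by linarith
  have "norm (?c 0) / 2 \<le> norm (?c z)" if z: "z \<in> polydisc 0 r" for z
  proof -
    have zR: "z \<in> polydisc 0 R" using z polydisc_mono[OF rR] by blast
    have z0: "(0::complex^'n) \<in> polydisc 0 R" using R by (simp add: centre_in_polydisc)
    have "norm (taylor_coeff (\<lambda>w. f (upd z i w) - f (upd 0 i w)) p) \<le> e * (2 / R) ^ p"
    proof (rule taylor_coeff_bound[OF _ R(1)])
      show "(\<lambda>w. f (upd z i w) - f (upd 0 i w)) holomorphic_on ball 0 R"
        by (intro holomorphic_on_diff hol zR z0)
      fix w :: complex assume w: "norm w < R"
      have "upd z i 0 \<in> polydisc 0 r" using z r by (auto simp: polydisc_def)
      then have "upd z i 0 \<in> polydisc 0 (d / (1 + real CARD('n)))"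
        using polydisc_mono[of r "d / (1 + real CARD('n))"] by (auto simp: r_def)
      then have "norm (upd z i 0) < d" using polydisc_subset_ball by fastforce
      \<comment> \<open>The displacement between corresponding points does not depend on
        \<open>w\<close>, so one smallness condition on \<open>z\<close> serves the whole
        slice.\<close>
      moreover have "upd z i w - upd 0 i w = upd z i 0" by (simp add: vec_eq_iff)
      ultimately have "dist (upd z i w) (upd 0 i w) < d" by (simp add: dist_norm)
      moreover have "upd z i w \<in> ?K" "upd 0 i w \<in> ?K"
        using upd_in_polydisc[OF zR, of w i R] upd_in_polydisc[OF z0, of w i R] w closure_subset by fastforce+
      ultimately show "norm (f (upd z i w) - f (upd 0 i w)) \<le> e"
        using d(2) by (fastforce simp: dist_norm less_imp_le)
    qed
    also have "e * (2 / R) ^ p = norm (?c 0) / 2" unfolding e_def using R by simp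
    finally have "norm (?c z - ?c 0) \<le> norm (?c 0) / 2"
      using taylor_coeff_diff[OF hol[OF zR] hol[OF z0] R(1)] by simp
    then show ?thesis using norm_triangle_ineq2[of "?c 0" "?c z"] by (simp add: norm_minus_commute)
  qed
  then show ?thesis using that r r4 by blast
qed

lemma open_sublevel:
  fixes f :: "'a::topological_space \<Rightarrow> complex"
  assumes "open U" "continuous_on U f"
  shows "open {z \<in> U. norm (f z) < t}"
proof -
  have "{z \<in> U. norm (f z) < t} = U \<inter> f -` ball 0 t" by auto
  then show ?thesis using continuous_open_preimage[OF assms(2,1) open_ball] by simp
qed

text \<open>Where \<open>f\<close> is smaller than \<open>t\<close>, its Taylor polynomial of degree
  \<open>p\<close> is smaller than \<open>t\<close> plus the remainder. By \<open>small\<close> this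
  is less than its modulus at distance \<open>\<delta>\<close> from all its zeros, so the polynomial
  estimate applies.\<close>

lemma slice_sublevel_bound:
  fixes f :: "complex^'n::finite \<Rightarrow> complex" and z :: "complex^'n"
  assumes f: "holomorphic_several f V" and R: "0 < R" "polydisc 0 R \<subseteq> V"
    and M: "\<And>z. z \<in> polydisc 0 R \<Longrightarrow> norm (f z) \<le> M"
    and r: "r \<le> R / 4" and z: "\<And>l. l \<noteq> i \<Longrightarrow> norm (z $ l) < r" and r0: "0 < r"
    and c0: "0 < c0" "c0 \<le> norm (taylor_coeff (\<lambda>w. f (upd z i w)) p)"
    and small: "t + 2 * M * (2 * \<rho> / R) ^ (p + 1) < c0 * \<delta> ^ p" and \<delta>: "0 \<le> \<delta>" and \<rho>: "0 \<le> \<rho>"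
  shows "emeasure lborel {w. norm w < r \<and> norm w \<le> \<rho> \<and> norm (f (upd z i w)) < t} \<le> ennreal (real p * (pi * \<delta>\<^sup>2))"
proof -
  define F where "F = (\<lambda>w. f (upd z i w))"
  let ?c = "taylor_coeff F"
  have zR: "upd z i w \<in> polydisc 0 R" if "norm w < R" for w
    using z r r0 that by (auto simp: polydisc_def) (smt (verit))
  have hol: "F holomorphic_on ball 0 R"
    unfolding F_def using zR R by (intro holomorphic_several_slice[OF f]) auto
  have FM: "norm (F w) \<le> M" if "norm w < R" for w
    unfolding F_def using M zR[OF that] by blast
  have "norm (F 0) \<le> M" using FM[of 0] R by simp
  then have M0: "0 \<le> M" by (rule order_trans[OF norm_ge_zero])
  have cp: "?c p \<noteq> 0" using c0 by (auto simp: F_def)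
  have "{w. norm w < r \<and> norm w \<le> \<rho> \<and> norm (f (upd z i w)) < t}
      \<subseteq> {w. norm (\<Sum>q\<le>p. ?c q * w ^ q) < norm (?c p) * \<delta> ^ p}"
  proof
    fix w assume "w \<in> {w. norm w < r \<and> norm w \<le> \<rho> \<and> norm (f (upd z i w)) < t}"
    then have w: "norm w < r" "norm w \<le> \<rho>" "norm (F w) < t" by (auto simp: F_def)
    have "norm (F w - (\<Sum>q\<le>p. ?c q * w ^ q)) \<le> 2 * M * (2 * norm w / R) ^ (p + 1)"
      using taylor_remainder_bound[OF hol R(1) FM, of w "p + 1"] w r by (simp add: lessThan_Suc_atMost)
    also have "\<dots> \<le> 2 * M * (2 * \<rho> / R) ^ (p + 1)"
      using w M0 R by (intro mult_left_mono power_mono divide_right_mono) auto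
    finally have "norm (\<Sum>q\<le>p. ?c q * w ^ q) < t + 2 * M * (2 * \<rho> / R) ^ (p + 1)"
      using w(3) norm_triangle_ineq2[of "\<Sum>q\<le>p. ?c q * w ^ q" "F w"] by (simp add: norm_minus_commute)
    also have "\<dots> < c0 * \<delta> ^ p" by (rule small)
    also have "\<dots> \<le> norm (?c p) * \<delta> ^ p" using c0 \<delta> unfolding F_def by (intro mult_right_mono) auto
    finally show "w \<in> {w. norm (\<Sum>q\<le>p. ?c q * w ^ q) < norm (?c p) * \<delta> ^ p}" by simp
  qed
  moreover have "open {w. norm (\<Sum>q\<le>p. ?c q * w ^ q) < norm (?c p) * \<delta> ^ p}"
    by (intro open_Collect_less continuous_intros)
  ultimately have "emeasure lborel {w. norm w < r \<and> norm w \<le> \<rho> \<and> norm (f (upd z i w)) < t}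
      \<le> emeasure lborel {w. norm (\<Sum>q\<le>p. ?c q * w ^ q) < norm (?c p) * \<delta> ^ p}"
    by (intro emeasure_mono) auto
  also have "\<dots> \<le> ennreal (real p * (pi * \<delta>\<^sup>2))" by (rule emeasure_poly_sublevel[of ?c, OF cp \<delta>])
  finally show ?thesis .
qed

text \<open>After division by \<open>exp (- real k * \<kappa>)\<close> both terms on the left tend
  to zero.\<close>

lemma exponential_gap:
  fixes c0 :: real
  assumes "0 < c0" "\<kappa> < \<sigma>" "\<kappa> < \<tau>"
  obtains k0 where "\<And>k. k0 \<le> k \<Longrightarrow> exp (- real k * \<sigma>) + C * exp (- real k * \<tau>) < c0 * exp (- real k * \<kappa>)"
proof -
  have lim: "(\<lambda>k. exp (- real k * s)) \<longlonglongrightarrow> 0" if "0 < s" for s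
  proof -
    have "exp (- real k * s) = exp (- s) ^ k" for k by (metis exp_of_nat_mult minus_mult_commute)
    then show ?thesis using that by (simp add: LIMSEQ_power_zero)
  qed
  have "(\<lambda>k. exp (- real k * (\<sigma> - \<kappa>)) + C * exp (- real k * (\<tau> - \<kappa>))) \<longlonglongrightarrow> 0 + C * 0"
    using assms by (intro tendsto_intros lim) auto
  then have "\<forall>\<^sub>F k in sequentially. exp (- real k * (\<sigma> - \<kappa>)) + C * exp (- real k * (\<tau> - \<kappa>)) < c0"
    using assms(1) by (intro order_tendstoD(2)) auto
  then obtain k0 where k0: "\<And>k. k0 \<le> k \<Longrightarrow> exp (- real k * (\<sigma> - \<kappa>)) + C * exp (- real k * (\<tau> - \<kappa>)) < c0"
    unfolding eventually_sequentially by blast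
  have "exp (- real k * \<sigma>) + C * exp (- real k * \<tau>) < c0 * exp (- real k * \<kappa>)" if "k0 \<le> k" for k
  proof -
    have "(exp (- real k * (\<sigma> - \<kappa>)) + C * exp (- real k * (\<tau> - \<kappa>))) * exp (- real k * \<kappa>) < c0 * exp (- real k * \<kappa>)"
      using k0[OF that] by (intro mult_strict_right_mono) auto
    moreover have "exp (- real k * (s - \<kappa>)) * exp (- real k * \<kappa>) = exp (- real k * s)" for s
      by (simp add: algebra_simps flip: exp_add)
    ultimately show ?thesis by (simp only: distrib_right mult.assoc)
  qed
  then show ?thesis using that by blast
qed

lemma ext_exp_bound:
  assumes "ereal x \<le> y"
  shows "ext_exp (- 2 * y) \<le> ennreal (exp (- 2 * x))"
proof -
  have e: "- 2 * ereal x = ereal (- 2 * x)" by (metis numeral_eq_ereal times_ereal.simps(1) uminus_ereal.simps(1))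
  have "ext_exp (- 2 * y) \<le> ext_exp (- 2 * ereal x)" by (rule ext_exp_minus_mono[OF assms])
  then show ?thesis unfolding e by (simp add: ext_exp_def)
qed

text \<open>
  On the shell \<open>\<Sum> \<bar>z\<^sub>l\<bar> powr A l \<approx> exp (- k)\<close> the integrand is bounded via \<open>f\<close> wherever
  \<open>\<bar>f\<bar> \<ge> exp (- k \<sigma>)\<close>; the remaining set lies, in each slice of the \<open>i\<close>-th coordinate, near the \<open>p\<close>
  zeros of a Taylor polynomial, so its relative volume in the shell decays exponentially.
\<close>

lemma integrable_below_axis_order:
  fixes f :: "complex^'n::finite \<Rightarrow> complex" and \<phi> :: "complex^'n \<Rightarrow> ereal" and \<beta> :: "'n \<Rightarrow> nat"
  assumes A: "\<forall>l\<in>I. 0 < A l" and i: "i \<in> I"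
    and sum: "1 \<le> (\<Sum>l\<in>I. (real (\<beta> l) + 1) / A l)"
    and V: "open V" "0 \<in> V" and f: "holomorphic_several f V"
    and cp: "taylor_coeff (\<lambda>w. f (upd 0 i w)) p \<noteq> 0"
    and c: "0 < c" "2 * c * real p < A i"
    and \<phi>1: "\<And>z. z \<in> V \<Longrightarrow> toric_weight I A z \<le> \<phi> z"
    and \<phi>2: "\<And>z. z \<in> V \<Longrightarrow> ereal c * ext_ln ((norm (f z))\<^sup>2) - ereal C \<le> \<phi> z"
  obtains W where "open W" "0 \<in> W" "W \<subseteq> V"
    "(\<integral>\<^sup>+ z\<in>W. ennreal ((\<Prod>l\<in>I. norm (z $ l) ^ \<beta> l)\<^sup>2) * ext_exp (- 2 * \<phi> z) \<partial>lborel) < \<infinity>"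
proof -
  let ?S = "\<lambda>z::complex^'n. \<Sum>l\<in>I. norm (z $ l) powr A l"
  let ?F = "\<lambda>z::complex^'n. ennreal ((\<Prod>l\<in>I. norm (z $ l) ^ \<beta> l)\<^sup>2) * ext_exp (- 2 * \<phi> z)"
  have Ai: "0 < A i" and I: "I \<noteq> {}" using A i by auto
  obtain R where R: "0 < R" "R \<le> 1" "closure (polydisc 0 R) \<subseteq> V"
    using open_contains_polydisc[OF V] .
  have RV: "polydisc 0 R \<subseteq> V" using R closure_subset by blast
  obtain M where M: "\<And>z. z \<in> polydisc 0 R \<Longrightarrow> norm (f z) \<le> M"
    using holomorphic_several_bounded_on_polydisc[OF f R(3)] by blast
  obtain r where r: "0 < r" "r \<le> R / 4" and low: "\<And>z. z \<in> polydisc 0 r \<Longrightarrow>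
      norm (taylor_coeff (\<lambda>w. f (upd 0 i w)) p) / 2 \<le> norm (taylor_coeff (\<lambda>w. f (upd z i w)) p)"
    using taylor_coeff_slice_lower_bound[OF f R(1,3) cp] by blast
  define c0 where "c0 = norm (taylor_coeff (\<lambda>w. f (upd 0 i w)) p) / 2"
  have c0: "0 < c0" using cp by (simp add: c0_def)
  \<comment> \<open>On the shell the leading term of \<open>f\<close> has the natural size
    \<open>exp (- k * p / A i)\<close>, while the bound through \<open>f\<close> improves on the
    weight as long as \<open>norm (f z)\<close> exceeds \<open>exp (- k / (2 * c))\<close>. The
    difference of the two rates is the room for the choices below.\<close>
  define gap where "gap = 1 / (2 * c) - real p / A i"
  have gap: "0 < gap" using c Ai by (simp add: gap_def field_simps)
  \<comment> \<open>\<open>\<eta>\<close> is the rate by which the discs around the zeros are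
    smaller than the shell. The denominator makes \<open>p * \<eta>\<close> at most half of
    \<open>gap\<close>, leaving room for the threshold \<open>\<sigma>\<close>, and at most half of
    \<open>1 / A i\<close>, so that the Taylor remainder stays negligible.\<close>
  define \<eta> where "\<eta> = min gap (1 / A i) / (2 * (real p + 1))"
  have \<eta>: "0 < \<eta>" using gap Ai by (simp add: \<eta>_def)
  define \<kappa> where "\<kappa> = real p * (1 / A i + \<eta>)"
  \<comment> \<open>A threshold strictly between \<open>\<kappa> \<le> p / A i + gap / 2\<close> and
    \<open>p / A i + gap = 1 / (2 * c)\<close>.\<close>
  define \<sigma> where "\<sigma> = real p / A i + 3 / 4 * gap"
  have p\<eta>: "real p * \<eta> \<le> gap / 2" "real p * \<eta> \<le> 1 / A i / 2"
  proof -
    have "real p * \<eta> \<le> (real p + 1) * \<eta>" using \<eta> by (intro mult_right_mono) auto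
    also have "\<dots> = min gap (1 / A i) / 2" by (simp add: \<eta>_def field_simps)
    finally have m: "real p * \<eta> \<le> min gap (1 / A i) / 2" .
    have "min gap (1 / A i) / 2 \<le> gap / 2" "min gap (1 / A i) / 2 \<le> 1 / A i / 2"
      by (rule divide_right_mono; simp)+
    then show "real p * \<eta> \<le> gap / 2" "real p * \<eta> \<le> 1 / A i / 2"
      using m order_trans by blast+
  qed
  have \<kappa>\<sigma>: "\<kappa> < \<sigma>" using p\<eta> gap by (simp add: \<kappa>_def \<sigma>_def distrib_left)
  have \<kappa>\<tau>: "\<kappa> < (real p + 1) / A i"
  proof -
    have "0 < 1 / A i" using Ai by simp
    moreover have "x / 2 < x" if "0 < x" for x :: real using that by simp
    ultimately have "real p * \<eta> < 1 / A i" using p\<eta>(2) order.strict_trans1 by blast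
    then show ?thesis unfolding \<kappa>_def add_divide_distrib distrib_left by simp
  qed
  have \<sigma>c: "2 * c * \<sigma> < 1"
  proof -
    have "\<sigma> < real p / A i + gap" unfolding \<sigma>_def using gap by simp
    also have "\<dots> = 1 / (2 * c)" by (simp add: gap_def)
    finally have "\<sigma> < 1 / (2 * c)" .
    then show ?thesis using c by (simp add: field_simps)
  qed
  obtain k0 where k0: "\<And>k. k0 \<le> k \<Longrightarrow> exp (- real k * \<sigma>) + (2 * M * (2 / R) ^ (p + 1)) * exp (- real k * ((real p + 1) / A i)) < c0 * exp (- real k * \<kappa>)"
    using exponential_gap[OF c0 \<kappa>\<sigma> \<kappa>\<tau>] by metis
  define s where "s = (\<Sum>l\<in>I. (real (\<beta> l) + 1) / A l)"
  define u where "u = (\<Sum>l\<in>I. real (\<beta> l) / A l)"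
  define v where "v = (\<Sum>l\<in>I. 1 / A l)"
  have suv: "s = u + v" by (simp add: s_def u_def v_def add_divide_distrib sum.distrib)
  have s1: "1 \<le> s" using sum by (simp add: s_def)
  define K where "K = (\<Prod>l\<in>I. pi) * (\<Prod>l\<in>-I. pi * r\<^sup>2)"
  have K: "0 \<le> K" unfolding K_def by (intro mult_nonneg_nonneg prod_nonneg) auto
  have vol: "emeasure lborel (shell_box I A 0 r k) = ennreal (K * exp (- 2 * real k * v))" for k
    unfolding v_def K_def by (rule emeasure_shell_box) (use r in simp)
  define T where "T k = shell_box I A (0::complex^'n) r k" for k
  \<comment> \<open>The slice estimate is available only from \<open>k0\<close> on. Points of
    \<open>W\<close> are assigned shells of index at least \<open>k0\<close>, so \<open>B k\<close>
    can be empty before.\<close>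
  define B where "B k = (if k < k0 then {} else T k \<inter> {z \<in> polydisc 0 r. norm (f z) < exp (- real k * \<sigma>)})" for k
  have Tm: "T k \<in> sets borel" for k unfolding T_def by (rule shell_box_measurable)
  have rR: "polydisc (0::complex^'n) r \<subseteq> polydisc 0 R" using r R by (intro polydisc_mono) simp
  have Bm: "B k \<in> sets borel" for k
  proof -
    have "continuous_on (polydisc 0 r) f"
      using continuous_on_subset[OF holomorphic_several_continuous_on[OF f]] rR RV by blast
    then have "open {z \<in> polydisc 0 r. norm (f z) < exp (- real k * \<sigma>)}"
      by (rule open_sublevel[OF open_polydisc])
    then show ?thesis unfolding B_def using Tm by auto
  qed
  define \<delta> where "\<delta> k = exp (- real k * (1 / A i + \<eta>))" for k :: nat
  have Bvol: "emeasure lborel (B k) \<le> ennreal (real p * exp (- 2 * real k * \<eta>) * (K * exp (- 2 * real k * v)))" for k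
  proof (cases "k < k0")
    case False
    then have k: "k0 \<le> k" by simp
    define D where "D l = (if l \<in> I then cball 0 (exp (- real k / A l)) else ball (0::complex) r)" for l
    have slice: "emeasure lborel {w. upd z i w \<in> B k} \<le> ennreal (real p * (pi * (\<delta> k)\<^sup>2))" for z
    proof (cases "\<exists>w. upd z i w \<in> B k")
      case True
      then obtain w0 where w0: "upd z i w0 \<in> polydisc 0 r" using False by (auto simp: B_def)
      then have zr: "norm (z $ l) < r" if "l \<noteq> i" for l
        using that unfolding polydisc_def by (auto dest: spec[of _ l])
      have zr0: "upd z i 0 \<in> polydisc 0 r" using zr r by (auto simp: polydisc_def)
      have "{w. upd z i w \<in> B k} \<subseteq> {w. norm w < r \<and> norm w \<le> exp (- real k / A i) \<and> norm (f (upd z i w)) < exp (- real k * \<sigma>)}"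
      proof
        fix w assume "w \<in> {w. upd z i w \<in> B k}"
        then have w: "upd z i w \<in> T k" "upd z i w \<in> polydisc 0 r" "norm (f (upd z i w)) < exp (- real k * \<sigma>)"
          using False by (auto simp: B_def)
        from w(1) have "w \<in> (if i \<in> I then cball 0 (exp (- real k / A i)) else ball 0 r)"
          unfolding T_def shell_box_def by (auto dest: spec[of _ i])
        moreover from w(2) have "norm w < r" unfolding polydisc_def by (auto dest: spec[of _ i])
        ultimately show "w \<in> {w. norm w < r \<and> norm w \<le> exp (- real k / A i) \<and> norm (f (upd z i w)) < exp (- real k * \<sigma>)}"
          using w i by simp
      qed
      moreover have "{w. norm w < r \<and> norm w \<le> exp (- real k / A i) \<and> norm (f (upd z i w)) < exp (- real k * \<sigma>)} \<in> sets lborel"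
      proof -
        have "continuous_on (ball 0 r) (\<lambda>w. f (upd z i w))"
        proof (rule holomorphic_on_imp_continuous_on, rule holomorphic_several_slice[OF f])
          fix w :: complex assume "w \<in> ball 0 r"
          then show "upd z i w \<in> V" using upd_in_polydisc[OF zr0, of w i r] rR RV by auto
        qed
        then have "open {w \<in> ball 0 r. norm (f (upd z i w)) < exp (- real k * \<sigma>)}"
          by (rule open_sublevel[OF open_ball])
        moreover have "{w. norm w < r \<and> norm w \<le> exp (- real k / A i) \<and> norm (f (upd z i w)) < exp (- real k * \<sigma>)}
          = {w \<in> ball 0 r. norm (f (upd z i w)) < exp (- real k * \<sigma>)} \<inter> cball 0 (exp (- real k / A i))" by auto
        ultimately show ?thesis by simp
      qed
      ultimately have "emeasure lborel {w. upd z i w \<in> B k} \<le> emeasure lborel {w. norm w < r \<and> norm w \<le> exp (- real k / A i) \<and> norm (f (upd z i w)) < exp (- real k * \<sigma>)}"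
        by (rule emeasure_mono)
      also have "\<dots> \<le> ennreal (real p * (pi * (\<delta> k)\<^sup>2))"
      proof (rule slice_sublevel_bound[OF f R(1) RV M r(2) zr r(1) c0])
        show "c0 \<le> norm (taylor_coeff (\<lambda>w. f (upd z i w)) p)" using low[OF zr0] by (simp add: c0_def)
        have "(2 * exp (- real k / A i) / R) ^ (p + 1) = (2 / R) ^ (p + 1) * exp (- real k * ((real p + 1) / A i))"
        proof -
          have "exp (- real k / A i) ^ (p + 1) = exp (- real k * ((real p + 1) / A i))"
            unfolding exp_of_nat_mult[symmetric] by (simp add: mult_ac)
          then show ?thesis by (simp only: power_mult_distrib power_divide times_divide_eq_left)
        qed
        moreover have "\<delta> k ^ p = exp (- real k * \<kappa>)"
          unfolding \<delta>_def exp_of_nat_mult[symmetric] by (simp add: \<kappa>_def mult_ac)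
        ultimately show "exp (- real k * \<sigma>) + 2 * M * (2 * exp (- real k / A i) / R) ^ (p + 1) < c0 * \<delta> k ^ p"
          using k0[OF k] by (simp only: mult.assoc)
      qed (auto simp: \<delta>_def)
      finally show ?thesis .
    qed simp
    have "emeasure lborel (B k) \<le> ennreal (real p * (pi * (\<delta> k)\<^sup>2)) * (\<Prod>l\<in>UNIV-{i}. emeasure lborel (D l))"
    proof (rule emeasure_slice_le[OF Bm _ _ slice])
      show "z $ l \<in> D l" if "z \<in> B k" for z l
        using that by (auto simp: B_def T_def shell_box_def D_def split: if_splits)
      show "D l \<in> sets borel" for l by (simp add: D_def)
    qed
    also have "ennreal (real p * (pi * (\<delta> k)\<^sup>2)) = ennreal (real p * exp (- 2 * real k * \<eta>)) * emeasure lborel (D i)"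
    proof -
      have "(\<delta> k)\<^sup>2 = exp (- 2 * real k * \<eta>) * (exp (- real k / A i))\<^sup>2"
        by (simp add: \<delta>_def algebra_simps flip: exp_double exp_add)
      then show ?thesis using i by (simp add: D_def emeasure_cball_complex mult_ac flip: ennreal_mult')
    qed
    also have "ennreal (real p * exp (- 2 * real k * \<eta>)) * emeasure lborel (D i) * (\<Prod>l\<in>UNIV-{i}. emeasure lborel (D l))
       = ennreal (real p * exp (- 2 * real k * \<eta>)) * (\<Prod>l\<in>UNIV. emeasure lborel (D l))"
      by (simp add: prod.remove[of UNIV i] mult.assoc)
    also have "(\<Prod>l\<in>UNIV. emeasure lborel (D l)) = emeasure lborel (T k)"
      unfolding T_def shell_box_def D_def by (subst emeasure_lborel_product) (auto intro!: prod.cong)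
    also have "ennreal (real p * exp (- 2 * real k * \<eta>)) * emeasure lborel (T k) = ennreal (real p * exp (- 2 * real k * \<eta>) * (K * exp (- 2 * real k * v)))"
      unfolding T_def vol using K by (simp add: ennreal_mult')
    finally show ?thesis .
  qed (simp add: B_def)
  define W where "W = polydisc 0 r \<inter> {z. ?S z < exp (- real k0)}"
  have W: "open W" "0 \<in> W" "W \<subseteq> V"
  proof -
    have "continuous_on UNIV ?S" by (intro continuous_on_sum_powr A continuous_on_id)
    then show "open W" unfolding W_def by (intro open_Int open_polydisc open_Collect_less continuous_on_const)
    show "0 \<in> W" using r by (auto simp: W_def centre_in_polydisc)
    show "W \<subseteq> V" using rR RV by (auto simp: W_def)
  qed
  \<comment> \<open>Where \<open>norm (f z) \<ge> exp (- k * \<sigma>)\<close>, the lower bound for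
    \<open>\<phi>\<close> through \<open>f\<close> gives
    \<open>exp (- 2 * \<phi>) \<le> exp (4 * c * \<sigma> * k + 2 * C)\<close>. The bound
    \<open>dk\<close> on the exceptional set comes from the toric weight itself.\<close>
  define ck where "ck k = exp (- 2 * real k * u) * exp (4 * c * \<sigma> * real k + 2 * C)" for k :: nat
  define dk where "dk k = exp (- 2 * real k * u) * exp (2 * (real k + 1))" for k :: nat
  define g where "g k = K * exp (2 * C) * exp (- (2 * (s - 2 * c * \<sigma>)) * real k)" for k :: nat
  define h where "h k = real p * K * exp 2 * exp (- (2 * (s - 1 + \<eta>)) * real k)" for k :: nat
  have g: "ennreal (ck k) * emeasure lborel (T k) \<le> ennreal (g k)" for k
  proof -
    have "ennreal (ck k) * emeasure lborel (T k) = ennreal (ck k * (K * exp (- 2 * real k * v)))"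
      unfolding T_def vol by (rule ennreal_mult'[symmetric]) (simp add: ck_def)
    also have "ck k * (K * exp (- 2 * real k * v)) = g k"
      unfolding ck_def g_def by (simp add: suv algebra_simps flip: exp_add)
    finally show ?thesis by simp
  qed
  \<comment> \<open>Both rates are positive even at the critical value \<open>s = 1\<close>: the
    first because \<open>2 * c * \<sigma> < 1\<close>, the second because of the gain
    \<open>\<eta>\<close> in volume.\<close>
  have "0 < 2 * (s - 2 * c * \<sigma>)" using order.strict_trans2[OF \<sigma>c s1] by (simp add: mult_ac)
  moreover have "0 < 2 * (s - 1 + \<eta>)" using add_nonneg_pos[OF _ \<eta>, of "s - 1"] s1 by simp
  ultimately have sums: "summable (\<lambda>k. C * exp (- (2 * (s - 2 * c * \<sigma>)) * real k))"
      "summable (\<lambda>k. C * exp (- (2 * (s - 1 + \<eta>)) * real k))" for C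
    by (blast intro: summable_exp_minus)+
  have gs: "summable g" "\<And>k. 0 \<le> g k"
    unfolding g_def using K by - (rule sums(1), simp)
  have h: "ennreal (dk k) * emeasure lborel (B k) \<le> ennreal (h k)" for k
  proof -
    have "ennreal (dk k) * emeasure lborel (B k) \<le> ennreal (dk k) * ennreal (real p * exp (- 2 * real k * \<eta>) * (K * exp (- 2 * real k * v)))"
      by (intro mult_left_mono Bvol) simp
    also have "\<dots> = ennreal (dk k * (real p * exp (- 2 * real k * \<eta>) * (K * exp (- 2 * real k * v))))"
      by (rule ennreal_mult'[symmetric]) (simp add: dk_def)
    also have "dk k * (real p * exp (- 2 * real k * \<eta>) * (K * exp (- 2 * real k * v))) = h k"
      unfolding dk_def h_def by (simp add: suv algebra_simps flip: exp_add)
    finally show ?thesis .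
  qed
  have hs: "summable h" "\<And>k. 0 \<le> h k"
    unfolding h_def using K by - (rule sums(2), simp)
  have "(\<integral>\<^sup>+ z\<in>W. ?F z \<partial>lborel) < \<infinity>"
  proof (rule nn_integral_finite_by_cover[of T lborel B, OF _ _ _ g gs h hs])
    show "T k \<in> sets lborel" "B k \<in> sets lborel" for k using Tm Bm by simp_all
    show "AE z in lborel. z \<in> W \<longrightarrow> (\<exists>k. z \<in> T k \<and> ?F z \<le> ennreal (ck k) \<or> z \<in> B k \<and> ?F z \<le> ennreal (dk k))"
      using AE_nonzero_coordinates[of 0]
    proof eventually_elim
      case (elim z)
      show ?case
      proof
        assume z: "z \<in> W"
        then have zr: "z \<in> polydisc 0 r" and zS: "?S z \<le> exp (- real k0)" by (auto simp: W_def)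
        have zV: "z \<in> V" using zr rR RV by blast
        have S0: "0 < ?S z" using elim I by (intro sum_pos) auto
        obtain k where k: "k0 \<le> k" "exp (- (real k + 1)) < ?S z" "?S z \<le> exp (- real k)"
          using shell_index[OF S0 zS] .
        have b: "norm (z $ l) \<le> exp (- real k / A l)" if l: "l \<in> I" for l
        proof (rule powr_le_exp_imp)
          have "norm (z $ l) powr A l \<le> ?S z" using l by (intro member_le_sum) auto
          then show "norm (z $ l) powr A l \<le> exp (- real k)" using k by simp
        qed (use A l in auto)
        have zT: "z \<in> T k"
          using b zr by (auto simp: T_def shell_box_def polydisc_def)
        have "(\<Prod>l\<in>I. norm (z $ l) ^ \<beta> l) \<le> (\<Prod>l\<in>I. exp (- real k / A l) ^ \<beta> l)"
          using b by (intro prod_mono) (auto intro: power_mono)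
        also have "\<dots> = exp (- real k * u)"
          unfolding u_def by (simp add: sum_distrib_left exp_sum flip: exp_of_nat_mult) (simp add: mult_ac)
        finally have "(\<Prod>l\<in>I. norm (z $ l) ^ \<beta> l)\<^sup>2 \<le> (exp (- real k * u))\<^sup>2"
          by (intro power_mono prod_nonneg) auto
        also have "\<dots> = exp (- 2 * real k * u)"
          by (simp add: mult.assoc flip: exp_double)
        finally have mon: "(\<Prod>l\<in>I. norm (z $ l) ^ \<beta> l)\<^sup>2 \<le> exp (- 2 * real k * u)" .
        have prod: "?F z \<le> ennreal (exp (- 2 * real k * u) * y)" if "ext_exp (- 2 * \<phi> z) \<le> ennreal y" for y
        proof -
          have "?F z \<le> ennreal (exp (- 2 * real k * u)) * ennreal y"
            using mon that by (intro mult_mono ennreal_leI) auto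
          then show ?thesis by (simp add: ennreal_mult')
        qed
        show "\<exists>k. z \<in> T k \<and> ?F z \<le> ennreal (ck k) \<or> z \<in> B k \<and> ?F z \<le> ennreal (dk k)"
        proof (cases "norm (f z) < exp (- real k * \<sigma>)")
          case True
          then have zB: "z \<in> B k" using k zT zr by (simp add: B_def)
          have "- (real k + 1) \<le> ln (?S z)"
            using k(2) S0 by (metis exp_le_cancel_iff exp_ln less_imp_le)
          then have "ereal (- (real k + 1)) \<le> toric_weight I A z"
            using S0 by (simp add: toric_weight_def ext_ln_def)
          also have "\<dots> \<le> \<phi> z" by (rule \<phi>1[OF zV])
          finally have "ext_exp (- 2 * \<phi> z) \<le> ennreal (exp (- 2 * (- (real k + 1))))"
            by (rule ext_exp_bound)
          also have "- 2 * (- (real k + 1)) = 2 * (real k + 1)" by simp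
          finally have "ext_exp (- 2 * \<phi> z) \<le> ennreal (exp (2 * (real k + 1)))" .
          from prod[OF this] show ?thesis using zB unfolding dk_def by blast
        next
          case False
          then have fz: "exp (- real k * \<sigma>) \<le> norm (f z)" by simp
          then have f0: "0 < norm (f z)" using exp_gt_zero[of "- real k * \<sigma>"] by linarith
          have "- real k * \<sigma> \<le> ln (norm (f z))" using fz f0 by (metis exp_le_cancel_iff exp_ln)
          then have "- 2 * real k * \<sigma> \<le> ln ((norm (f z))\<^sup>2)" using f0 by (simp add: ln_realpow mult_ac)
          then have "c * (- 2 * real k * \<sigma>) - C \<le> c * ln ((norm (f z))\<^sup>2) - C"
            using c(1) by (intro diff_right_mono mult_left_mono) simp_all
          then have "ereal (c * (- 2 * real k * \<sigma>) - C) \<le> ereal c * ext_ln ((norm (f z))\<^sup>2) - ereal C"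
            using f0 by (simp add: ext_ln_def)
          also have "\<dots> \<le> \<phi> z" by (rule \<phi>2[OF zV])
          finally have "ext_exp (- 2 * \<phi> z) \<le> ennreal (exp (- 2 * (c * (- 2 * real k * \<sigma>) - C)))"
            by (rule ext_exp_bound)
          also have "- 2 * (c * (- 2 * real k * \<sigma>) - C) = 4 * c * \<sigma> * real k + 2 * C" by (simp add: algebra_simps)
          finally show ?thesis using prod zT unfolding ck_def by blast
        qed
      qed
    qed
  qed
  then show ?thesis using that W by blast
qed

section \<open>Analytic singularities and commensurable exponents\<close>

lemma ereal_le_scaled_ext_ln:
  assumes "ereal y \<le> ereal c * ext_ln s + ereal C" "0 < c"
  shows "0 < s" and "y \<le> c * ln s + C"
  using assms by (auto simp: ext_ln_def split: if_splits)

lemma scaled_ext_ln_le_ereal: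
  assumes "ereal c * ext_ln s - ereal C \<le> ereal y" "0 < s"
  shows "c * ln s - C \<le> y"
  using assms by (auto simp: ext_ln_def)

lemma toric_weight_axis:
  assumes "i \<in> I"
  shows "toric_weight I A (upd 0 i w) = ext_ln (norm w powr A i)"
proof -
  have "(\<Sum>l\<in>I. norm (upd 0 i w $ l) powr A l) = (\<Sum>l\<in>I. if l = i then norm w powr A i else 0)"
    by (intro sum.cong) auto
  also have "\<dots> = norm w powr A i" using assms by (simp add: sum.delta)
  finally show ?thesis by (simp add: toric_weight_def)
qed

lemma toric_weight_axis_nonzero:
  assumes "i \<in> I" "w \<noteq> 0"
  shows "toric_weight I A (upd 0 i w) = ereal (A i * ln (norm w))"
  unfolding toric_weight_axis[OF assms(1)] using assms(2) by (simp add: ext_ln_def ln_powr)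

lemma tendsto_powr_at_right_0:
  assumes "0 < (s::real)" shows "((\<lambda>r. K * r powr s) \<longlongrightarrow> 0) (at_right 0)"
proof -
  have "((\<lambda>r::real. r powr s) \<longlongrightarrow> 0) (at_right 0)"
    using assms by (intro tendsto_zero_powrI[of _ _ "\<lambda>_. s" s]) (auto intro!: tendsto_ident_at intro: eventually_mono[OF eventually_at_right_less])
  from tendsto_mult_left[OF this, of K] show ?thesis by simp
qed

text \<open>The Cauchy estimate on discs of radius \<open>r\<close> gives a multiple of
  \<open>r powr (s - p)\<close>, which tends to zero with \<open>r\<close>.\<close>

lemma taylor_coeff_eq_0_if_small:
  assumes F: "F holomorphic_on ball 0 R" and R: "0 < R" and K: "0 \<le> K"
    and le: "\<And>w. norm w < R \<Longrightarrow> norm (F w) \<le> K * norm w powr s" and p: "real p < s"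
  shows "taylor_coeff F p = 0"
proof -
  have "norm (taylor_coeff F p) \<le> K * 2 ^ p * r powr (s - real p)" if r: "0 < r" "r < R" for r
  proof -
    have "norm (taylor_coeff F p) \<le> K * r powr s * (2 / r) ^ p"
    proof (rule taylor_coeff_bound)
      show "F holomorphic_on ball 0 r" using F r by (rule_tac holomorphic_on_subset) auto
      fix w :: complex assume w: "norm w < r"
      then have "norm (F w) \<le> K * norm w powr s" using le r by simp
      also have "\<dots> \<le> K * r powr s" using w K p by (intro mult_left_mono powr_mono2) auto
      finally show "norm (F w) \<le> K * r powr s" .
    qed (use r in simp)
    also have "\<dots> = K * 2 ^ p * r powr (s - real p)"
      using r by (simp add: powr_diff powr_realpow power_divide)
    finally show ?thesis .
  qed
  then have "\<forall>\<^sub>F r in at_right 0. norm (taylor_coeff F p) \<le> K * 2 ^ p * r powr (s - real p)"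
    unfolding eventually_at_right_field using R by blast
  then have "norm (taylor_coeff F p) \<le> 0"
    using p by (intro tendsto_lowerbound[OF tendsto_powr_at_right_0]) auto
  then show ?thesis by simp
qed

lemma axis_in_polydisc: "norm w < R \<Longrightarrow> upd 0 i w \<in> polydisc (0 :: complex^'n::finite) R"
  by (auto simp: polydisc_def intro: order.strict_trans1[OF norm_ge_zero])

lemma axis_slice_holomorphic:
  assumes "holomorphic_several f V" "polydisc 0 R \<subseteq> V"
  shows "(\<lambda>w. f (upd 0 i w)) holomorphic_on ball 0 R"
  using assms axis_in_polydisc by (intro holomorphic_several_slice[OF assms(1)]) auto

text \<open>Otherwise every \<open>f j\<close> vanishes on the \<open>i\<close>-th axis to some
  order \<open>P > A i / (2 * c)\<close>. Up to a constant \<open>\<psi>\<close> is then at most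
  \<open>2 * c * P * ln (norm w)\<close> there, which for small \<open>w\<close> is below the weight
  \<open>A i * ln (norm w)\<close>.\<close>

lemma exists_low_axis_coeff:
  fixes f :: "nat \<Rightarrow> complex^'n::finite \<Rightarrow> complex" and \<psi> :: "complex^'n \<Rightarrow> ereal"
  assumes i: "i \<in> I" and V: "open V" "0 \<in> V" and f: "\<And>j. j \<in> J \<Longrightarrow> holomorphic_several (f j) V"
    and J: "finite J" and c: "0 < c"
    and lower: "\<And>z. z \<in> V \<Longrightarrow> toric_weight I A z \<le> \<psi> z"
    and upper: "\<And>z. z \<in> V \<Longrightarrow> \<psi> z \<le> ereal c * ext_ln (\<Sum>j\<in>J. (norm (f j z))\<^sup>2) + ereal C"
    and Ai: "0 < A i"
  obtains j p where "j \<in> J" "taylor_coeff (\<lambda>w. f j (upd 0 i w)) p \<noteq> 0" "2 * c * real p \<le> A i"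
proof (rule ccontr)
  note res = that
  assume "\<not> thesis"
  then have zero: "taylor_coeff (\<lambda>w. f j (upd 0 i w)) p = 0" if "j \<in> J" "2 * c * real p \<le> A i" for j p
    using that \<open>\<not> thesis\<close> res by blast
  obtain R where R: "0 < R" "R \<le> 1" "closure (polydisc 0 R) \<subseteq> V"
    using open_contains_polydisc[OF V] .
  have RV: "polydisc 0 R \<subseteq> V" using R closure_subset by blast
  have "\<exists>M. \<forall>z\<in>polydisc 0 R. norm (f j z) \<le> M" if "j \<in> J" for j
    by (rule holomorphic_several_bounded_on_polydisc[OF f[OF that] R(3)])
  then obtain M where M: "\<And>j z. j \<in> J \<Longrightarrow> z \<in> polydisc 0 R \<Longrightarrow> norm (f j z) \<le> M j" by metis
  \<comment> \<open>The least integer greater than \<open>A i / (2 * c)\<close>; all coefficients of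
    lower order vanish by \<open>zero\<close>.\<close>
  define P where "P = Suc (nat \<lfloor>A i / (2 * c)\<rfloor>)"
  have P: "A i / (2 * c) < real P" "\<And>p. p < P \<Longrightarrow> real p \<le> A i / (2 * c)"
  proof -
    have "0 \<le> A i / (2 * c)" using Ai c by simp
    then show "A i / (2 * c) < real P" "\<And>p. p < P \<Longrightarrow> real p \<le> A i / (2 * c)"
      unfolding P_def by linarith+
  qed
  define K where "K = (\<Sum>j\<in>J. (2 * M j * (2 / R) ^ P)\<^sup>2)"
  have bound: "(\<Sum>j\<in>J. (norm (f j (upd 0 i w)))\<^sup>2) \<le> K * norm w powr (2 * real P)" if w: "w \<noteq> 0" "norm w \<le> R / 4" for w
  proof -
    have "(norm (f j (upd 0 i w)))\<^sup>2 \<le> (2 * M j * (2 / R) ^ P)\<^sup>2 * norm w powr (2 * real P)" if j: "j \<in> J" for j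
    proof -
      let ?F = "\<lambda>w. f j (upd 0 i w)"
      have "norm (?F w - (\<Sum>q<P. taylor_coeff ?F q * w ^ q)) \<le> 2 * M j * (2 * norm w / R) ^ P"
        by (rule taylor_remainder_bound[OF axis_slice_holomorphic[OF f[OF j] RV] R(1) _ w(2)])
           (rule M[OF j axis_in_polydisc])
      moreover have "(\<Sum>q<P. taylor_coeff ?F q * w ^ q) = 0"
      proof (rule sum.neutral, rule ballI)
        fix q assume "q \<in> {..<P}"
        then have "2 * c * real q \<le> A i" using P(2)[of q] c by (simp add: field_simps)
        then show "taylor_coeff ?F q * w ^ q = 0" using zero[OF j] by simp
      qed
      ultimately have "norm (?F w) \<le> 2 * M j * (2 / R) ^ P * norm w ^ P"
        by (simp add: power_mult_distrib power_divide)
      then have "(norm (?F w))\<^sup>2 \<le> (2 * M j * (2 / R) ^ P * norm w ^ P)\<^sup>2" by (intro power_mono) auto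
      also have "\<dots> = (2 * M j * (2 / R) ^ P)\<^sup>2 * norm w powr (2 * real P)"
      proof -
        have "norm w powr (2 * real P) = norm w powr real (2 * P)" by simp
        also have "\<dots> = norm w ^ (2 * P)" using w(1) by (subst powr_realpow) auto
        finally show ?thesis by (simp only: power_mult_distrib power_mult[symmetric] mult.commute[of 2 P])
      qed
      finally show ?thesis .
    qed
    then show ?thesis unfolding K_def sum_distrib_right by (intro sum_mono)
  qed
  have est: "ln 1 \<le> (c * ln K + C) + (2 * c * real P - A i) * ln r \<and> 0 < K" if r: "0 < r" "r \<le> R / 4" for r
  proof -
    let ?w = "of_real r :: complex"
    have w: "?w \<noteq> 0" "norm ?w \<le> R / 4" "norm ?w < R" using r R by auto
    have wV: "upd 0 i ?w \<in> V" using axis_in_polydisc[OF w(3)] RV by blast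
    let ?s = "\<Sum>j\<in>J. (norm (f j (upd 0 i ?w)))\<^sup>2"
    have "ereal (A i * ln r) \<le> ereal c * ext_ln ?s + ereal C"
      using order_trans[OF lower[OF wV] upper[OF wV]] toric_weight_axis_nonzero[OF i w(1), of A] r by simp
    note s = ereal_le_scaled_ext_ln[OF this c]
    have sK: "?s \<le> K * r powr (2 * real P)" using bound[OF w(1,2)] r by simp
    have K0: "0 < K"
    proof -
      have "0 < K * r powr (2 * real P)" using s(1) sK by linarith
      then show ?thesis using r by (simp add: zero_less_mult_iff)
    qed
    have "ln ?s \<le> ln (K * r powr (2 * real P))" using s(1) sK by (subst ln_le_cancel_iff) auto
    also have "\<dots> = ln K + 2 * real P * ln r" using K0 r by (simp add: ln_mult ln_powr)
    finally have "c * ln ?s \<le> c * (ln K + 2 * real P * ln r)" using c by (intro mult_left_mono) auto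
    then have "A i * ln r \<le> c * (ln K + 2 * real P * ln r) + C" using s(2) by linarith
    then show ?thesis using K0 by (simp add: algebra_simps)
  qed
  define b where "b = 2 * c * real P - A i"
  have b: "0 < b" using P(1) c by (simp add: b_def field_simps)
  \<comment> \<open>So small that the negative term \<open>b * ln r\<close> outweighs the constant
    in \<open>est\<close> by at least one.\<close>
  define r where "r = min (R / 4) (exp (- (\<bar>c * ln K + C\<bar> + 1) / b))"
  have r: "0 < r" "r \<le> R / 4" unfolding r_def using R by simp_all
  have "ln r \<le> ln (exp (- (\<bar>c * ln K + C\<bar> + 1) / b))"
    using r unfolding r_def by (subst ln_le_cancel_iff) auto
  then have "b * ln r \<le> b * (- (\<bar>c * ln K + C\<bar> + 1) / b)" using b by (intro mult_left_mono) auto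
  also have "\<dots> = - (\<bar>c * ln K + C\<bar> + 1)" using b by simp
  finally have "b * ln r \<le> - (\<bar>c * ln K + C\<bar> + 1)" .
  then show False using est[OF r] abs_ge_self[of "c * ln K + C"] unfolding b_def[symmetric] by simp
qed

text \<open>On the \<open>i\<close>-th axis the two bounds make
  \<open>\<Sum>j. (norm (f j))\<^sup>2\<close> comparable to \<open>norm w powr (A i / c)\<close>.
  So no \<open>f j\<close> has a nonzero coefficient of order below \<open>A i / (2 * c)\<close>,
  while some \<open>f j\<close> has one of order at most this number, which is therefore an
  integer.\<close>

lemma analytic_toric_imp_commensurable:
  fixes I :: "'n::finite set"
  assumes A: "\<forall>l\<in>I. 0 < A l" and an: "analytic_singularities_near (toric_weight I A :: complex^'n \<Rightarrow> ereal) 0"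
  obtains c :: real where "0 < c" "\<And>l. l \<in> I \<Longrightarrow> A l / c \<in> \<rat>"
proof -
  obtain V N f c C where V: "open V" "(0::complex^'n) \<in> V" and f: "\<And>j. j \<in> {1..N::nat} \<Longrightarrow> holomorphic_several (f j) V"
    and c: "0 < c" and lo: "\<And>z. z \<in> V \<Longrightarrow> ereal c * ext_ln (\<Sum>j=1..N. (norm (f j z))\<^sup>2) - ereal C \<le> toric_weight I A z"
    and up: "\<And>z. z \<in> V \<Longrightarrow> toric_weight I A z \<le> ereal c * ext_ln (\<Sum>j=1..N. (norm (f j z))\<^sup>2) + ereal C"
    using an unfolding analytic_singularities_near_def by blast
  obtain R where R: "0 < R" "R \<le> 1" "closure (polydisc 0 R) \<subseteq> V"
    using open_contains_polydisc[OF V] .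
  have RV: "polydisc 0 R \<subseteq> V" using R closure_subset by blast
  have "A i / (2 * c) \<in> \<rat>" if i: "i \<in> I" for i
  proof -
    have Ai: "0 < A i" using A i by simp
    obtain j p where j: "j \<in> {1..N}" and cp: "taylor_coeff (\<lambda>w. f j (upd 0 i w)) p \<noteq> 0" and le: "2 * c * real p \<le> A i"
      using exists_low_axis_coeff[OF i V f finite_atLeastAtMost c order_refl up Ai] by blast
    have "\<not> real p < A i / (2 * c)"
    proof
      assume p: "real p < A i / (2 * c)"
      have "taylor_coeff (\<lambda>w. f j (upd 0 i w)) p = 0"
      proof (rule taylor_coeff_eq_0_if_small[OF axis_slice_holomorphic[OF f[OF j] RV] R(1) _ _ p])
        show "0 \<le> exp (C / (2 * c))" by simp
        fix w :: complex assume w: "norm w < R"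
        have wV: "upd 0 i w \<in> V" using axis_in_polydisc[OF w] RV by blast
        let ?s = "\<Sum>j=1..N. (norm (f j (upd 0 i w)))\<^sup>2"
        have fs: "(norm (f j (upd 0 i w)))\<^sup>2 \<le> ?s" using j by (intro member_le_sum) auto
        show "norm (f j (upd 0 i w)) \<le> exp (C / (2 * c)) * norm w powr (A i / (2 * c))"
        proof (cases "f j (upd 0 i w) = 0")
          case False
          then have f0: "0 < (norm (f j (upd 0 i w)))\<^sup>2" by simp
          then have s0: "0 < ?s" using fs by linarith
          have w0: "w \<noteq> 0"
          proof
            assume "w = 0"
            then have "toric_weight I A (upd 0 i w) = -\<infinity>" using toric_weight_axis[OF i, of A w] by (simp add: ext_ln_def)
            then show False using lo[OF wV] s0 by (simp add: ext_ln_def)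
          qed
          have "c * ln ?s - C \<le> A i * ln (norm w)"
            using lo[OF wV] s0 unfolding toric_weight_axis_nonzero[OF i w0] by (rule scaled_ext_ln_le_ereal)
          moreover have "c * ln ((norm (f j (upd 0 i w)))\<^sup>2) \<le> c * ln ?s"
            using f0 s0 fs c by (intro mult_left_mono) simp_all
          ultimately have "c * (2 * ln (norm (f j (upd 0 i w)))) \<le> A i * ln (norm w) + C"
            using False by (simp add: ln_realpow)
          then have "ln (norm (f j (upd 0 i w))) \<le> C / (2 * c) + A i / (2 * c) * ln (norm w)"
            using c by (simp add: field_simps)
          then have "exp (ln (norm (f j (upd 0 i w)))) \<le> exp (C / (2 * c) + A i / (2 * c) * ln (norm w))"
            by (subst exp_le_cancel_iff)
          then show ?thesis using False w0 by (simp add: exp_add powr_def)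
        qed simp
      qed
      then show False using cp by simp
    qed
    moreover have "real p \<le> A i / (2 * c)" using le c by (simp add: field_simps)
    ultimately have "A i / (2 * c) = real p" by simp
    then show ?thesis by simp
  qed
  then show ?thesis using that[of "2 * c"] c by simp
qed

section \<open>Commensurable exponents and analytic singularities\<close>

lemma powr_sum_comparable:
  fixes x :: "'a \<Rightarrow> real"
  assumes "finite J" "\<And>j. j \<in> J \<Longrightarrow> 0 \<le> x j" "0 < s"
  shows "(\<Sum>j\<in>J. x j) powr s \<le> real (card J) powr s * (\<Sum>j\<in>J. x j powr s)"
    and "(\<Sum>j\<in>J. x j powr s) \<le> real (card J) * (\<Sum>j\<in>J. x j) powr s"
proof -
  show "(\<Sum>j\<in>J. x j) powr s \<le> real (card J) powr s * (\<Sum>j\<in>J. x j powr s)"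
  proof (cases "J = {}")
    case False
    \<comment> \<open>The sum is at most the number of its terms times the largest one, whose power
      is a term on the right.\<close>
    define m where "m = Max (x ` J)"
    have "m \<in> x ` J" unfolding m_def using assms(1) False by (intro Max_in) auto
    then obtain j where j: "j \<in> J" "m = x j" by auto
    have "(\<Sum>j\<in>J. x j) \<le> (\<Sum>j\<in>J. m)" unfolding m_def using assms(1) by (intro sum_mono Max_ge) auto
    then have "(\<Sum>j\<in>J. x j) powr s \<le> (real (card J) * m) powr s"
      using assms by (intro powr_mono2) (auto intro: sum_nonneg)
    also have "\<dots> = real (card J) powr s * x j powr s" using j assms(2)[OF j(1)] by (simp add: powr_mult)
    also have "\<dots> \<le> real (card J) powr s * (\<Sum>j\<in>J. x j powr s)"
      using assms j by (intro mult_left_mono member_le_sum) auto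
    finally show ?thesis .
  qed simp
  have "(\<Sum>j\<in>J. x j powr s) \<le> (\<Sum>j\<in>J. (\<Sum>j\<in>J. x j) powr s)"
    using assms by (intro sum_mono powr_mono2 member_le_sum) auto
  then show "(\<Sum>j\<in>J. x j powr s) \<le> real (card J) * (\<Sum>j\<in>J. x j) powr s" by simp
qed

lemma holomorphic_several_coordinate_power:
  "holomorphic_several (\<lambda>z :: complex^'n::finite. (z $ l) ^ n) V"
  unfolding holomorphic_several_def
proof (intro ballI exI conjI allI)
  fix z :: "complex^'n"
  have "((\<lambda>z :: complex^'n. z $ l) has_derivative (\<lambda>v. v $ l)) (at z)"
    by (rule bounded_linear_imp_has_derivative) (rule bounded_linear_vec_nth)
  from has_derivative_power[OF this, of n]
  show "((\<lambda>z :: complex^'n. (z $ l) ^ n) has_derivative (\<lambda>v. of_nat n * (v $ l) * (z $ l) ^ (n - 1))) (at z)" .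
qed (simp add: mult_ac)

text \<open>The generators are the powers \<open>(z $ l) ^ n l\<close>. With
  \<open>x l = norm (z $ l) ^ (2 * n l)\<close> the weight is the logarithm of a sum of
  \<open>x l powr (c / 2)\<close>, which is comparable to
  \<open>(\<Sum>l. x l) powr (c / 2)\<close>; hence the factor \<open>c / 2\<close>.\<close>

lemma commensurable_imp_analytic_toric:
  fixes I :: "'n::finite set"
  assumes A: "\<forall>l\<in>I. A l = c * real (n l)" and c: "0 < c" and n: "\<forall>l\<in>I. 0 < n l" and I: "I \<noteq> {}"
  shows "analytic_singularities_near (toric_weight I A :: complex^'n \<Rightarrow> ereal) p"
proof -
  have A0: "\<forall>l\<in>I. 0 < A l" using A c n by simp
  obtain h where h: "bij_betw h {1..card I} I" using ex_bij_betw_nat_finite_1[of I] by auto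
  have card: "1 \<le> card I" using I by (simp add: Suc_leI card_gt_0_iff)
  define C where "C = max (c / 2 * ln (real (card I))) (ln (real (card I)))"
  define f where "f j z = (z $ h j) ^ n (h j)" for j and z :: "complex^'n"
  have "ereal (c / 2) * ext_ln (\<Sum>j=1..card I. (norm (f j z))\<^sup>2) - ereal C \<le> toric_weight I A z \<and>
    toric_weight I A z \<le> ereal (c / 2) * ext_ln (\<Sum>j=1..card I. (norm (f j z))\<^sup>2) + ereal C" for z
  proof -
    define x where "x l = (norm (z $ l)) ^ (2 * n l)" for l
    have x0: "0 \<le> x l" for l by (simp add: x_def)
    have s: "(\<Sum>j=1..card I. (norm (f j z))\<^sup>2) = (\<Sum>l\<in>I. x l)"
    proof -
      have "(\<Sum>j=1..card I. (norm (f j z))\<^sup>2) = (\<Sum>j=1..card I. x (h j))"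
        by (simp add: f_def x_def norm_power mult.commute flip: power_mult)
      also have "\<dots> = (\<Sum>l\<in>I. x l)" by (rule sum.reindex_bij_betw[OF h])
      finally show ?thesis .
    qed
    have xp: "norm (z $ l) powr A l = x l powr (c / 2)" if l: "l \<in> I" for l
    proof (cases "z $ l = 0")
      case True then show ?thesis using n l by (simp add: x_def)
    next
      case False
      then have "x l = norm (z $ l) powr real (2 * n l)" unfolding x_def by (subst powr_realpow) auto
      then show ?thesis using A l by (simp add: powr_powr mult.commute)
    qed
    have t: "(\<Sum>l\<in>I. norm (z $ l) powr A l) = (\<Sum>l\<in>I. x l powr (c / 2))"
      using xp by (intro sum.cong) auto
    have cmp: "(\<Sum>l\<in>I. x l) powr (c / 2) \<le> real (card I) powr (c / 2) * (\<Sum>l\<in>I. x l powr (c / 2))"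
       "(\<Sum>l\<in>I. x l powr (c / 2)) \<le> real (card I) * (\<Sum>l\<in>I. x l) powr (c / 2)"
      using powr_sum_comparable[of I x "c / 2"] x0 c by auto
    show ?thesis
    proof (cases "0 < (\<Sum>l\<in>I. x l)")
      case True
      then have p1: "0 < (\<Sum>l\<in>I. x l) powr (c / 2)" by simp
      then have "0 < real (card I) powr (c / 2) * (\<Sum>l\<in>I. x l powr (c / 2))" using cmp(1) by linarith
      then have p2: "0 < (\<Sum>l\<in>I. x l powr (c / 2))" using card by (simp add: zero_less_mult_iff)
      have cI: "0 < real (card I)" using card by simp
      have "ln ((\<Sum>l\<in>I. x l) powr (c / 2)) \<le> ln (real (card I) powr (c / 2) * (\<Sum>l\<in>I. x l powr (c / 2)))"
        using cmp(1) p1 by (intro ln_mono) auto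
      moreover have "ln (real (card I) powr (c / 2) * (\<Sum>l\<in>I. x l powr (c / 2))) = c / 2 * ln (real (card I)) + ln (\<Sum>l\<in>I. x l powr (c / 2))"
        using p2 cI by (subst ln_mult) (auto simp: ln_powr)
      moreover have "ln ((\<Sum>l\<in>I. x l) powr (c / 2)) = c / 2 * ln (\<Sum>l\<in>I. x l)" using True by (simp add: ln_powr)
      moreover have "c / 2 * ln (real (card I)) \<le> C" unfolding C_def by (rule max.cobounded1)
      ultimately have 1: "c / 2 * ln (\<Sum>l\<in>I. x l) - C \<le> ln (\<Sum>l\<in>I. x l powr (c / 2))"
        by linarith
      have "ln (\<Sum>l\<in>I. x l powr (c / 2)) \<le> ln (real (card I) * (\<Sum>l\<in>I. x l) powr (c / 2))"
        using cmp(2) p2 by (intro ln_mono) auto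
      moreover have "ln (real (card I) * (\<Sum>l\<in>I. x l) powr (c / 2)) = ln (real (card I)) + c / 2 * ln (\<Sum>l\<in>I. x l)"
        using True cI by (subst ln_mult) (auto simp: ln_powr)
      moreover have "ln (real (card I)) \<le> C" unfolding C_def by (rule max.cobounded2)
      ultimately have 2: "ln (\<Sum>l\<in>I. x l powr (c / 2)) \<le> c / 2 * ln (\<Sum>l\<in>I. x l) + C"
        by linarith
      show ?thesis unfolding s toric_weight_def t using 1 2 p2 True by (simp add: ext_ln_def)
    next
      case False
      then have z: "(\<Sum>l\<in>I. x l) = 0" using sum_nonneg[of I x] x0 by (simp add: order_antisym)
      then have "(\<Sum>l\<in>I. x l powr (c / 2)) \<le> 0" using cmp(2) by simp
      then show ?thesis unfolding s toric_weight_def t using z c by (simp add: ext_ln_def)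
    qed
  qed
  moreover have "\<forall>j\<in>{1..card I}. holomorphic_several (f j) UNIV"
    unfolding f_def by (simp add: holomorphic_several_coordinate_power)
  ultimately show ?thesis
    unfolding analytic_singularities_near_def using card c plurisubharmonic_toric_weight[OF A0]
    by (intro exI[of _ UNIV] exI[of _ "card I"] exI[of _ f] exI[of _ "c / 2"] exI[of _ C]) auto
qed

lemma rational_ratios_imp_integers:
  fixes A :: "'a \<Rightarrow> real"
  assumes I: "finite I" and c: "0 < c" and A: "\<forall>l\<in>I. A l / c \<in> \<rat> \<and> 0 < A l / c"
  obtains c' n where "0 < c'" "\<forall>l\<in>I. A l = c' * real (n l) \<and> 0 < (n l :: nat)"
proof -
  have "\<exists>p q. 0 < p \<and> 0 < q \<and> A l / c = real p / real q" if l: "l \<in> I" for l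
  proof -
    obtain p q :: nat where pq: "q \<noteq> 0" "\<bar>A l / c\<bar> = real p / real q"
      using A l Rats_abs_nat_div_natE by metis
    have eq: "A l / c = real p / real q" using pq(2) A l by (metis abs_of_pos)
    moreover have "0 < real p / real q" using eq A l by metis
    ultimately show ?thesis using pq(1) by (metis bot_nat_0.not_eq_extremum divide_eq_0_iff less_irrefl of_nat_0)
  qed
  then obtain p q where pq: "\<And>l. l \<in> I \<Longrightarrow> 0 < p l \<and> 0 < q l \<and> A l / c = real (p l) / real (q l :: nat)" by metis
  define Q where "Q = (\<Prod>l\<in>I. q l)"
  have Q: "0 < Q" unfolding Q_def using pq by (intro prod_pos) auto
  have "A l = c / real Q * real (p l * (Q div q l)) \<and> 0 < p l * (Q div q l)" if l: "l \<in> I" for l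
  proof -
    have d: "q l dvd Q" unfolding Q_def using I l by (rule dvd_prodI)
    then have "real Q = real (Q div q l) * real (q l)" by (metis dvd_div_mult_self of_nat_mult)
    moreover have "0 < Q div q l" using d Q pq[OF l] by (simp add: div_greater_zero_iff dvd_imp_le)
    moreover have "A l = c * (real (p l) / real (q l))" using pq[OF l] c by (simp add: field_simps)
    ultimately show ?thesis using pq[OF l] by (simp add: field_simps)
  qed
  then show ?thesis using that[of "c / real Q" "\<lambda>l. p l * (Q div q l)"] c Q by auto
qed

text \<open>The candidate is twice the constant \<open>c\<close> of the first approximant. If some
  \<open>A i / (2 * c)\<close> is irrational, the order \<open>p\<close> found on that axis cannot
  equal this bound, and the strict inequality makes the critical monomial integrable against the
  approximant.\<close>

lemma equisingular_imp_commensurable: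
  fixes I :: "'n::finite set" and x :: "'n \<Rightarrow> nat"
  assumes A: "\<forall>l\<in>I. 0 < A l" and I: "I \<noteq> {}"
    and dec: "decreasing_equisingular_approx_near (toric_weight I A :: complex^'n \<Rightarrow> ereal) 0"
    and x: "\<forall>l\<in>I. 0 < x l" "(\<Sum>l\<in>I. real (x l) / A l) = 1"
  obtains c :: real where "0 < c" "\<And>l. l \<in> I \<Longrightarrow> A l / c \<in> \<rat>"
proof (rule ccontr)
  note res = that
  assume contra: "\<not> thesis"
  obtain U \<phi>s where U: "open U" "(0::complex^'n) \<in> U"
    and ans: "\<forall>k::nat. analytic_singularities_near (\<phi>s k) 0"
    and decrs: "\<forall>k. \<forall>z\<in>U. \<phi>s (Suc k) z \<le> \<phi>s k z"
    and lims: "\<forall>z\<in>U. (\<lambda>k. \<phi>s k z) \<longlonglongrightarrow> toric_weight I A z"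
    and mults: "\<forall>k. \<forall>z\<in>U. multiplier_ideal (\<phi>s k) z = multiplier_ideal (toric_weight I A) z"
    using dec unfolding decreasing_equisingular_approx_near_def by (elim exE conjE) (rule that)
  note an = spec[OF ans, of 0] and mono = bspec[OF spec[OF decrs]] and lim = bspec[OF lims] and mult = bspec[OF spec[OF mults]]
  define \<psi> where "\<psi> = \<phi>s 0"
  have ge: "toric_weight I A z \<le> \<psi> z" if "z \<in> U" for z
    unfolding \<psi>_def using mono[OF that] lim[OF that] by (intro decseq_ge) (auto simp: decseq_Suc_iff)
  obtain V N f c C where V: "open V" "(0::complex^'n) \<in> V" and f: "\<And>j. j \<in> {1..N::nat} \<Longrightarrow> holomorphic_several (f j) V"
    and c: "0 < c" and lo: "\<And>z. z \<in> V \<Longrightarrow> ereal c * ext_ln (\<Sum>j=1..N. (norm (f j z))\<^sup>2) - ereal C \<le> \<psi> z"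
    and up: "\<And>z. z \<in> V \<Longrightarrow> \<psi> z \<le> ereal c * ext_ln (\<Sum>j=1..N. (norm (f j z))\<^sup>2) + ereal C"
    using an unfolding analytic_singularities_near_def \<psi>_def by blast
  have c2: "0 < 2 * c" using c by simp
  have UV: "open (U \<inter> V)" "0 \<in> U \<inter> V" using U V by auto
  have "\<exists>i\<in>I. A i / (2 * c) \<notin> \<rat>" 
  proof (rule ccontr)
    assume "\<not> (\<exists>i\<in>I. A i / (2 * c) \<notin> \<rat>)"
    then have "A l / (2 * c) \<in> \<rat>" if "l \<in> I" for l using that by blast
    then have thesis by (rule res[OF c2])
    then show False using contra by blast
  qed
  then obtain i where i: "i \<in> I" "A i / (2 * c) \<notin> \<rat>" by blast
  have Ai: "0 < A i" using A i by simp
  have hol: "holomorphic_several (f j) (U \<inter> V)" if "j \<in> {1..N}" for j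
    using holomorphic_several_subset[OF f[OF that]] by blast
  obtain j p where j: "j \<in> {1..N}" and cp: "taylor_coeff (\<lambda>w. f j (upd 0 i w)) p \<noteq> 0" and le: "2 * c * real p \<le> A i"
  proof (rule exists_low_axis_coeff[where A=A and \<psi>=\<psi> and C=C, OF i(1) UV hol finite_atLeastAtMost c])
    show "toric_weight I A z \<le> \<psi> z" if "z \<in> U \<inter> V" for z using ge that by blast
    show "\<psi> z \<le> ereal c * ext_ln (\<Sum>j=1..N. (norm (f j z))\<^sup>2) + ereal C" if "z \<in> U \<inter> V" for z
      using up that by blast
  qed (use Ai in simp_all)
  have "2 * c * real p \<noteq> A i"
  proof
    assume "2 * c * real p = A i"
    then have "A i / (2 * c) = real p" using c by (simp add: field_simps)
    then show False using i(2) by simp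
  qed
  then have lt: "2 * c * real p < A i" using le by simp
  \<comment> \<open>Positivity of \<open>x\<close> on \<open>I\<close> makes the truncated
    subtraction exact there, and the exponents \<open>\<beta>\<close> sit at the critical value of
    the integrability criterion.\<close>
  define \<beta> where "\<beta> l = x l - 1" for l
  have \<beta>: "real (\<beta> l) + 1 = real (x l)" if "l \<in> I" for l 
  proof -
    have "0 < x l" using x(1) that by blast
    then show ?thesis unfolding \<beta>_def by (cases "x l") simp_all
  qed
  have sum: "(\<Sum>l\<in>I. (real (\<beta> l) + 1) / A l) = 1"
    using x(2) \<beta> by (simp cong: sum.cong)
  have lo2: "ereal c * ext_ln ((norm (f j z))\<^sup>2) - ereal C \<le> \<psi> z" if "z \<in> U \<inter> V" for z
  proof -
    have "(norm (f j z))\<^sup>2 \<le> (\<Sum>j=1..N. (norm (f j z))\<^sup>2)" using j by (intro member_le_sum) auto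
    then have "ereal c * ext_ln ((norm (f j z))\<^sup>2) - ereal C \<le> ereal c * ext_ln (\<Sum>j=1..N. (norm (f j z))\<^sup>2) - ereal C"
      using c by (intro ereal_minus_mono ereal_mult_left_mono ext_ln_mono) auto
    then show ?thesis using lo that by (meson IntD2 order_trans)
  qed
  define g where "g z = (\<Prod>l\<in>I. (z $ l) ^ \<beta> l)" for z :: "complex^'n"
  have ng: "norm (g z) = (\<Prod>l\<in>I. norm (z $ l) ^ \<beta> l)" for z
    by (simp add: g_def prod_norm[symmetric] norm_power)
  obtain W where W: "open W" "0 \<in> W" "W \<subseteq> U \<inter> V"
    and int: "(\<integral>\<^sup>+ z\<in>W. ennreal ((\<Prod>l\<in>I. norm (z $ l) ^ \<beta> l)\<^sup>2) * ext_exp (- 2 * \<psi> z) \<partial>lborel) < \<infinity>"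
    using integrable_below_axis_order[OF A i(1) _ UV hol[OF j] cp c lt _ lo2, of \<beta>] sum ge by auto
  have gh: "holomorphic_several g W"
    unfolding holomorphic_several_def
  proof (intro ballI exI conjI allI)
    fix z assume "z \<in> W"
    have d: "((\<lambda>z :: complex^'n. (z $ l) ^ \<beta> l) has_derivative (\<lambda>v. of_nat (\<beta> l) * (v $ l) * (z $ l) ^ (\<beta> l - 1))) (at z)" for l
      by (rule has_derivative_power[OF bounded_linear_imp_has_derivative[OF bounded_linear_vec_nth]])
    show "(g has_derivative (\<lambda>v. \<Sum>i\<in>I. of_nat (\<beta> i) * (v $ i) * (z $ i) ^ (\<beta> i - 1) * (\<Prod>j\<in>I - {i}. (z $ j) ^ \<beta> j))) (at z)"
      unfolding g_def[abs_def] by (rule has_derivative_prod[OF d])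
  qed (simp add: sum_distrib_left mult_ac)
  have "g \<in> multiplier_ideal \<psi> 0"
    unfolding multiplier_ideal_def using W gh int by (auto simp: ng)
  then have "g \<in> multiplier_ideal (toric_weight I A) 0" using mult[OF U(2)] by (simp add: \<psi>_def)
  then obtain W' where W': "open W'" "0 \<in> W'"
    "(\<integral>\<^sup>+ z\<in>W'. ennreal ((norm (g z))\<^sup>2) * ext_exp (- 2 * toric_weight I A z) \<partial>lborel) < \<infinity>"
    unfolding multiplier_ideal_def by blast
  moreover have "(\<integral>\<^sup>+ z\<in>W'. ennreal ((norm (g z))\<^sup>2) * ext_exp (- 2 * toric_weight I A z) \<partial>lborel) = \<infinity>"
    using toric_monomial_not_integrable[OF A I _ _ W'(1,2), of \<beta> 1 g] sum ng by auto
  ultimately show False by simp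
qed

section \<open>Symmetric functions\<close>

definition unity_root :: "nat \<Rightarrow> complex" where
  "unity_root N = exp (2 * of_real pi * \<i> / of_nat N)"

lemma unity_root_power: "unity_root N ^ q = exp (2 * of_real pi * \<i> * of_nat q / of_nat N)"
  unfolding unity_root_def by (simp add: mult_ac flip: exp_of_nat_mult)

lemma unity_root_power_eq_iff:
  assumes "1 \<le> N" shows "unity_root N ^ q = unity_root N ^ j \<longleftrightarrow> q mod N = j mod N"
  unfolding unity_root_power using complex_root_unity_eq[OF assms] by (simp add: mult_ac)

lemma unity_root_power_self: "1 \<le> N \<Longrightarrow> unity_root N ^ N = 1"
  using unity_root_power_eq_iff[of N N 0] by simp

lemma norm_unity_root [simp]: "norm (unity_root N) = 1"
  unfolding unity_root_def by (simp add: norm_exp_eq_Re)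

lemma unity_root_nonzero [simp]: "unity_root N \<noteq> 0"
  unfolding unity_root_def by simp

lemma sum_unity_root:
  assumes N: "1 \<le> N" and t: "t < N"
  shows "(\<Sum>j<N. inverse (unity_root N) ^ (j * t)) = (if t = 0 then of_nat N else 0)"
proof (cases "t = 0")
  case False
  define x where "x = inverse (unity_root N) ^ t"
  have "unity_root N ^ t \<noteq> 1" using unity_root_power_eq_iff[OF N, of t 0] t False by simp
  then have x1: "x \<noteq> 1" unfolding x_def power_inverse by (metis inverse_1 inverse_inverse_eq)
  have "x ^ N = inverse ((unity_root N ^ N) ^ t)"
    unfolding x_def by (simp add: power_inverse flip: power_mult) (simp add: mult.commute)
  then have xN: "x ^ N = 1" using unity_root_power_self[OF N] by simp
  have "(\<Sum>j<N. x ^ j) = (x ^ N - 1) / (x - 1)" by (rule geometric_sum[OF x1])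
  then have "(\<Sum>j<N. x ^ j) = 0" using xN by simp
  moreover have "inverse (unity_root N) ^ (j * t) = x ^ j" for j
    by (simp add: x_def mult.commute flip: power_mult)
  ultimately show ?thesis using False by simp
qed simp

text \<open>Comparing the \<open>q\<close>-th derivatives of both sides of the symmetry at zero,
  either the derivative vanishes or \<open>q\<close> is congruent to \<open>j\<close> modulo
  \<open>N\<close>. Below \<open>j + N\<close> the congruence leaves only
  \<open>q = j\<close>.\<close>

lemma taylor_coeff_symmetric:
  assumes F: "F holomorphic_on ball 0 R" and R: "0 < R" and N: "1 \<le> N" and j: "j < N"
    and sym: "\<And>w. norm w < R \<Longrightarrow> F (unity_root N * w) = unity_root N ^ j * F w"
    and q: "q < j + N" "q \<noteq> j"
  shows "taylor_coeff F q = 0"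
proof -
  let ?\<omega> = "unity_root N"
  have sub: "\<And>w. w \<in> ball 0 R \<Longrightarrow> ?\<omega> * w \<in> ball 0 R" by (simp add: norm_mult)
  have "(deriv ^^ q) (\<lambda>w. F (?\<omega> * w)) 0 = ?\<omega> ^ q * (deriv ^^ q) F (?\<omega> * 0)"
  proof (rule higher_deriv_compose_linear[OF F open_ball open_ball])
    show "0 \<in> ball (0::complex) R" using R by simp
  qed (rule sub)
  moreover have "(deriv ^^ q) (\<lambda>w. F (?\<omega> * w)) 0 = (deriv ^^ q) (\<lambda>w. ?\<omega> ^ j * F w) 0"
  proof (rule higher_deriv_transform_within_open[OF _ _ open_ball[of 0 R]])
    show "(\<lambda>w. F (?\<omega> * w)) holomorphic_on ball 0 R"
      using holomorphic_on_compose_gen[OF _ F, of "\<lambda>w. ?\<omega> * w" "ball 0 R"] sub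
      by (simp add: o_def holomorphic_intros image_subset_iff)
    show "(\<lambda>w. ?\<omega> ^ j * F w) holomorphic_on ball 0 R" by (intro holomorphic_intros F)
  qed (use R sym in auto)
  moreover have "(deriv ^^ q) (\<lambda>w. ?\<omega> ^ j * F w) 0 = ?\<omega> ^ j * (deriv ^^ q) F 0"
    by (rule higher_deriv_cmult[OF F]) (use R in auto)
  ultimately have "(?\<omega> ^ q - ?\<omega> ^ j) * (deriv ^^ q) F 0 = 0" by (auto simp: left_diff_distrib)
  moreover have "?\<omega> ^ q \<noteq> ?\<omega> ^ j"
  proof
    assume "?\<omega> ^ q = ?\<omega> ^ j"
    then have m: "q mod N = j" using unity_root_power_eq_iff[OF N] j by simp
    have "q = q div N * N + j" using m by (metis div_mult_mod_eq)
    then have "q div N * N < 1 * N" using q(1) by linarith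
    then have "q div N = 0" by (metis less_one mult_less_cancel2)
    then show False using \<open>q = q div N * N + j\<close> q(2) by simp
  qed
  ultimately show ?thesis by (simp add: taylor_coeff_def)
qed

section \<open>Functions with gaps in their Taylor series\<close>

definition slices_holomorphic :: "(complex^'n::finite \<Rightarrow> complex) \<Rightarrow> complex^'n \<Rightarrow> real \<Rightarrow> bool" where
  "slices_holomorphic K p R \<longleftrightarrow>
     (\<forall>z\<in>polydisc p R. \<forall>l. (\<lambda>w. K (upd z l (p $ l + w))) holomorphic_on ball 0 R)"

text \<open>
  In each coordinate the Taylor series at the centre has, up to order \<open>\<alpha> l + \<nu> l\<close>, only the
  \<open>\<alpha> l\<close>-th term; \<open>\<alpha> l = 0\<close>, \<open>\<nu> l = 1\<close> is no condition.
\<close>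

definition gapped :: "(complex^'n::finite \<Rightarrow> complex) \<Rightarrow> complex^'n \<Rightarrow> real \<Rightarrow> ('n \<Rightarrow> nat) \<Rightarrow> ('n \<Rightarrow> nat) \<Rightarrow> bool" where
  "gapped K p R \<alpha> \<nu> \<longleftrightarrow>
     (\<forall>z\<in>polydisc p R. \<forall>l. \<forall>q<\<alpha> l + \<nu> l. q \<noteq> \<alpha> l \<longrightarrow> taylor_coeff (\<lambda>w. K (upd z l (p $ l + w))) q = 0)"

definition shifted_monomial :: "('n \<Rightarrow> nat) \<Rightarrow> complex^'n \<Rightarrow> complex^'n::finite \<Rightarrow> complex" where
  "shifted_monomial \<alpha> p z = (\<Prod>k\<in>UNIV. (z $ k - p $ k) ^ \<alpha> k)"

lemma upd_shift_in_polydisc: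
  fixes z p :: "complex^'n::finite"
  assumes "z \<in> polydisc p R" "norm w < R"
  shows "upd z l (p $ l + w) \<in> polydisc p R"
  using assms by (auto simp: polydisc_def)

text \<open>A Schwarz lemma, one coordinate after another. The induction hypothesis bounds the whole
  slice in direction \<open>l\<close>; as its coefficients below \<open>\<alpha> l\<close> vanish,
  the Taylor remainder of that order is the function itself. Each coordinate costs a factor
  2.\<close>

lemma gapped_upper_bound:
  fixes K :: "complex^'n::finite \<Rightarrow> complex" and z :: "complex^'n"
  assumes hol: "slices_holomorphic K p R" and gap: "gapped K p R \<alpha> \<nu>" and R: "0 < R"
    and M: "\<And>z. z \<in> polydisc p R \<Longrightarrow> norm (K z) \<le> M"
    and J: "finite J" and z: "z \<in> polydisc p R" "\<And>l. l \<in> J \<Longrightarrow> norm (z $ l - p $ l) \<le> R / 4"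
  shows "norm (K z) \<le> M * 2 ^ card J * (\<Prod>l\<in>J. (2 * norm (z $ l - p $ l) / R) ^ \<alpha> l)"
  using J z
proof (induction J arbitrary: z rule: finite_induct)
  case empty
  then show ?case using M by simp
next
  case (insert l J)
  define F where "F = (\<lambda>w. K (upd z l (p $ l + w)))"
  define B where "B = M * 2 ^ card J * (\<Prod>k\<in>J. (2 * norm (z $ k - p $ k) / R) ^ \<alpha> k)"
  have F: "F holomorphic_on ball 0 R" using hol insert.prems(1) by (simp add: slices_holomorphic_def F_def)
  have FB: "norm (F w) \<le> B" if w: "norm w < R" for w
  proof -
    have "norm (F w) \<le> M * 2 ^ card J * (\<Prod>k\<in>J. (2 * norm (upd z l (p $ l + w) $ k - p $ k) / R) ^ \<alpha> k)"
      unfolding F_def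
    proof (rule insert.IH)
      show "upd z l (p $ l + w) \<in> polydisc p R" by (rule upd_shift_in_polydisc[OF insert.prems(1) w])
      fix k assume "k \<in> J"
      then show "norm (upd z l (p $ l + w) $ k - p $ k) \<le> R / 4"
        using insert.hyps insert.prems(2) by auto
    qed
    also have "(\<Prod>k\<in>J. (2 * norm (upd z l (p $ l + w) $ k - p $ k) / R) ^ \<alpha> k) = (\<Prod>k\<in>J. (2 * norm (z $ k - p $ k) / R) ^ \<alpha> k)"
      using insert.hyps by (intro prod.cong) auto
    finally show ?thesis by (simp add: B_def)
  qed
  have zero: "taylor_coeff F q = 0" if "q < \<alpha> l" for q
    using gap insert.prems(1) that unfolding gapped_def F_def by (metis add_lessD1 nat_neq_iff trans_less_add1)
  have "norm (F (z $ l - p $ l) - (\<Sum>q<\<alpha> l. taylor_coeff F q * (z $ l - p $ l) ^ q)) \<le> 2 * B * (2 * norm (z $ l - p $ l) / R) ^ \<alpha> l"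
    using taylor_remainder_bound[OF F R FB] insert.prems(2) by auto
  moreover have "(\<Sum>q<\<alpha> l. taylor_coeff F q * (z $ l - p $ l) ^ q) = 0"
    using zero by (intro sum.neutral) auto
  moreover have "F (z $ l - p $ l) = K z" by (simp add: F_def)
  ultimately show ?case using insert.hyps by (simp add: B_def mult_ac)
qed

text \<open>With the other coordinates fixed, dividing by their part \<open>Q\<close> of the
  monomial gives a function \<open>G\<close> whose bound does not depend on them. Both quotients in
  the claim are close to the same number, the \<open>\<alpha> l\<close>-th Taylor coefficient of
  \<open>G\<close>; the error has order \<open>\<nu> l\<close> because the coefficients in between
  vanish.\<close>

lemma gapped_coordinate_oscillation:
  fixes K :: "complex^'n::finite \<Rightarrow> complex" and z p :: "complex^'n" and v :: complex
  assumes hol: "slices_holomorphic K p R" and gap: "gapped K p R \<alpha> \<nu>" and R: "0 < R" and \<nu>: "\<And>l. 1 \<le> \<nu> l"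
    and M: "\<And>z. z \<in> polydisc p R \<Longrightarrow> norm (K z) \<le> M"
    and z: "z \<in> polydisc p (R / 4)" and v: "norm (v - p $ l) < R / 4"
    and nz: "\<And>k. \<alpha> k = 0 \<or> z $ k \<noteq> p $ k" and nv: "\<alpha> l = 0 \<or> v \<noteq> p $ l"
  shows "norm (K z / shifted_monomial \<alpha> p z - K (upd z l v) / shifted_monomial \<alpha> p (upd z l v))
      \<le> 2 * (M * 2 ^ CARD('n) * (\<Prod>k\<in>UNIV. (2 / R) ^ \<alpha> k)) * (2 / R) ^ \<nu> l * (norm (z $ l - p $ l) ^ \<nu> l + norm (v - p $ l) ^ \<nu> l)"
proof -
  let ?J = "UNIV - {l}"
  define Q where "Q = (\<Prod>k\<in>?J. (z $ k - p $ k) ^ \<alpha> k)"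
  define G where "G = (\<lambda>w. K (upd z l (p $ l + w)) / Q)"
  define B where "B = M * 2 ^ CARD('n) * (\<Prod>k\<in>?J. (2 / R) ^ \<alpha> k)"
  have zR: "z \<in> polydisc p R" using z polydisc_mono[of "R/4" R] R by auto
  have M0: "0 \<le> M" using M[OF zR] norm_ge_zero order_trans by blast
  have "(z $ k - p $ k) ^ \<alpha> k \<noteq> 0" for k using nz[of k] by auto
  then have Q0: "Q \<noteq> 0" unfolding Q_def by simp
  have KG: "(\<lambda>w. K (upd z l (p $ l + w))) holomorphic_on ball 0 R"
    using hol zR by (simp add: slices_holomorphic_def)
  have G: "G holomorphic_on ball 0 R" unfolding G_def by (intro holomorphic_on_divide KG holomorphic_on_const Q0)
  have GB: "norm (G w) \<le> B" if w: "norm w < R" for w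
  proof -
    have "norm (K (upd z l (p $ l + w))) \<le> M * 2 ^ card ?J * (\<Prod>k\<in>?J. (2 * norm (upd z l (p $ l + w) $ k - p $ k) / R) ^ \<alpha> k)"
    proof (rule gapped_upper_bound[OF hol gap R M])
      show "upd z l (p $ l + w) \<in> polydisc p R" by (rule upd_shift_in_polydisc[OF zR w])
      fix k assume "k \<in> ?J"
      then show "norm (upd z l (p $ l + w) $ k - p $ k) \<le> R / 4" using z by (auto simp: polydisc_def order_less_imp_le)
    qed auto
    also have "(\<Prod>k\<in>?J. (2 * norm (upd z l (p $ l + w) $ k - p $ k) / R) ^ \<alpha> k) = (\<Prod>k\<in>?J. (2 / R) ^ \<alpha> k) * norm Q"
      unfolding Q_def prod_norm[symmetric] prod.distrib[symmetric]
      by (intro prod.cong) (auto simp: norm_power power_mult_distrib power_divide)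
    also have "M * 2 ^ card ?J * ((\<Prod>k\<in>?J. (2 / R) ^ \<alpha> k) * norm Q) \<le> B * norm Q"
    proof -
      have "(2::real) ^ card ?J \<le> 2 ^ CARD('n)" by (intro power_increasing card_mono) auto
      then have "M * 2 ^ card ?J * (\<Prod>k\<in>?J. (2 / R) ^ \<alpha> k) * norm Q \<le> M * 2 ^ CARD('n) * (\<Prod>k\<in>?J. (2 / R) ^ \<alpha> k) * norm Q"
        using M0 R by (intro mult_right_mono mult_left_mono prod_nonneg) auto
      then show ?thesis by (simp add: B_def mult_ac)
    qed
    finally show ?thesis unfolding G_def norm_divide using Q0 by (simp add: field_simps)
  qed
  have tc: "taylor_coeff G q = 0" if "q < \<alpha> l + \<nu> l" "q \<noteq> \<alpha> l" for q
  proof -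
    have "taylor_coeff (\<lambda>w. K (upd z l (p $ l + w))) q = 0" using gap zR that by (simp add: gapped_def)
    moreover have "(deriv ^^ q) (\<lambda>w. inverse Q * K (upd z l (p $ l + w))) 0 = inverse Q * (deriv ^^ q) (\<lambda>w. K (upd z l (p $ l + w))) 0"
      by (rule higher_deriv_cmult[OF KG]) (use R in auto)
    ultimately show ?thesis unfolding taylor_coeff_def G_def divide_inverse by (simp add: mult.commute)
  qed
  have est: "norm (K (upd z l v) / shifted_monomial \<alpha> p (upd z l v) - taylor_coeff G (\<alpha> l)) \<le> 2 * B * (2 / R) ^ (\<alpha> l + \<nu> l) * norm (v - p $ l) ^ \<nu> l"
    if v: "norm (v - p $ l) < R / 4" and nv: "\<alpha> l = 0 \<or> v \<noteq> p $ l" for v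
  proof -
    let ?w = "v - p $ l"
    have w0: "?w ^ \<alpha> l \<noteq> 0" using nv by auto
    have "(\<Sum>q<\<alpha> l + \<nu> l. taylor_coeff G q * ?w ^ q) = (\<Sum>q\<in>{\<alpha> l}. taylor_coeff G q * ?w ^ q)"
      using tc \<nu>[of l] by (intro sum.mono_neutral_right) auto
    then have "norm (G ?w - taylor_coeff G (\<alpha> l) * ?w ^ \<alpha> l) \<le> 2 * B * (2 * norm ?w / R) ^ (\<alpha> l + \<nu> l)"
      using taylor_remainder_bound[OF G R GB, of ?w "\<alpha> l + \<nu> l"] v by simp
    also have "(2 * norm ?w / R) ^ (\<alpha> l + \<nu> l) = (2 / R) ^ (\<alpha> l + \<nu> l) * norm ?w ^ \<nu> l * norm (?w ^ \<alpha> l)"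
      by (simp add: power_mult_distrib power_divide power_add norm_power mult_ac)
    finally have "norm (G ?w - taylor_coeff G (\<alpha> l) * ?w ^ \<alpha> l) / norm (?w ^ \<alpha> l) \<le> 2 * B * (2 / R) ^ (\<alpha> l + \<nu> l) * norm ?w ^ \<nu> l"
      using w0 by (simp add: field_simps)
    moreover have "norm (G ?w - taylor_coeff G (\<alpha> l) * ?w ^ \<alpha> l) / norm (?w ^ \<alpha> l) = norm (G ?w / ?w ^ \<alpha> l - taylor_coeff G (\<alpha> l))"
      using w0 by (simp add: norm_divide[symmetric] diff_divide_distrib)
    moreover have "G ?w / ?w ^ \<alpha> l = K (upd z l v) / shifted_monomial \<alpha> p (upd z l v)"
    proof -
      have "shifted_monomial \<alpha> p (upd z l v) = ?w ^ \<alpha> l * (\<Prod>k\<in>?J. (upd z l v $ k - p $ k) ^ \<alpha> k)"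
        unfolding shifted_monomial_def by (subst prod.remove[of UNIV l]) auto
      also have "(\<Prod>k\<in>?J. (upd z l v $ k - p $ k) ^ \<alpha> k) = Q"
        unfolding Q_def by (intro prod.cong) auto
      finally show ?thesis by (simp add: G_def mult.commute)
    qed
    ultimately show ?thesis by simp
  qed
  have "norm (z $ l - p $ l) < R / 4" using z by (simp add: polydisc_def)
  from est[OF this nz] have 1: "norm (K z / shifted_monomial \<alpha> p z - taylor_coeff G (\<alpha> l)) \<le> 2 * B * (2 / R) ^ (\<alpha> l + \<nu> l) * norm (z $ l - p $ l) ^ \<nu> l"
    by simp
  have "norm (K z / shifted_monomial \<alpha> p z - K (upd z l v) / shifted_monomial \<alpha> p (upd z l v))
      \<le> norm (K z / shifted_monomial \<alpha> p z - taylor_coeff G (\<alpha> l)) + norm (K (upd z l v) / shifted_monomial \<alpha> p (upd z l v) - taylor_coeff G (\<alpha> l))"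
    using norm_triangle_ineq4[of "K z / shifted_monomial \<alpha> p z - taylor_coeff G (\<alpha> l)" "K (upd z l v) / shifted_monomial \<alpha> p (upd z l v) - taylor_coeff G (\<alpha> l)"] by simp
  also have "\<dots> \<le> 2 * B * (2 / R) ^ (\<alpha> l + \<nu> l) * (norm (z $ l - p $ l) ^ \<nu> l + norm (v - p $ l) ^ \<nu> l)"
    using 1 est[OF v nv] by (simp add: distrib_left)
  also have "2 * B * (2 / R) ^ (\<alpha> l + \<nu> l) = 2 * (M * 2 ^ CARD('n) * (\<Prod>k\<in>UNIV. (2 / R) ^ \<alpha> k)) * (2 / R) ^ \<nu> l"
  proof -
    have "(\<Prod>k\<in>UNIV. (2 / R) ^ \<alpha> k) = (2 / R) ^ \<alpha> l * (\<Prod>k\<in>?J. (2 / R) ^ \<alpha> k)"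
      by (rule prod.remove) auto
    then show ?thesis unfolding B_def by (simp add: power_add)
  qed
  finally show ?thesis .
qed

text \<open>The constants of the single coordinates are summed so as to dominate each of them. The
  function enters only through its bound \<open>M\<close>, and the centre does not enter, so all
  points of the singular locus share the constant.\<close>

definition oscillation_const :: "real \<Rightarrow> real \<Rightarrow> ('n::finite \<Rightarrow> nat) \<Rightarrow> ('n \<Rightarrow> nat) \<Rightarrow> real" where
  "oscillation_const M R \<alpha> \<nu> =
     (\<Sum>l\<in>UNIV. 2 * (M * 2 ^ CARD('n) * (\<Prod>k\<in>UNIV. (2 / R) ^ \<alpha> k)) * (2 / R) ^ \<nu> l)"

lemma oscillation_const_nonneg: "0 \<le> M \<Longrightarrow> 0 < R \<Longrightarrow> 0 \<le> oscillation_const M R \<alpha> \<nu>"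
  unfolding oscillation_const_def by (intro sum_nonneg mult_nonneg_nonneg prod_nonneg) auto

text \<open>The coordinates of \<open>z\<close> are exchanged for those of \<open>z'\<close> one at
  a time. The mixed points stay in the polydisc and off the zeros of the monomial.\<close>

lemma gapped_oscillation:
  fixes K :: "complex^'n::finite \<Rightarrow> complex" and p z z' :: "complex^'n"
  assumes hol: "slices_holomorphic K p R" and gap: "gapped K p R \<alpha> \<nu>" and R: "0 < R" and \<nu>: "\<And>l. 1 \<le> \<nu> l"
    and M: "\<And>z. z \<in> polydisc p R \<Longrightarrow> norm (K z) \<le> M"
    and z: "z \<in> polydisc p (R / 4)" "\<And>k. \<alpha> k = 0 \<or> z $ k \<noteq> p $ k"
    and z': "z' \<in> polydisc p (R / 4)" "\<And>k. \<alpha> k = 0 \<or> z' $ k \<noteq> p $ k"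
  shows "norm (K z / shifted_monomial \<alpha> p z - K z' / shifted_monomial \<alpha> p z')
         \<le> oscillation_const M R \<alpha> \<nu> * (\<Sum>l\<in>UNIV. norm (z $ l - p $ l) ^ \<nu> l + norm (z' $ l - p $ l) ^ \<nu> l)"
proof -
  define C0 where "C0 l = 2 * (M * 2 ^ CARD('n) * (\<Prod>k\<in>UNIV. (2 / R) ^ \<alpha> k)) * (2 / R) ^ \<nu> l" for l
  define C where "C = oscillation_const M R \<alpha> \<nu>"
  have C_eq: "C = (\<Sum>l\<in>UNIV. C0 l)" by (simp add: C_def oscillation_const_def C0_def)
  have "norm (K p) \<le> M" using M[of p] R by (simp add: centre_in_polydisc)
  then have M0: "0 \<le> M" by (rule order_trans[OF norm_ge_zero])
  have C0: "0 \<le> C0 l" for l unfolding C0_def using M0 R by (intro mult_nonneg_nonneg prod_nonneg) auto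
  have C0C: "C0 l \<le> C" for l unfolding C_eq using C0 by (intro member_le_sum) auto
    define mix where "mix J = (\<chi> k. if k \<in> J then z' $ k else z $ k)" for J
    define Q where "Q y = K y / shifted_monomial \<alpha> p y" for y
    have mix: "mix J \<in> polydisc p (R / 4)" "\<And>k. \<alpha> k = 0 \<or> mix J $ k \<noteq> p $ k" for J
      using z z' by (auto simp: mix_def polydisc_def)
    have "norm (Q z - Q (mix J)) \<le> C * (\<Sum>l\<in>J. norm (z $ l - p $ l) ^ \<nu> l + norm (z' $ l - p $ l) ^ \<nu> l)" if "finite J" for J
      using that
    proof (induction J rule: finite_induct)
      case empty
      have "mix {} = z" by (simp add: mix_def vec_eq_iff)
      then show ?case by simp
    next
      case (insert l J)
      have ins: "mix (insert l J) = upd (mix J) l (z' $ l)" by (auto simp: mix_def vec_eq_iff)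
      have ml: "mix J $ l = z $ l" using insert by (simp add: mix_def)
      have vl: "norm (z' $ l - p $ l) < R / 4" using z' by (simp add: polydisc_def)
      have "norm (Q (mix J) - Q (mix (insert l J))) \<le> C0 l * (norm (mix J $ l - p $ l) ^ \<nu> l + norm (z' $ l - p $ l) ^ \<nu> l)"
        unfolding Q_def ins C0_def
        by (rule gapped_coordinate_oscillation[OF hol gap R \<nu> M mix(1) vl mix(2) z'(2)])
      also have "\<dots> \<le> C * (norm (z $ l - p $ l) ^ \<nu> l + norm (z' $ l - p $ l) ^ \<nu> l)"
        unfolding ml by (intro mult_right_mono C0C) simp
      finally have "norm (Q z - Q (mix (insert l J))) \<le> C * (\<Sum>l\<in>J. norm (z $ l - p $ l) ^ \<nu> l + norm (z' $ l - p $ l) ^ \<nu> l) + C * (norm (z $ l - p $ l) ^ \<nu> l + norm (z' $ l - p $ l) ^ \<nu> l)"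
        using insert.IH norm_triangle_ineq[of "Q z - Q (mix J)" "Q (mix J) - Q (mix (insert l J))"] by simp
      then show ?case using insert.hyps by (simp add: distrib_left)
    qed
    from this[of UNIV] have "norm (Q z - Q (mix UNIV)) \<le> C * (\<Sum>l\<in>UNIV. norm (z $ l - p $ l) ^ \<nu> l + norm (z' $ l - p $ l) ^ \<nu> l)"
      by simp
    moreover have "mix UNIV = z'" by (simp add: mix_def vec_eq_iff)
    ultimately show ?thesis by (simp add: Q_def C_def)
qed

text \<open>
  If the leading coefficient of a symmetric function did not vanish at some point of the singular
  locus, the function would be bounded below by its monomial there and not be square integrable;
  so the next terms, \<open>N\<close> orders higher, dominate.
\<close>

lemma symmetric_square_integrable_bound:
  fixes K :: "complex^'n::finite \<Rightarrow> complex" and x :: "complex^'n"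
  assumes b: "\<forall>l\<in>I. 0 < b l" and I: "I \<noteq> {}" and x: "\<forall>l\<in>I. x $ l = 0"
    and R: "0 < R" and N: "1 \<le> N"
    and hol: "\<And>p. (\<forall>l\<in>I. p $ l = 0) \<Longrightarrow> p \<in> polydisc x (R / 2) \<Longrightarrow> slices_holomorphic K p (R / 2)"
    and gap: "\<And>p. (\<forall>l\<in>I. p $ l = 0) \<Longrightarrow> p \<in> polydisc x (R / 2) \<Longrightarrow>
       gapped K p (R / 2) (\<lambda>l. if l \<in> I then \<alpha> l else 0) (\<lambda>l. if l \<in> I then N else 1)"
    and M: "\<And>z. z \<in> polydisc x R \<Longrightarrow> norm (K z) \<le> M"
    and int: "(\<integral>\<^sup>+ z\<in>polydisc x R. ennreal ((norm (K z))\<^sup>2) * ext_exp (- 2 * toric_weight I b z) \<partial>lborel) < \<infinity>"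
    and sum: "(\<Sum>l\<in>I. (real (\<alpha> l) + 1) / b l) \<le> 1"
  obtains C where "0 \<le> C" "\<And>z. z \<in> polydisc x (R / 8) \<Longrightarrow> \<forall>l\<in>I. z $ l \<noteq> 0 \<Longrightarrow>
      norm (K z) \<le> C * (\<Prod>l\<in>I. norm (z $ l) ^ \<alpha> l) * (\<Sum>l\<in>I. norm (z $ l) ^ N)"
proof -
  define \<alpha>' where "\<alpha>' = (\<lambda>l. if l \<in> I then \<alpha> l else 0)"
  define \<nu> where "\<nu> = (\<lambda>l. if l \<in> I then N else 1 :: nat)"
  define C where "C = oscillation_const M (R / 2) \<alpha>' \<nu>"
  have "norm (K x) \<le> M" using M[of x] R by (simp add: centre_in_polydisc)
  then have M0: "0 \<le> M" by (rule order_trans[OF norm_ge_zero])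
  have C: "0 \<le> C" unfolding C_def using M0 R by (intro oscillation_const_nonneg) auto
  have "norm (K z) \<le> C * (\<Prod>l\<in>I. norm (z $ l) ^ \<alpha> l) * (\<Sum>l\<in>I. norm (z $ l) ^ N)"
    if z: "z \<in> polydisc x (R / 8)" and znz: "\<forall>l\<in>I. z $ l \<noteq> 0" for z
  proof -
    \<comment> \<open>The foot of \<open>z\<close> on the singular locus. Its other coordinates
      agree with those of \<open>z\<close>, so \<open>z\<close> contributes only through
      \<open>I\<close> to the oscillation bound.\<close>
    define p where "p = (\<chi> l. if l \<in> I then 0 else z $ l)"
    have pI: "\<forall>l\<in>I. p $ l = 0" by (simp add: p_def)
    have p8: "p \<in> polydisc x (R / 8)" using z x R by (auto simp: polydisc_def p_def)
    then have p2: "p \<in> polydisc x (R / 2)" using polydisc_mono[of "R/8" "R/2"] R by auto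
    have sub: "polydisc p (R / 2) \<subseteq> polydisc x R" by (rule half_polydisc_subset[OF p2])
    have zp: "z \<in> polydisc p (R / 2 / 4)"
      unfolding polydisc_def
    proof (intro CollectI allI)
      fix l
      have "norm (z $ l - x $ l) < R / 8" using z by (simp add: polydisc_def)
      then show "norm (z $ l - p $ l) < R / 2 / 4" using x R by (cases "l \<in> I") (auto simp: p_def)
    qed
    have mono: "norm (shifted_monomial \<alpha>' p y) = (\<Prod>l\<in>I. norm (y $ l) ^ \<alpha> l)" for y
    proof -
      have "norm (shifted_monomial \<alpha>' p y) = (\<Prod>l\<in>UNIV. norm (y $ l - p $ l) ^ \<alpha>' l)"
        unfolding shifted_monomial_def by (simp add: prod_norm[symmetric] norm_power)
      also have "\<dots> = (\<Prod>l\<in>I. norm (y $ l - p $ l) ^ \<alpha>' l)"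
        by (rule prod.mono_neutral_right) (auto simp: \<alpha>'_def)
      also have "\<dots> = (\<Prod>l\<in>I. norm (y $ l) ^ \<alpha> l)"
        by (intro prod.cong) (auto simp: \<alpha>'_def p_def)
      finally show ?thesis .
    qed
    let ?q = "\<lambda>y. K y / shifted_monomial \<alpha>' p y"
    let ?T = "\<Sum>l\<in>I. norm (z $ l) ^ N"
    \<comment> \<open>Arbitrarily close to \<open>p\<close> there is a point \<open>y\<close> with a
      small quotient, since otherwise the integral near \<open>p\<close> would be infinite.
      Comparison with \<open>y\<close> bounds the quotient at \<open>z\<close>.\<close>
    have key: "norm (?q z) \<le> C * ?T + e" if e: "0 < e" for e
    proof -
      \<comment> \<open>The choice absorbs the quotient at \<open>y\<close> and the terms of
        \<open>y\<close> in the oscillation sum: \<open>r * (1 + C * CARD('n)) \<le> e\<close>. The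
        bound \<open>r \<le> 1\<close> makes each of those terms at most \<open>r\<close>.\<close>
      define r where "r = min (min 1 (R / 2 / 4)) (e / (1 + C * real CARD('n)))"
      have d: "0 < 1 + C * real CARD('n)" using C by (intro add_pos_nonneg) auto
      have r: "0 < r" unfolding r_def using R e d by simp
      have r1: "r \<le> 1" "r \<le> R / 2 / 4" "r \<le> e / (1 + C * real CARD('n))"
        unfolding r_def by (rule min.coboundedI1, rule min.cobounded1, rule min.coboundedI1, rule min.cobounded2, rule min.cobounded2)
      have "\<exists>y\<in>polydisc p r. (\<forall>l\<in>I. y $ l \<noteq> 0) \<and> norm (K y) < r * (\<Prod>l\<in>I. norm (y $ l) ^ \<alpha> l)"
      proof (rule ccontr)
        assume "\<not> ?thesis"
        then have "\<And>y. y \<in> polydisc p r \<Longrightarrow> \<forall>l\<in>I. y $ l \<noteq> 0 \<Longrightarrow> r * (\<Prod>l\<in>I. norm (y $ l) ^ \<alpha> l) \<le> norm (K y)"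
          using not_less by blast
        from toric_monomial_not_integrable[OF b I pI sum open_polydisc centre_in_polydisc[OF r] r this]
        have "(\<integral>\<^sup>+ z\<in>polydisc p r. ennreal ((norm (K z))\<^sup>2) * ext_exp (- 2 * toric_weight I b z) \<partial>lborel) = \<infinity>" .
        moreover have "(\<integral>\<^sup>+ z\<in>polydisc p r. ennreal ((norm (K z))\<^sup>2) * ext_exp (- 2 * toric_weight I b z) \<partial>lborel)
          \<le> (\<integral>\<^sup>+ z\<in>polydisc x R. ennreal ((norm (K z))\<^sup>2) * ext_exp (- 2 * toric_weight I b z) \<partial>lborel)"
        proof (rule nn_set_integral_set_mono)
          have "polydisc p r \<subseteq> polydisc p (R / 2)" using r1 R by (intro polydisc_mono) simp
          then show "polydisc p r \<subseteq> polydisc x R" using sub by blast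
        qed
        ultimately show False using int by simp
      qed
      then obtain y where y: "y \<in> polydisc p r" "\<forall>l\<in>I. y $ l \<noteq> 0" "norm (K y) < r * (\<Prod>l\<in>I. norm (y $ l) ^ \<alpha> l)" by blast
      have mpos: "0 < (\<Prod>l\<in>I. norm (y $ l) ^ \<alpha> l)" using y(2) by (intro prod_pos) auto
      have qy: "norm (?q y) \<le> r" unfolding norm_divide mono using y(3) mpos by (simp add: field_simps)
      have yp: "y \<in> polydisc p (R / 2 / 4)" using y(1) polydisc_mono[OF r1(2)] by blast
      have osc: "norm (?q z - ?q y) \<le> C * (\<Sum>l\<in>UNIV. norm (z $ l - p $ l) ^ \<nu> l + norm (y $ l - p $ l) ^ \<nu> l)"
        unfolding C_def
      proof (rule gapped_oscillation[OF hol[OF pI p2] gap[OF pI p2, folded \<alpha>'_def \<nu>_def] _ _ _ zp _ yp])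
        show "0 < R / 2" using R by simp
        show "1 \<le> \<nu> l" for l using N by (simp add: \<nu>_def)
        show "norm (K y) \<le> M" if "y \<in> polydisc p (R / 2)" for y using M sub that by blast
        show "\<alpha>' k = 0 \<or> z $ k \<noteq> p $ k" for k using znz by (simp add: \<alpha>'_def p_def)
        show "\<alpha>' k = 0 \<or> y $ k \<noteq> p $ k" for k using y(2) by (simp add: \<alpha>'_def p_def)
      qed
      have 1: "(\<Sum>l\<in>UNIV. norm (z $ l - p $ l) ^ \<nu> l) = ?T"
      proof -
        have "(\<Sum>l\<in>UNIV. norm (z $ l - p $ l) ^ \<nu> l) = (\<Sum>l\<in>I. norm (z $ l - p $ l) ^ \<nu> l)"
          by (rule sum.mono_neutral_right) (auto simp: \<nu>_def p_def)
        also have "\<dots> = ?T" by (intro sum.cong) (auto simp: \<nu>_def p_def)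
        finally show ?thesis .
      qed
      have 2: "(\<Sum>l\<in>UNIV. norm (y $ l - p $ l) ^ \<nu> l) \<le> real CARD('n) * r"
      proof -
        have "norm (y $ l - p $ l) ^ \<nu> l \<le> r" for l
        proof -
          have yl: "norm (y $ l - p $ l) \<le> r" using y(1) by (simp add: polydisc_def order_less_imp_le)
          have "norm (y $ l - p $ l) ^ \<nu> l \<le> norm (y $ l - p $ l) ^ 1"
            using yl r1(1) N by (intro power_decreasing) (auto simp: \<nu>_def)
          then show ?thesis using yl by simp
        qed
        then have "(\<Sum>l\<in>UNIV. norm (y $ l - p $ l) ^ \<nu> l) \<le> (\<Sum>l\<in>(UNIV::'n set). r)" by (intro sum_mono)
        then show ?thesis by simp
      qed
      have "norm (?q z) \<le> norm (?q z - ?q y) + norm (?q y)"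
        using norm_triangle_ineq[of "?q z - ?q y" "?q y"] by simp
      also have "\<dots> \<le> C * (?T + real CARD('n) * r) + r"
      proof (rule add_mono[OF order_trans[OF osc] qy])
        show "C * (\<Sum>l\<in>UNIV. norm (z $ l - p $ l) ^ \<nu> l + norm (y $ l - p $ l) ^ \<nu> l) \<le> C * (?T + real CARD('n) * r)"
          unfolding sum.distrib 1 using 2 C by (intro mult_left_mono add_left_mono) auto
      qed
      also have "\<dots> = C * ?T + r * (1 + C * real CARD('n))" by (simp add: algebra_simps)
      also have "\<dots> \<le> C * ?T + e"
        using r1(3) d by (intro add_left_mono) (simp add: pos_le_divide_eq)
      finally show ?thesis .
    qed
    have "norm (?q z) \<le> C * ?T" by (rule field_le_epsilon) (rule key)
    moreover have "0 < (\<Prod>l\<in>I. norm (z $ l) ^ \<alpha> l)" using znz by (intro prod_pos) auto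
    ultimately show ?thesis unfolding norm_divide mono by (simp add: field_simps)
  qed
  then show ?thesis using that C by blast
qed

section \<open>Averaging over rotations\<close>

lemma toric_sum_measurable:
  assumes "\<forall>l\<in>I. 0 < A l"
  shows "(\<lambda>z :: complex^'n::finite. \<Sum>l\<in>I. norm (z $ l) powr A l) \<in> borel_measurable borel"
  by (intro borel_measurable_continuous_onI continuous_on_sum_powr assms continuous_on_id)

lemma toric_density_measurable:
  assumes "\<forall>l\<in>I. 0 < A l"
  shows "(\<lambda>z :: complex^'n::finite. ext_exp (- 2 * toric_weight I A z)) \<in> borel_measurable borel"
  unfolding toric_weight_def ext_exp_toric using toric_sum_measurable[OF assms] by measurable

lemma weighted_square_measurable:
  fixes K :: "'a::euclidean_space \<Rightarrow> complex"
  assumes K: "continuous_on V K" and V: "open V" and W: "W \<in> borel_measurable borel"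
  shows "(\<lambda>z. ennreal ((norm (K z))\<^sup>2) * W z * indicator V z) \<in> borel_measurable borel"
proof -
  have m: "(\<lambda>z. indicator V z *\<^sub>R K z) \<in> borel_measurable borel"
    using V by (intro borel_measurable_continuous_on_indicator K) auto
  have "(\<lambda>z. ennreal ((norm (indicator V z *\<^sub>R K z))\<^sup>2) * W z) \<in> borel_measurable borel"
    using m W by measurable
  moreover have "ennreal ((norm (indicator V z *\<^sub>R K z))\<^sup>2) * W z = ennreal ((norm (K z))\<^sup>2) * W z * indicator V z" for z
    by (simp add: indicator_def)
  ultimately show ?thesis by simp
qed

text \<open>The Cauchy-Schwarz inequality for finite sums. Domination almost everywhere admits
  bounds that are proved only off the coordinate hyperplanes.\<close>

lemma weighted_square_sum_finite:
  fixes K :: "'a::euclidean_space \<Rightarrow> complex" and D :: "'i \<Rightarrow> 'a \<Rightarrow> complex"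
  assumes J: "finite J"
    and meas: "\<And>i. i \<in> J \<Longrightarrow> (\<lambda>z. ennreal ((norm (D i z))\<^sup>2) * W z * indicator V z) \<in> borel_measurable borel"
    and le: "AE z in lborel. z \<in> V \<longrightarrow> norm (K z) \<le> (\<Sum>i\<in>J. norm (D i z))"
    and int: "\<And>i. i \<in> J \<Longrightarrow> (\<integral>\<^sup>+ z\<in>V. ennreal ((norm (D i z))\<^sup>2) * W z \<partial>lborel) < \<infinity>"
  shows "(\<integral>\<^sup>+ z\<in>V. ennreal ((norm (K z))\<^sup>2) * W z \<partial>lborel) < \<infinity>"
proof -
  have "(\<integral>\<^sup>+ z\<in>V. ennreal ((norm (K z))\<^sup>2) * W z \<partial>lborel)
      \<le> (\<integral>\<^sup>+ z. (\<Sum>i\<in>J. ennreal (real (card J)) * (ennreal ((norm (D i z))\<^sup>2) * W z * indicator V z)) \<partial>lborel)"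
  proof (rule nn_integral_mono_AE, use le in eventually_elim)
    case (elim z)
    show ?case
    proof (cases "z \<in> V")
      case True
      then have "norm (K z) \<le> (\<Sum>i\<in>J. norm (D i z))" using elim by simp
      then have "(norm (K z))\<^sup>2 \<le> (\<Sum>i\<in>J. norm (D i z))\<^sup>2" by (intro power_mono) auto
      also have "\<dots> \<le> (\<Sum>i\<in>J. (norm (D i z))\<^sup>2) * real (card J)" by (rule sum_squared_le_sum_of_squares)
      finally have "ennreal ((norm (K z))\<^sup>2) \<le> ennreal (\<Sum>i\<in>J. real (card J) * (norm (D i z))\<^sup>2)"
        by (intro ennreal_leI) (simp add: sum_distrib_left mult.commute)
      also have "\<dots> = (\<Sum>i\<in>J. ennreal (real (card J) * (norm (D i z))\<^sup>2))" by (rule sum_ennreal[symmetric]) simp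
      also have "\<dots> = (\<Sum>i\<in>J. ennreal (real (card J)) * ennreal ((norm (D i z))\<^sup>2))" by (intro sum.cong refl ennreal_mult') simp
      finally have "ennreal ((norm (K z))\<^sup>2) * W z \<le> (\<Sum>i\<in>J. ennreal (real (card J)) * ennreal ((norm (D i z))\<^sup>2)) * W z"
        by (intro mult_right_mono) auto
      then show ?thesis using True by (simp add: sum_distrib_right mult.assoc)
    qed simp
  qed
  also have "\<dots> = (\<Sum>i\<in>J. ennreal (real (card J)) * (\<integral>\<^sup>+ z\<in>V. ennreal ((norm (D i z))\<^sup>2) * W z \<partial>lborel))"
  proof (subst nn_integral_sum)
    show "(\<lambda>z. ennreal (real (card J)) * (ennreal ((norm (D i z))\<^sup>2) * W z * indicator V z)) \<in> borel_measurable lborel" if "i \<in> J" for i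
      using meas[OF that] by simp
    show "(\<Sum>i\<in>J. \<integral>\<^sup>+ z. ennreal (real (card J)) * (ennreal ((norm (D i z))\<^sup>2) * W z * indicator V z) \<partial>lborel)
        = (\<Sum>i\<in>J. ennreal (real (card J)) * (\<integral>\<^sup>+ z\<in>V. ennreal ((norm (D i z))\<^sup>2) * W z \<partial>lborel))"
      using meas by (intro sum.cong refl nn_integral_cmult) simp
  qed
  also have "\<dots> < \<infinity>"
    using int J by (simp add: ennreal_mult_less_top)
  finally show ?thesis .
qed

text \<open>These properties feed the one-variable Taylor estimates and survive averaging over
  rotations, so that a function can be split repeatedly, coordinate by coordinate.\<close>

definition admissible :: "(complex^'n::finite \<Rightarrow> complex) \<Rightarrow> complex^'n \<Rightarrow> real \<Rightarrow> (complex^'n \<Rightarrow> ennreal) \<Rightarrow> bool" where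
  "admissible K x R W \<longleftrightarrow> continuous_on (polydisc x R) K \<and>
     (\<forall>z\<in>polydisc x R. \<forall>l. (\<lambda>w. K (upd z l w)) holomorphic_on ball (x $ l) R) \<and>
     (\<exists>M. \<forall>z\<in>polydisc x R. norm (K z) \<le> M) \<and>
     (\<integral>\<^sup>+ z\<in>polydisc x R. ennreal ((norm (K z))\<^sup>2) * W z \<partial>lborel) < \<infinity>"

definition rotation_symmetric :: "(complex^'n::finite \<Rightarrow> complex) \<Rightarrow> complex^'n \<Rightarrow> real \<Rightarrow> nat \<Rightarrow> ('n \<Rightarrow> nat) \<Rightarrow> 'n set \<Rightarrow> bool" where
  "rotation_symmetric K x R N \<alpha> J \<longleftrightarrow>
     (\<forall>l\<in>J. \<forall>z\<in>polydisc x R. K (upd z l (unity_root N * z $ l)) = unity_root N ^ \<alpha> l * K z)"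

text \<open>The projection onto the eigenspace of the rotation of the \<open>i\<close>-th coordinate
  with eigenvalue \<open>unity_root N ^ j\<close>: a monomial is kept if its \<open>i\<close>-th
  exponent is congruent to \<open>j\<close> modulo \<open>N\<close> and removed otherwise.\<close>

definition rotation_average :: "nat \<Rightarrow> 'n::finite \<Rightarrow> nat \<Rightarrow> (complex^'n \<Rightarrow> complex) \<Rightarrow> complex^'n \<Rightarrow> complex" where
  "rotation_average N i j K z =
     (\<Sum>t<N. inverse (unity_root N) ^ (j * t) * K (upd z i (unity_root N ^ t * z $ i))) / of_nat N"

lemma sum_rotation_average:
  fixes z :: "complex^'n::finite"
  assumes "1 \<le> N" shows "(\<Sum>j<N. rotation_average N i j K z) = K z"
proof -
  let ?\<omega> = "unity_root N"
  have "(\<Sum>j<N. rotation_average N i j K z) = (\<Sum>t<N. \<Sum>j<N. inverse ?\<omega> ^ (j * t) * K (upd z i (?\<omega> ^ t * z $ i))) / of_nat N"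
    unfolding rotation_average_def sum_divide_distrib[symmetric] by (subst sum.swap) simp
  also have "(\<Sum>t<N. \<Sum>j<N. inverse ?\<omega> ^ (j * t) * K (upd z i (?\<omega> ^ t * z $ i))) = (\<Sum>t<N. if t = 0 then of_nat N * K (upd z i (?\<omega> ^ t * z $ i)) else 0)"
    using sum_unity_root[OF assms] by (intro sum.cong refl) (simp add: sum_distrib_right[symmetric])
  also have "\<dots> = of_nat N * K z" using assms by (simp add: sum.delta)
  finally show ?thesis using assms by simp
qed

lemma rotate_in_polydisc:
  fixes z x :: "complex^'n::finite"
  assumes "z \<in> polydisc x R" "x $ i = 0" "norm \<omega> = 1"
  shows "upd z i (\<omega> * z $ i) \<in> polydisc x R"
  unfolding polydisc_def
proof (intro CollectI allI)
  fix l
  have "norm (z $ l - x $ l) < R" using assms(1) by (simp add: polydisc_def)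
  then show "norm (upd z i (\<omega> * z $ i) $ l - x $ l) < R"
    using assms by (cases "l = i") (auto simp: norm_mult)
qed

lemma norm_unity_root_power [simp]: "norm (unity_root N ^ t) = 1"
  by (simp add: norm_power)

lemma rotation_average_symmetric_same:
  fixes z :: "complex^'n::finite"
  assumes N: "1 \<le> N"
  shows "rotation_average N i j K (upd z i (unity_root N * z $ i)) = unity_root N ^ j * rotation_average N i j K z"
proof -
  let ?\<omega> = "unity_root N"
  define h where "h t = inverse ?\<omega> ^ (j * t) * K (upd z i (?\<omega> ^ t * z $ i))" for t
  \<comment> \<open>Rotating the argument shifts the summation index by one; periodicity closes the
    cycle.\<close>
  have "h N = h 0"
  proof -
    have "inverse ?\<omega> ^ (j * N) = 1"
      using unity_root_power_self[OF N] by (simp add: mult.commute[of j N] power_mult power_inverse)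
    then show ?thesis using unity_root_power_self[OF N] by (simp add: h_def)
  qed
  then have shift: "(\<Sum>t<N. h (Suc t)) = (\<Sum>t<N. h t)"
    using sum.lessThan_Suc_shift[of h N] by (simp add: sum.lessThan_Suc)
  have "inverse ?\<omega> ^ (j * t) * K (upd (upd z i (?\<omega> * z $ i)) i (?\<omega> ^ t * upd z i (?\<omega> * z $ i) $ i)) = ?\<omega> ^ j * h (Suc t)" for t
  proof -
    have a: "?\<omega> ^ j * inverse ?\<omega> ^ (j * Suc t) = inverse ?\<omega> ^ (j * t)"
      by (simp add: power_add power_inverse)
    have e: "upd (upd z i (?\<omega> * z $ i)) i (?\<omega> ^ t * upd z i (?\<omega> * z $ i) $ i) = upd z i (?\<omega> ^ Suc t * z $ i)"
      by (simp add: vec_eq_iff mult_ac)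
    show ?thesis unfolding h_def e mult.assoc[symmetric] a ..
  qed
  then have "rotation_average N i j K (upd z i (?\<omega> * z $ i)) = ?\<omega> ^ j * (\<Sum>t<N. h (Suc t)) / of_nat N"
    unfolding rotation_average_def by (simp add: sum_distrib_left)
  then show ?thesis unfolding shift by (simp add: rotation_average_def h_def)
qed

lemma rotation_average_symmetric_other:
  fixes x :: "complex^'n::finite"
  assumes sym: "rotation_symmetric K x R N \<alpha> J" and i: "i \<notin> J" "x $ i = 0"
  shows "rotation_symmetric (rotation_average N i j K) x R N \<alpha> J"
  unfolding rotation_symmetric_def
proof (intro ballI)
  fix l z assume l: "l \<in> J" and z: "z \<in> polydisc x R"
  let ?\<omega> = "unity_root N"
  have ne: "l \<noteq> i" using l i by auto
  have "K (upd (upd z l (?\<omega> * z $ l)) i (?\<omega> ^ t * upd z l (?\<omega> * z $ l) $ i)) = ?\<omega> ^ \<alpha> l * K (upd z i (?\<omega> ^ t * z $ i))" for t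
  proof -
    let ?y = "upd z i (?\<omega> ^ t * z $ i)"
    have "?y \<in> polydisc x R" by (rule rotate_in_polydisc[OF z i(2)]) simp
    then have "K (upd ?y l (?\<omega> * ?y $ l)) = ?\<omega> ^ \<alpha> l * K ?y" using sym l unfolding rotation_symmetric_def by blast
    moreover have "upd (upd z l (?\<omega> * z $ l)) i (?\<omega> ^ t * upd z l (?\<omega> * z $ l) $ i) = upd ?y l (?\<omega> * ?y $ l)"
      using ne by (simp add: vec_eq_iff)
    ultimately show ?thesis by simp
  qed
  then show "rotation_average N i j K (upd z l (?\<omega> * z $ l)) = ?\<omega> ^ \<alpha> l * rotation_average N i j K z"
    unfolding rotation_average_def by (simp add: sum_distrib_left mult_ac)
qed

lemma rotation_symmetric_average:
  fixes x :: "complex^'n::finite"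
  assumes "1 \<le> N" "rotation_symmetric K x R N \<alpha> J" "i \<notin> J" "x $ i = 0"
  shows "rotation_symmetric (rotation_average N i j K) x R N (\<alpha>(i := j)) (insert i J)"
proof -
  have "rotation_symmetric (rotation_average N i j K) x R N \<alpha> J"
    by (rule rotation_average_symmetric_other[OF assms(2-4)])
  then show ?thesis using rotation_average_symmetric_same[OF assms(1)] assms(3)
    unfolding rotation_symmetric_def by auto
qed

text \<open>Because \<open>x $ i = 0\<close>, rotations of the \<open>i\<close>-th coordinate map
  the polydisc onto itself. They preserve Lebesgue measure and, by \<open>inv\<close>, the weight,
  so each rotated copy of \<open>K\<close> has the same weighted integral.\<close>

lemma admissible_average:
  fixes x :: "complex^'n::finite"
  assumes K: "admissible K x R W" and N: "1 \<le> N" and xi: "x $ i = 0"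
    and W: "W \<in> borel_measurable borel" and inv: "\<And>(z :: complex^'n) \<omega>. norm \<omega> = 1 \<Longrightarrow> W (upd z i (\<omega> * z $ i)) = W z"
  shows "admissible (rotation_average N i j K) x R W"
proof -
  let ?P = "polydisc x R"
  let ?\<omega> = "unity_root N"
  let ?rot = "\<lambda>t z. upd z i (?\<omega> ^ t * z $ i)"
  have cK: "continuous_on ?P K" and hK: "\<And>z l. z \<in> ?P \<Longrightarrow> (\<lambda>w. K (upd z l w)) holomorphic_on ball (x $ l) R"
    and iK: "(\<integral>\<^sup>+ z\<in>?P. ennreal ((norm (K z))\<^sup>2) * W z \<partial>lborel) < \<infinity>"
    using K by (auto simp: admissible_def)
  obtain M where M: "\<And>z. z \<in> ?P \<Longrightarrow> norm (K z) \<le> M" using K by (auto simp: admissible_def)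
  have rot: "?rot t z \<in> ?P" if "z \<in> ?P" for t z by (rule rotate_in_polydisc[OF that xi]) simp
  have crot: "continuous_on ?P (?rot t)" for t by (intro continuous_intros)
  have cKt: "continuous_on ?P (\<lambda>z. K (?rot t z))" for t
    by (rule continuous_on_compose2[OF cK crot]) (use rot in auto)
  have c: "continuous_on ?P (rotation_average N i j K)"
    unfolding rotation_average_def[abs_def] using N by (intro continuous_intros cKt) auto
  have h: "(\<lambda>w. rotation_average N i j K (upd z l w)) holomorphic_on ball (x $ l) R" if z: "z \<in> ?P" for z l
  proof -
    have "(\<lambda>w. K (?rot t (upd z l w))) holomorphic_on ball (x $ l) R" for t
    proof (cases "l = i")
      case True
      have "(\<lambda>w. K (upd z i w)) \<circ> (\<lambda>w. ?\<omega> ^ t * w) holomorphic_on ball (x $ i) R"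
        by (rule holomorphic_on_compose_gen[OF _ hK[OF z]]) (auto intro!: holomorphic_intros simp: xi norm_mult norm_power)
      then show ?thesis using True by (simp add: o_def)
    next
      case False
      then have "?rot t (upd z l w) = upd (?rot t z) l w" for w by (auto simp: vec_eq_iff)
      then show ?thesis using hK[OF rot[OF z]] by simp
    qed
    then show ?thesis unfolding rotation_average_def by (intro holomorphic_intros) (use N in auto)
  qed
  have le: "norm (rotation_average N i j K z) \<le> (\<Sum>t<N. norm (K (?rot t z) / of_nat N))" for z
  proof -
    have "norm (rotation_average N i j K z) \<le> (\<Sum>t<N. norm (inverse ?\<omega> ^ (j * t) * K (?rot t z) / of_nat N))"
      unfolding rotation_average_def sum_divide_distrib by (rule norm_sum)
    then show ?thesis by (simp add: norm_mult norm_divide norm_power norm_inverse)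
  qed
  have b: "\<exists>M. \<forall>z\<in>?P. norm (rotation_average N i j K z) \<le> M"
  proof (intro exI ballI)
    fix z assume z: "z \<in> ?P"
    show "norm (rotation_average N i j K z) \<le> (\<Sum>t<N. M / of_nat N)"
      using M[OF rot[OF z]] by (intro order_trans[OF le] sum_mono) (simp add: norm_divide divide_right_mono)
  qed
  have int: "(\<integral>\<^sup>+ z\<in>?P. ennreal ((norm (rotation_average N i j K z))\<^sup>2) * W z \<partial>lborel) < \<infinity>"
  proof (rule weighted_square_sum_finite[of "{..<N}" "\<lambda>t z. K (?rot t z) / of_nat N"])
    fix t
    show "(\<lambda>z. ennreal ((norm (K (?rot t z) / of_nat N))\<^sup>2) * W z * indicator ?P z) \<in> borel_measurable borel"
      using N by (intro weighted_square_measurable open_polydisc W continuous_intros cKt) auto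
    have ind: "indicator ?P (?rot t z) = (indicator ?P z :: ennreal)" for z
    proof (cases "z \<in> ?P")
      case False
      have "?rot t z \<notin> ?P"
      proof
        assume "?rot t z \<in> ?P"
        then have "upd (?rot t z) i (inverse (?\<omega> ^ t) * ?rot t z $ i) \<in> ?P"
          by (rule rotate_in_polydisc[OF _ xi]) (simp add: norm_inverse norm_power)
        moreover have "upd (?rot t z) i (inverse (?\<omega> ^ t) * ?rot t z $ i) = z"
          by (auto simp: vec_eq_iff mult.assoc[symmetric])
        ultimately show False using False by simp
      qed
      then show ?thesis using False by simp
    qed (simp add: rot)
    have "(\<integral>\<^sup>+ z\<in>?P. ennreal ((norm (K (?rot t z) / of_nat N))\<^sup>2) * W z \<partial>lborel)
       \<le> (\<integral>\<^sup>+ z. ennreal ((norm (K (?rot t z)))\<^sup>2) * W (?rot t z) * indicator ?P (?rot t z) \<partial>lborel)"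
    proof (rule nn_integral_mono)
      fix z
      have "norm (K (?rot t z)) / real N \<le> norm (K (?rot t z))" using N by (simp add: divide_le_eq mult_left_le_one_le mult_le_cancel_left1)
      then have "ennreal ((norm (K (?rot t z) / of_nat N))\<^sup>2) \<le> ennreal ((norm (K (?rot t z)))\<^sup>2)"
        by (intro ennreal_leI power_mono) (auto simp: norm_divide)
      then show "ennreal ((norm (K (?rot t z) / of_nat N))\<^sup>2) * W z * indicator ?P z
          \<le> ennreal ((norm (K (?rot t z)))\<^sup>2) * W (?rot t z) * indicator ?P (?rot t z)"
        unfolding ind by (subst inv) (auto intro!: mult_right_mono)
    qed
    also have "\<dots> = (\<integral>\<^sup>+ z. ennreal ((norm (K z))\<^sup>2) * W z * indicator ?P z \<partial>lborel)"
      by (rule nn_integral_rotate[where F="\<lambda>z. ennreal ((norm (K z))\<^sup>2) * W z * indicator ?P z"])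
         (auto intro!: weighted_square_measurable cK open_polydisc W)
    also have "\<dots> < \<infinity>" by (rule iK)
    finally show "(\<integral>\<^sup>+ z\<in>?P. ennreal ((norm (K (?rot t z) / of_nat N))\<^sup>2) * W z \<partial>lborel) < \<infinity>" .
  qed (use le in auto)
  show ?thesis unfolding admissible_def using c h b int by blast
qed

section \<open>Transfer of integrability between toric weights\<close>

definition sublevel_polydisc :: "'n set \<Rightarrow> ('n \<Rightarrow> real) \<Rightarrow> complex^'n::finite \<Rightarrow> real \<Rightarrow> (complex^'n) set" where
  "sublevel_polydisc I A x r = polydisc x r \<inter> {z. (\<Sum>l\<in>I. norm (z $ l) powr A l) < 1}"

lemma open_sublevel_polydisc:
  fixes x :: "complex^'n::finite"
  assumes "\<forall>l\<in>I. 0 < A l" shows "open (sublevel_polydisc I A x r)"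
proof -
  have "continuous_on UNIV (\<lambda>z :: complex^'n. \<Sum>l\<in>I. norm (z $ l) powr A l)"
    by (intro continuous_on_sum_powr assms continuous_on_id)
  then show ?thesis unfolding sublevel_polydisc_def
    by (intro open_Int open_polydisc open_Collect_less continuous_on_const)
qed

text \<open>The complex-valued form \<open>D\<close> of the monomial fits
  \<open>weighted_square_sum_finite\<close>, where it serves as a majorant.\<close>

lemma monomial_square_integrable:
  fixes x :: "complex^'n::finite" and \<beta> :: "'n \<Rightarrow> nat"
  assumes A: "\<forall>l\<in>I. 0 < A l" and I: "I \<noteq> {}" and x: "\<forall>l\<in>I. x $ l = 0" and r: "0 < r"
    and sum: "1 < (\<Sum>l\<in>I. (real (\<beta> l) + 1) / A l)" and C: "0 \<le> C"
  defines "V \<equiv> sublevel_polydisc I A x r"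
  defines "D \<equiv> \<lambda>z :: complex^'n. complex_of_real (C * (\<Prod>l\<in>I. norm (z $ l) ^ \<beta> l))"
  shows "(\<integral>\<^sup>+ z\<in>V. ennreal ((norm (D z))\<^sup>2) * ext_exp (- 2 * toric_weight I A z) \<partial>lborel) < \<infinity>"
    and "(\<lambda>z. ennreal ((norm (D z))\<^sup>2) * ext_exp (- 2 * toric_weight I A z) * indicator V z) \<in> borel_measurable borel"
proof -
  let ?m = "\<lambda>z :: complex^'n. \<Prod>l\<in>I. norm (z $ l) ^ \<beta> l"
  have V: "open V" unfolding V_def by (rule open_sublevel_polydisc[OF A])
  have m0: "0 \<le> ?m z" for z by (intro prod_nonneg) auto
  have cm: "continuous_on V (\<lambda>z. complex_of_real (c * ?m z))" for c
    by (intro continuous_intros)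
  show "(\<lambda>z. ennreal ((norm (D z))\<^sup>2) * ext_exp (- 2 * toric_weight I A z) * indicator V z) \<in> borel_measurable borel"
    unfolding D_def by (intro weighted_square_measurable cm V toric_density_measurable A)
  have meas: "(\<lambda>z. ennreal ((?m z)\<^sup>2) * ext_exp (- 2 * toric_weight I A z) * indicator V z) \<in> borel_measurable borel"
    using weighted_square_measurable[OF cm[of 1] V toric_density_measurable[OF A]]
    unfolding norm_of_real power2_abs mult_1 .
  have "(\<integral>\<^sup>+ z\<in>V. ennreal ((norm (D z))\<^sup>2) * ext_exp (- 2 * toric_weight I A z) \<partial>lborel)
     = (\<integral>\<^sup>+ z. ennreal (C\<^sup>2) * (ennreal ((?m z)\<^sup>2) * ext_exp (- 2 * toric_weight I A z) * indicator V z) \<partial>lborel)"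
  proof (rule nn_integral_cong)
    fix z :: "complex^'n"
    have "(norm (D z))\<^sup>2 = C\<^sup>2 * (?m z)\<^sup>2"
      unfolding D_def norm_of_real using C m0 by (simp add: power_mult_distrib)
    then have "ennreal ((norm (D z))\<^sup>2) = ennreal (C\<^sup>2) * ennreal ((?m z)\<^sup>2)" by (simp add: ennreal_mult')
    then show "ennreal ((norm (D z))\<^sup>2) * ext_exp (- 2 * toric_weight I A z) * indicator V z
        = ennreal (C\<^sup>2) * (ennreal ((?m z)\<^sup>2) * ext_exp (- 2 * toric_weight I A z) * indicator V z)"
      by (simp only: mult.assoc)
  qed
  also have "\<dots> = ennreal (C\<^sup>2) * (\<integral>\<^sup>+ z\<in>V. ennreal ((?m z)\<^sup>2) * ext_exp (- 2 * toric_weight I A z) \<partial>lborel)"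
    using meas by (intro nn_integral_cmult) simp
  also have "\<dots> < \<infinity>"
  proof -
    have "(\<integral>\<^sup>+ z\<in>V. ennreal ((?m z)\<^sup>2) * ext_exp (- 2 * toric_weight I A z) \<partial>lborel) < \<infinity>"
    proof (rule toric_monomial_integrable[OF A I x sum r])
      \<comment> \<open>The sublevel condition ensures that the shells start at index zero.\<close>
      show "(\<Sum>l\<in>I. norm (z $ l) powr A l) \<le> 1" if "z \<in> V" for z
        using that by (simp add: V_def sublevel_polydisc_def)
      show "norm (z $ l - x $ l) < r" if "z \<in> V" for z l
        using that by (simp add: V_def sublevel_polydisc_def polydisc_def)
    qed
    then show ?thesis by (simp add: ennreal_mult_less_top)
  qed
  finally show "(\<integral>\<^sup>+ z\<in>V. ennreal ((norm (D z))\<^sup>2) * ext_exp (- 2 * toric_weight I A z) \<partial>lborel) < \<infinity>" .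
qed

lemma admissible_slices_holomorphic:
  fixes p x :: "complex^'n::finite"
  assumes K: "admissible K x R W" and sub: "polydisc p r \<subseteq> polydisc x R" and r: "0 < r"
  shows "slices_holomorphic K p r"
  unfolding slices_holomorphic_def
proof (intro ballI allI)
  fix z l assume z: "z \<in> polydisc p r"
  have "(\<lambda>w. K (upd z l w)) holomorphic_on ball (x $ l) R"
    using K z sub by (auto simp: admissible_def)
  moreover have "(\<lambda>w. p $ l + w) ` ball 0 r \<subseteq> ball (x $ l) R"
  proof
    fix y assume "y \<in> (\<lambda>w. p $ l + w) ` ball 0 r"
    then obtain w where "w \<in> ball 0 r" and y: "y = p $ l + w" by blast
    then have w: "norm w < r" by simp
    have "upd p l y \<in> polydisc p r" using w y r by (auto simp: polydisc_def)
    then have "upd p l y \<in> polydisc x R" using sub by blast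
    then have "norm (upd p l y $ l - x $ l) < R" unfolding polydisc_def by blast
    then show "y \<in> ball (x $ l) R" by (simp add: dist_norm norm_minus_commute)
  qed
  moreover have "(\<lambda>w. p $ l + w) holomorphic_on ball 0 r" by (intro holomorphic_intros)
  ultimately have "(\<lambda>w. K (upd z l w)) \<circ> (\<lambda>w. p $ l + w) holomorphic_on ball 0 r"
    by (intro holomorphic_on_compose_gen)
  then show "(\<lambda>w. K (upd z l (p $ l + w))) holomorphic_on ball 0 r" by (simp add: o_def)
qed

text \<open>Since \<open>p $ l = 0\<close> for \<open>l \<in> I\<close>, rotating such a coordinate
  about the centre of the slice is rotating it about zero. The symmetry on the polydisc around
  \<open>x\<close> thus passes to the slices around every such \<open>p\<close>.\<close>

lemma symmetric_gapped:
  fixes p x :: "complex^'n::finite"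
  assumes hol: "slices_holomorphic K p r" and sub: "polydisc p r \<subseteq> polydisc x R" and r: "0 < r" and N: "1 \<le> N"
    and p: "\<forall>l\<in>I. p $ l = 0" and \<alpha>: "\<forall>l\<in>I. \<alpha> l < N"
    and sym: "rotation_symmetric K x R N \<alpha> I"
  shows "gapped K p r (\<lambda>l. if l \<in> I then \<alpha> l else 0) (\<lambda>l. if l \<in> I then N else 1)"
  unfolding gapped_def
proof (intro ballI allI impI)
  fix z l q
  assume z: "z \<in> polydisc p r" and q: "q < (if l \<in> I then \<alpha> l else 0) + (if l \<in> I then N else 1)" "q \<noteq> (if l \<in> I then \<alpha> l else 0)"
  have l: "l \<in> I" using q by (auto split: if_splits)
  show "taylor_coeff (\<lambda>w. K (upd z l (p $ l + w))) q = 0"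
  proof (rule taylor_coeff_symmetric[OF _ r N])
    show "(\<lambda>w. K (upd z l (p $ l + w))) holomorphic_on ball 0 r"
      using hol z by (simp add: slices_holomorphic_def)
    show "\<alpha> l < N" using \<alpha> l by simp
    show "q < \<alpha> l + N" "q \<noteq> \<alpha> l" using q l by auto
    fix w :: complex assume w: "norm w < r"
    have "upd z l w \<in> polydisc x R"
      using upd_shift_in_polydisc[OF z w, of l] p l sub by auto
    then have "K (upd (upd z l w) l (unity_root N * upd z l w $ l)) = unity_root N ^ \<alpha> l * K (upd z l w)"
      using sym l unfolding rotation_symmetric_def by blast
    then show "K (upd z l (p $ l + unity_root N * w)) = unity_root N ^ \<alpha> l * K (upd z l (p $ l + w))"
      using p l by simp
  qed
qed

text \<open>If the monomial of \<open>\<alpha>\<close> is integrable for \<open>a\<close>, the bound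
  of \<open>K\<close> by it suffices. If not, by \<open>ab\<close> it is not integrable for
  \<open>b\<close> either, and integrability of \<open>K\<close> for \<open>b\<close> forces a bound
  by the monomials with an extra factor \<open>z\<^sub>i ^ N\<close>, which are integrable for
  \<open>a\<close> because \<open>N > a i\<close>. The radius \<open>R / 8\<close> is half for
  moving the centre and a quarter for the Taylor remainder.\<close>

lemma symmetric_square_integrable:
  fixes K :: "complex^'n::finite \<Rightarrow> complex" and x :: "complex^'n" and a b :: "'n \<Rightarrow> real"
  assumes a: "\<forall>l\<in>I. 0 < a l" and b: "\<forall>l\<in>I. 0 < b l" and I: "I \<noteq> {}" and x: "\<forall>l\<in>I. x $ l = 0"
    and R: "0 < R" and N: "1 \<le> N" "\<forall>l\<in>I. a l < real N" and \<alpha>: "\<forall>l\<in>I. \<alpha> l < N"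
    and ab: "(\<Sum>l\<in>I. (real (\<alpha> l) + 1) / a l) \<le> 1 \<Longrightarrow> (\<Sum>l\<in>I. (real (\<alpha> l) + 1) / b l) \<le> 1"
    and K: "admissible K x R (\<lambda>z. ext_exp (- 2 * toric_weight I b z))"
    and sym: "rotation_symmetric K x R N \<alpha> I"
  shows "(\<integral>\<^sup>+ z\<in>sublevel_polydisc I a x (R / 8). ennreal ((norm (K z))\<^sup>2) * ext_exp (- 2 * toric_weight I a z) \<partial>lborel) < \<infinity>"
proof -
  let ?V = "sublevel_polydisc I a x (R / 8)"
  obtain M where M: "\<And>z. z \<in> polydisc x R \<Longrightarrow> norm (K z) \<le> M" using K by (auto simp: admissible_def)
  have "norm (K x) \<le> M" using M[of x] R by (simp add: centre_in_polydisc)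
  then have M0: "0 \<le> M" by (rule order_trans[OF norm_ge_zero])
  have R2: "0 < R / 2" and R8: "0 < R / 8" using R by simp_all
  have hol: "slices_holomorphic K p (R / 2)" if "p \<in> polydisc x (R / 2)" for p
    by (rule admissible_slices_holomorphic[OF K half_polydisc_subset[OF that] R2])
  have gap: "gapped K p (R / 2) (\<lambda>l. if l \<in> I then \<alpha> l else 0) (\<lambda>l. if l \<in> I then N else 1)"
    if "\<forall>l\<in>I. p $ l = 0" "p \<in> polydisc x (R / 2)" for p
    by (rule symmetric_gapped[OF hol[OF that(2)] half_polydisc_subset[OF that(2)] R2 N(1) that(1) \<alpha> sym])
  have V8: "z \<in> polydisc x (R / 8)" if "z \<in> ?V" for z using that by (simp add: sublevel_polydisc_def)
  show ?thesis
  proof (cases "1 < (\<Sum>l\<in>I. (real (\<alpha> l) + 1) / a l)")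
    case True
    define C where "C = M * 2 ^ card I * (\<Prod>l\<in>I. (4 / R) ^ \<alpha> l)"
    have C: "0 \<le> C" unfolding C_def using M0 R by (intro mult_nonneg_nonneg prod_nonneg) auto
    have le: "norm (K z) \<le> C * (\<Prod>l\<in>I. norm (z $ l) ^ \<alpha> l)" if z: "z \<in> ?V" for z
    proof -
      have x2: "x \<in> polydisc x (R / 2)" using R2 by (rule centre_in_polydisc)
      have z2: "z \<in> polydisc x (R / 2)" using V8[OF z] polydisc_mono[of "R/8" "R/2"] R by auto
      have "norm (K z) \<le> M * 2 ^ card I * (\<Prod>l\<in>I. (2 * norm (z $ l - x $ l) / (R / 2)) ^ (if l \<in> I then \<alpha> l else 0))"
      proof (rule gapped_upper_bound[OF hol[OF x2] gap[OF x x2] R2 _ _ z2])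
        show "norm (K z) \<le> M" if "z \<in> polydisc x (R / 2)" for z
          using M polydisc_mono[of "R/2" R] that R by auto
        show "norm (z $ l - x $ l) \<le> R / 2 / 4" for l
          using V8[OF z] by (simp add: polydisc_def order_less_imp_le)
      qed (use N in auto)
      also have "(\<Prod>l\<in>I. (2 * norm (z $ l - x $ l) / (R / 2)) ^ (if l \<in> I then \<alpha> l else 0)) = (\<Prod>l\<in>I. (4 / R) ^ \<alpha> l * norm (z $ l) ^ \<alpha> l)"
        using x by (intro prod.cong refl) (simp add: power_mult_distrib power_divide)
      finally show ?thesis by (simp add: C_def prod.distrib mult.assoc)
    qed
    note mon = monomial_square_integrable[OF a I x R8 True C]
    show ?thesis
    proof (rule weighted_square_sum_finite[of "{()}" "\<lambda>_ z. complex_of_real (C * (\<Prod>l\<in>I. norm (z $ l) ^ \<alpha> l))"])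
      have "norm (K z) \<le> norm (complex_of_real (C * (\<Prod>l\<in>I. norm (z $ l) ^ \<alpha> l)))" if "z \<in> ?V" for z
        unfolding norm_of_real using order_trans[OF le[OF that] abs_ge_self] .
      then show "AE z in lborel. z \<in> ?V \<longrightarrow> norm (K z) \<le> (\<Sum>i\<in>{()}. norm (complex_of_real (C * (\<Prod>l\<in>I. norm (z $ l) ^ \<alpha> l))))"
        by simp
    qed (use mon in simp_all)
  next
    case False
    then have sb: "(\<Sum>l\<in>I. (real (\<alpha> l) + 1) / b l) \<le> 1" using ab by simp
    have int: "(\<integral>\<^sup>+ z\<in>polydisc x R. ennreal ((norm (K z))\<^sup>2) * ext_exp (- 2 * toric_weight I b z) \<partial>lborel) < \<infinity>"
      using K by (simp add: admissible_def)
    obtain C where C: "0 \<le> C" and le: "\<And>z. z \<in> polydisc x (R / 8) \<Longrightarrow> \<forall>l\<in>I. z $ l \<noteq> 0 \<Longrightarrow>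
      norm (K z) \<le> C * (\<Prod>l\<in>I. norm (z $ l) ^ \<alpha> l) * (\<Sum>l\<in>I. norm (z $ l) ^ N)"
      using symmetric_square_integrable_bound[OF b I x R N(1) hol gap M int sb] by blast
    define \<beta> where "\<beta> i = \<alpha>(i := \<alpha> i + N)" for i
    have prod_eq: "(\<Prod>l\<in>I. norm (z $ l) ^ \<alpha> l) * norm (z $ i) ^ N = (\<Prod>l\<in>I. norm (z $ l) ^ \<beta> i l)" if i: "i \<in> I" for i and z :: "complex^'n"
    proof -
      have "(\<Prod>l\<in>I. norm (z $ l) ^ \<beta> i l) = norm (z $ i) ^ \<beta> i i * (\<Prod>l\<in>I - {i}. norm (z $ l) ^ \<beta> i l)"
        using i by (intro prod.remove) auto
      also have "(\<Prod>l\<in>I - {i}. norm (z $ l) ^ \<beta> i l) = (\<Prod>l\<in>I - {i}. norm (z $ l) ^ \<alpha> l)"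
        by (intro prod.cong) (auto simp: \<beta>_def)
      also have "norm (z $ i) ^ \<beta> i i = norm (z $ i) ^ \<alpha> i * norm (z $ i) ^ N" by (simp add: \<beta>_def power_add)
      finally show ?thesis using i by (subst prod.remove[of I i]) auto
    qed
    have s\<beta>: "1 < (\<Sum>l\<in>I. (real (\<beta> i l) + 1) / a l)" if i: "i \<in> I" for i
    proof -
      have "a i < real N" "0 < a i" using N a i by auto
      then have "1 < (real (\<beta> i i) + 1) / a i" by (simp add: \<beta>_def)
      also have "\<dots> \<le> (\<Sum>l\<in>I. (real (\<beta> i l) + 1) / a l)"
        using a i by (intro member_le_sum[of i I "\<lambda>l. (real (\<beta> i l) + 1) / a l"]) (auto simp: order_less_imp_le)
      finally show ?thesis .
    qed
    note mon = monomial_square_integrable[OF a I x R8 s\<beta> C]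
    show ?thesis
    proof (rule weighted_square_sum_finite[of I "\<lambda>i z. complex_of_real (C * (\<Prod>l\<in>I. norm (z $ l) ^ \<beta> i l))"])
      show "AE z in lborel. z \<in> ?V \<longrightarrow> norm (K z) \<le> (\<Sum>i\<in>I. norm (complex_of_real (C * (\<Prod>l\<in>I. norm (z $ l) ^ \<beta> i l))))"
        using AE_nonzero_coordinates[of 0]
      proof eventually_elim
        case (elim z)
        show ?case
        proof
          assume z: "z \<in> ?V"
          have "norm (K z) \<le> C * (\<Prod>l\<in>I. norm (z $ l) ^ \<alpha> l) * (\<Sum>l\<in>I. norm (z $ l) ^ N)"
            using elim by (intro le V8 z) simp
          also have "\<dots> = (\<Sum>i\<in>I. C * ((\<Prod>l\<in>I. norm (z $ l) ^ \<alpha> l) * norm (z $ i) ^ N))"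
            by (simp add: sum_distrib_left mult.assoc)
          also have "\<dots> = (\<Sum>i\<in>I. C * (\<Prod>l\<in>I. norm (z $ l) ^ \<beta> i l))"
            by (intro sum.cong refl) (simp only: prod_eq)
          also have "\<dots> \<le> (\<Sum>i\<in>I. norm (complex_of_real (C * (\<Prod>l\<in>I. norm (z $ l) ^ \<beta> i l))))"
            unfolding norm_of_real by (intro sum_mono abs_ge_self)
          finally show "norm (K z) \<le> (\<Sum>i\<in>I. norm (complex_of_real (C * (\<Prod>l\<in>I. norm (z $ l) ^ \<beta> i l))))" .
        qed
      qed
    qed (use mon in simp_all)
  qed
qed

text \<open>Induction on the set \<open>T\<close> of coordinates in which \<open>K\<close> is not
  yet symmetric: averaging in one of them writes \<open>K\<close> as a sum of \<open>N\<close>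
  functions that are symmetric in that coordinate as well.\<close>

lemma admissible_square_integrable:
  fixes K :: "complex^'n::finite \<Rightarrow> complex" and x :: "complex^'n" and a b :: "'n \<Rightarrow> real"
  assumes a: "\<forall>l\<in>I. 0 < a l" and b: "\<forall>l\<in>I. 0 < b l" and I: "I \<noteq> {}" and x: "\<forall>l\<in>I. x $ l = 0"
    and R: "0 < R" and N: "1 \<le> N" "\<forall>l\<in>I. a l < real N"
    and ab: "\<And>\<alpha> :: 'n \<Rightarrow> nat. (\<Sum>l\<in>I. (real (\<alpha> l) + 1) / a l) \<le> 1 \<Longrightarrow> (\<Sum>l\<in>I. (real (\<alpha> l) + 1) / b l) \<le> 1"
    and T: "finite T" "T \<subseteq> I" and \<alpha>: "\<forall>l\<in>I - T. \<alpha> l < N"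
    and K: "admissible K x R (\<lambda>z. ext_exp (- 2 * toric_weight I b z))"
    and sym: "rotation_symmetric K x R N \<alpha> (I - T)"
  shows "(\<integral>\<^sup>+ z\<in>sublevel_polydisc I a x (R / 8). ennreal ((norm (K z))\<^sup>2) * ext_exp (- 2 * toric_weight I a z) \<partial>lborel) < \<infinity>"
  using T \<alpha> K sym
proof (induction T arbitrary: K \<alpha> rule: finite_induct)
  case empty
  then show ?case
    using symmetric_square_integrable[OF a b I x R N _ ab, of \<alpha> K] by simp
next
  case (insert i T)
  let ?V = "sublevel_polydisc I a x (R / 8)"
  let ?D = "\<lambda>j. rotation_average N i j K"
  have i: "i \<in> I" "x $ i = 0" using insert.prems x by auto
  have eq: "insert i (I - insert i T) = I - T" using insert.hyps i by auto
  have inv: "ext_exp (- 2 * toric_weight I b (upd z i (\<omega> * z $ i))) = ext_exp (- 2 * toric_weight I b z)"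
    if "norm \<omega> = 1" for z :: "complex^'n" and \<omega>
  proof -
    have "norm (upd z i (\<omega> * z $ i) $ l) = norm (z $ l)" for l using that by (simp add: norm_mult)
    then show ?thesis by (simp add: toric_weight_def)
  qed
  have adm: "admissible (?D j) x R (\<lambda>z. ext_exp (- 2 * toric_weight I b z))" for j
    by (rule admissible_average[OF insert.prems(3) N(1) i(2) toric_density_measurable[OF b] inv])
  have symD: "rotation_symmetric (?D j) x R N (\<alpha>(i := j)) (I - T)" for j
    using rotation_symmetric_average[OF N(1) insert.prems(4) _ i(2), of j] unfolding eq by simp
  have fin: "(\<integral>\<^sup>+ z\<in>?V. ennreal ((norm (?D j z))\<^sup>2) * ext_exp (- 2 * toric_weight I a z) \<partial>lborel) < \<infinity>" if "j < N" for j
  proof (rule insert.IH)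
    show "\<forall>l\<in>I - T. (\<alpha>(i := j)) l < N" using insert.prems(2) that by auto
    show "rotation_symmetric (?D j) x R N (\<alpha>(i := j)) (I - T)" by (rule symD)
  qed (use insert.prems adm in auto)
  have V: "open ?V" by (rule open_sublevel_polydisc[OF a])
  have sub: "?V \<subseteq> polydisc x R"
    using polydisc_mono[of "R/8" R] R by (auto simp: sublevel_polydisc_def)
  show ?case
  proof (rule weighted_square_sum_finite[of "{..<N}" ?D])
    fix j assume "j \<in> {..<N}"
    have "continuous_on ?V (?D j)" using adm[of j] sub continuous_on_subset unfolding admissible_def by blast
    then show "(\<lambda>z. ennreal ((norm (?D j z))\<^sup>2) * ext_exp (- 2 * toric_weight I a z) * indicator ?V z) \<in> borel_measurable borel"
      by (intro weighted_square_measurable V toric_density_measurable a)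
  next
    have "norm (K z) \<le> (\<Sum>j<N. norm (?D j z))" for z
      using norm_sum[of "\<lambda>j. ?D j z" "{..<N}"] sum_rotation_average[OF N(1), of i K z] by simp
    then show "AE z in lborel. z \<in> ?V \<longrightarrow> norm (K z) \<le> (\<Sum>j<N. norm (?D j z))" by simp
  qed (use fin in auto)
qed

lemma multiplier_ideal_transfer_singular:
  fixes x :: "complex^'n::finite" and a b :: "'n \<Rightarrow> real"
  assumes a: "\<forall>l\<in>I. 0 < a l" and b: "\<forall>l\<in>I. 0 < b l" and I: "I \<noteq> {}" and x: "\<forall>l\<in>I. x $ l = 0"
    and ab: "\<And>\<alpha> :: 'n \<Rightarrow> nat. (\<Sum>l\<in>I. (real (\<alpha> l) + 1) / a l) \<le> 1 \<Longrightarrow> (\<Sum>l\<in>I. (real (\<alpha> l) + 1) / b l) \<le> 1"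
    and f: "f \<in> multiplier_ideal (toric_weight I b) x"
  shows "f \<in> multiplier_ideal (toric_weight I a) x"
proof -
  obtain V where V: "open V" "x \<in> V" "holomorphic_several f V"
    and int: "(\<integral>\<^sup>+ z\<in>V. ennreal ((norm (f z))\<^sup>2) * ext_exp (- 2 * toric_weight I b z) \<partial>lborel) < \<infinity>"
    using f unfolding multiplier_ideal_def by blast
  obtain R where R: "0 < R" "R \<le> 1" "closure (polydisc x R) \<subseteq> V"
    using open_contains_polydisc[OF V(1,2)] .
  have RV: "polydisc x R \<subseteq> V" using R closure_subset by blast
  obtain M where M: "\<And>z. z \<in> polydisc x R \<Longrightarrow> norm (f z) \<le> M"
    using holomorphic_several_bounded_on_polydisc[OF V(3) R(3)] by blast
  \<comment> \<open>Any integer above all \<open>a l\<close> with \<open>l \<in> I\<close> would do;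
    the sum is a convenient bound.\<close>
  define N where "N = Suc (nat \<lceil>\<Sum>l\<in>I. a l\<rceil>)"
  have N: "1 \<le> N" "\<forall>l\<in>I. a l < real N"
  proof -
    show "\<forall>l\<in>I. a l < real N"
    proof
      fix l assume "l \<in> I"
      then have "a l \<le> (\<Sum>l\<in>I. a l)" using a by (intro member_le_sum) (auto simp: order_less_imp_le)
      then show "a l < real N" unfolding N_def by linarith
    qed
  qed (simp add: N_def)
  have hol: "(\<lambda>w. f (upd z l w)) holomorphic_on ball (x $ l) R" if z: "z \<in> polydisc x R" for z l
  proof (rule holomorphic_several_slice[OF V(3)])
    fix w assume "w \<in> ball (x $ l) R"
    then have "upd z l w \<in> polydisc x R"
      using z by (auto simp: polydisc_def dist_norm norm_minus_commute)
    then show "upd z l w \<in> V" using RV by blast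
  qed
  have adm: "admissible f x R (\<lambda>z. ext_exp (- 2 * toric_weight I b z))"
    unfolding admissible_def
  proof (intro conjI ballI allI hol)
    show "continuous_on (polydisc x R) f"
      using continuous_on_subset[OF holomorphic_several_continuous_on[OF V(3)] RV] .
    show "\<exists>M. \<forall>z\<in>polydisc x R. norm (f z) \<le> M" using M by blast
    show "(\<integral>\<^sup>+ z\<in>polydisc x R. ennreal ((norm (f z))\<^sup>2) * ext_exp (- 2 * toric_weight I b z) \<partial>lborel) < \<infinity>"
      using nn_set_integral_set_mono[OF RV] int by (rule order.strict_trans1)
  qed
  let ?V = "sublevel_polydisc I a x (R / 8)"
  have "(\<integral>\<^sup>+ z\<in>?V. ennreal ((norm (f z))\<^sup>2) * ext_exp (- 2 * toric_weight I a z) \<partial>lborel) < \<infinity>"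
    \<comment> \<open>With \<open>T = I\<close> the symmetry condition is empty, so the induction
      can start from an arbitrary \<open>f\<close>.\<close>
    by (rule admissible_square_integrable[where T = I and \<alpha> = "\<lambda>_. 0", OF a b I x R(1) N ab _ _ _ adm])
       (auto simp: rotation_symmetric_def)
  moreover have "open ?V" by (rule open_sublevel_polydisc[OF a])
  moreover have "x \<in> ?V" using x R(1) by (simp add: sublevel_polydisc_def centre_in_polydisc)
  moreover have "holomorphic_several f ?V"
    by (rule holomorphic_several_subset[OF V(3)]) (use RV polydisc_mono[of "R/8" R] R in \<open>auto simp: sublevel_polydisc_def\<close>)
  ultimately show ?thesis unfolding multiplier_ideal_def by blast
qed

section \<open>Equisingular approximation by rational exponents\<close>

lemma multiplier_ideal_mono:
  fixes \<phi> \<psi> :: "complex^'n::finite \<Rightarrow> ereal"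
  assumes U: "open U" "y \<in> U" and le: "\<And>z. z \<in> U \<Longrightarrow> \<phi> z \<le> \<psi> z"
  shows "multiplier_ideal \<phi> y \<subseteq> multiplier_ideal \<psi> y"
proof
  fix f assume "f \<in> multiplier_ideal \<phi> y"
  then obtain V where V: "open V" "y \<in> V" "holomorphic_several f V"
    and int: "(\<integral>\<^sup>+ z\<in>V. ennreal ((norm (f z))\<^sup>2) * ext_exp (- 2 * \<phi> z) \<partial>lborel) < \<infinity>"
    unfolding multiplier_ideal_def by blast
  have "(\<integral>\<^sup>+ z\<in>V \<inter> U. ennreal ((norm (f z))\<^sup>2) * ext_exp (- 2 * \<psi> z) \<partial>lborel)
      \<le> (\<integral>\<^sup>+ z\<in>V. ennreal ((norm (f z))\<^sup>2) * ext_exp (- 2 * \<phi> z) \<partial>lborel)"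
  proof (rule nn_integral_mono)
    fix z
    show "ennreal ((norm (f z))\<^sup>2) * ext_exp (- 2 * \<psi> z) * indicator (V \<inter> U) z
        \<le> ennreal ((norm (f z))\<^sup>2) * ext_exp (- 2 * \<phi> z) * indicator V z"
      using ext_exp_minus_mono[OF le, of z] by (auto simp: indicator_def intro!: mult_left_mono)
  qed
  then have "(\<integral>\<^sup>+ z\<in>V \<inter> U. ennreal ((norm (f z))\<^sup>2) * ext_exp (- 2 * \<psi> z) \<partial>lborel) < \<infinity>"
    using int by (rule order.strict_trans1)
  moreover have "open (V \<inter> U)" "y \<in> V \<inter> U" "holomorphic_several f (V \<inter> U)"
    using V U holomorphic_several_subset[OF V(3)] by auto
  ultimately show "f \<in> multiplier_ideal \<psi> y" unfolding multiplier_ideal_def by blast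
qed

text \<open>Near such a point the sum stays above half its value at \<open>y\<close>, so the density
  is bounded.\<close>

lemma holomorphic_in_multiplier_ideal_nonsingular:
  fixes y :: "complex^'n::finite"
  assumes A: "\<forall>l\<in>I. 0 < A l" and i: "i \<in> I" "y $ i \<noteq> 0"
    and V: "open V" "y \<in> V" "holomorphic_several f V"
  shows "f \<in> multiplier_ideal (toric_weight I A) y"
proof -
  let ?S = "\<lambda>z :: complex^'n. \<Sum>l\<in>I. norm (z $ l) powr A l"
  define s where "s = ?S y / 2"
  have "0 < norm (y $ i) powr A i" using i by simp
  also have "\<dots> \<le> ?S y" using i by (intro member_le_sum) auto
  finally have s: "0 < s" "s < ?S y" by (simp_all add: s_def)
  obtain R where R: "0 < R" "R \<le> 1" "closure (polydisc y R) \<subseteq> V"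
    using open_contains_polydisc[OF V(1,2)] .
  have RV: "polydisc y R \<subseteq> V" using R closure_subset by blast
  obtain M where M: "\<And>z. z \<in> polydisc y R \<Longrightarrow> norm (f z) \<le> M"
    using holomorphic_several_bounded_on_polydisc[OF V(3) R(3)] by blast
  define W where "W = polydisc y R \<inter> {z. s < ?S z}"
  have cS: "continuous_on UNIV ?S" by (intro continuous_on_sum_powr A continuous_on_id)
  have W: "open W" "y \<in> W" "W \<subseteq> V"
    unfolding W_def using s R RV
    by (auto intro!: open_Int open_polydisc open_Collect_less continuous_on_const cS simp: centre_in_polydisc)
  have "(\<integral>\<^sup>+ z\<in>W. ennreal ((norm (f z))\<^sup>2) * ext_exp (- 2 * toric_weight I A z) \<partial>lborel)
      \<le> (\<integral>\<^sup>+ z. ennreal (M\<^sup>2 * (1 / s\<^sup>2)) * indicator W z \<partial>lborel)"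
  proof (rule nn_integral_mono)
    fix z
    show "ennreal ((norm (f z))\<^sup>2) * ext_exp (- 2 * toric_weight I A z) * indicator W z \<le> ennreal (M\<^sup>2 * (1 / s\<^sup>2)) * indicator W z"
    proof (cases "z \<in> W")
      case True
      then have z: "z \<in> polydisc y R" "s < ?S z" by (auto simp: W_def)
      then have S0: "0 < ?S z" using s by linarith
      have 1: "(norm (f z))\<^sup>2 \<le> M\<^sup>2" using M[OF z(1)] by (intro power_mono) auto
      have "s\<^sup>2 \<le> (?S z)\<^sup>2" using z(2) s(1) by (intro power_mono) auto
      then have 2: "1 / (?S z)\<^sup>2 \<le> 1 / s\<^sup>2"
        using s S0 by (intro divide_left_mono mult_pos_pos zero_less_power) auto
      show ?thesis unfolding toric_weight_def ext_exp_toric using True S0 mult_mono[OF 1 2]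
        by (simp add: ennreal_leI flip: ennreal_mult')
    qed simp
  qed
  also have "\<dots> = ennreal (M\<^sup>2 * (1 / s\<^sup>2)) * emeasure lborel W"
    using W(1) by (intro nn_integral_cmult_indicator) simp
  also have "\<dots> < \<infinity>"
  proof -
    have "bounded W" using bounded_subset[OF bounded_polydisc] by (auto simp: W_def)
    from emeasure_bounded_finite[OF this] show ?thesis by (simp add: ennreal_mult_less_top)
  qed
  finally show ?thesis
    unfolding multiplier_ideal_def using W holomorphic_several_subset[OF V(3) W(3)] by blast
qed

lemma toric_weight_mono_exponent:
  fixes z :: "complex^'n::finite"
  assumes "\<And>l. l \<in> I \<Longrightarrow> b l \<le> a l" "\<And>l. norm (z $ l) \<le> 1"
  shows "toric_weight I a z \<le> toric_weight I b z"
  unfolding toric_weight_def using assms by (intro ext_ln_mono sum_mono powr_mono') auto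

text \<open>Smaller exponents give a larger weight on the unit polydisc, which is the easy
  inclusion. For the other one, a point with a nonzero coordinate in \<open>I\<close> imposes no
  condition, and the common zeros of these coordinates are covered by the transfer.\<close>

lemma multiplier_ideal_toric_eq:
  fixes y :: "complex^'n::finite" and a b :: "'n \<Rightarrow> real"
  assumes b: "\<forall>l\<in>I. 0 < b l" and ba: "\<And>l. l \<in> I \<Longrightarrow> b l \<le> a l" and I: "I \<noteq> {}"
    and ab: "\<And>\<alpha> :: 'n \<Rightarrow> nat. (\<Sum>l\<in>I. (real (\<alpha> l) + 1) / a l) \<le> 1 \<Longrightarrow> (\<Sum>l\<in>I. (real (\<alpha> l) + 1) / b l) \<le> 1"
    and y: "y \<in> polydisc 0 1"
  shows "multiplier_ideal (toric_weight I b) y = multiplier_ideal (toric_weight I a) y"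
proof
  have a: "\<forall>l\<in>I. 0 < a l" using b ba by (meson order.strict_trans2)
  show "multiplier_ideal (toric_weight I a) y \<subseteq> multiplier_ideal (toric_weight I b) y"
  proof (rule multiplier_ideal_mono[OF open_polydisc y])
    fix z :: "complex^'n" assume "z \<in> polydisc 0 1"
    then show "toric_weight I a z \<le> toric_weight I b z"
      by (intro toric_weight_mono_exponent ba) (auto simp: polydisc_def order_less_imp_le)
  qed
  show "multiplier_ideal (toric_weight I b) y \<subseteq> multiplier_ideal (toric_weight I a) y"
  proof
    fix f assume f: "f \<in> multiplier_ideal (toric_weight I b) y"
    show "f \<in> multiplier_ideal (toric_weight I a) y"
    proof (cases "\<forall>l\<in>I. y $ l = 0")
      case True
      show ?thesis by (rule multiplier_ideal_transfer_singular[OF a b I True ab f])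
    next
      case False
      then obtain i where "i \<in> I" "y $ i \<noteq> 0" by blast
      moreover obtain V where "open V" "y \<in> V" "holomorphic_several f V"
        using f unfolding multiplier_ideal_def by blast
      ultimately show ?thesis by (rule holomorphic_in_multiplier_ideal_nonsingular[OF a])
    qed
  qed
qed

text \<open>Dyadic truncation yields rational exponents that increase with \<open>k\<close>, and
  increasing exponents make the weights decrease on the unit polydisc.\<close>

definition dyadic_floor :: "nat \<Rightarrow> real \<Rightarrow> real" where
  "dyadic_floor k x = of_int \<lfloor>x * 2 ^ k\<rfloor> / 2 ^ k"

lemma dyadic_floor_le: "dyadic_floor k x \<le> x"
  unfolding dyadic_floor_def by (simp add: divide_le_eq)

lemma dyadic_floor_Suc: "dyadic_floor k x \<le> dyadic_floor (Suc k) x"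
proof -
  have "2 * \<lfloor>x * 2 ^ k\<rfloor> \<le> \<lfloor>x * 2 ^ Suc k\<rfloor>"
    by (subst le_floor_iff) (simp add: mult.left_commute[of x 2])
  then have "(of_int (2 * \<lfloor>x * 2 ^ k\<rfloor>) :: real) \<le> of_int \<lfloor>x * 2 ^ Suc k\<rfloor>" by (subst of_int_le_iff)
  then show ?thesis unfolding dyadic_floor_def by (simp add: field_simps)
qed

lemma dyadic_floor_rational: "dyadic_floor k x \<in> \<rat>"
  unfolding dyadic_floor_def by simp

lemma tendsto_dyadic_floor: "(\<lambda>k. dyadic_floor k x) \<longlonglongrightarrow> x"
proof (rule tendsto_sandwich)
  have "x - (1/2) ^ k \<le> dyadic_floor k x" for k
  proof -
    have "x * 2 ^ k - 1 \<le> of_int \<lfloor>x * 2 ^ k\<rfloor>" by linarith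
    then have "(x * 2 ^ k - 1) / 2 ^ k \<le> dyadic_floor k x" unfolding dyadic_floor_def by (intro divide_right_mono) auto
    then show ?thesis by (simp add: diff_divide_distrib power_one_over)
  qed
  then show "\<forall>\<^sub>F k in sequentially. x - (1/2) ^ k \<le> dyadic_floor k x" by simp
  show "\<forall>\<^sub>F k in sequentially. dyadic_floor k x \<le> x" by (simp add: dyadic_floor_le)
  have "(\<lambda>k. x - (1/2) ^ k) \<longlonglongrightarrow> x - 0" by (intro tendsto_intros LIMSEQ_power_zero) auto
  then show "(\<lambda>k. x - (1/2) ^ k) \<longlonglongrightarrow> x" by simp
qed simp

text \<open>
  Only finitely many monomials have \<open>\<Sum> (\<alpha> l + 1) / a l \<le> 1\<close>; when equality never occurs, this
  inequality survives for all sufficiently close exponents.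
\<close>

lemma eventually_dyadic_floor_sum_le:
  fixes a :: "'n::finite \<Rightarrow> real"
  assumes a: "\<forall>l\<in>I. 0 < a l"
    and no: "\<not> (\<exists>x :: 'n \<Rightarrow> nat. (\<forall>l\<in>I. 0 < x l) \<and> (\<Sum>l\<in>I. real (x l) / a l) = 1)"
  shows "\<forall>\<^sub>F k in sequentially. \<forall>\<alpha> :: 'n \<Rightarrow> nat. (\<Sum>l\<in>I. (real (\<alpha> l) + 1) / a l) \<le> 1 \<longrightarrow> (\<Sum>l\<in>I. (real (\<alpha> l) + 1) / dyadic_floor k (a l)) \<le> 1"
proof -
  \<comment> \<open>The inequality forces \<open>\<alpha> l + 1 \<le> a l\<close> for each
    \<open>l \<in> I\<close>, so \<open>N\<close> bounds the exponents in question.\<close>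
  define N where "N = nat \<lceil>\<Sum>l\<in>I. a l\<rceil>"
  \<comment> \<open>Values off \<open>I\<close> are arbitrary; taking extensional functions removes
    this freedom and makes the set finite.\<close>
  define F where "F = {\<beta> \<in> Pi\<^sub>E I (\<lambda>_. {..N}). (\<Sum>l\<in>I. (real (\<beta> l) + 1) / a l) \<le> 1}"
  have fin: "finite F" unfolding F_def by (intro finite_subset[OF _ finite_PiE[of I "\<lambda>_. {..N}"]]) auto
  have "\<forall>\<beta>\<in>F. \<forall>\<^sub>F k in sequentially. (\<Sum>l\<in>I. (real (\<beta> l) + 1) / dyadic_floor k (a l)) < 1"
  proof
    fix \<beta> assume \<beta>: "\<beta> \<in> F"
    \<comment> \<open>The numbers \<open>\<beta> l + 1\<close> are positive integers, so
      unsolvability rules out equality, and a strict inequality survives small changes of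
      \<open>a\<close>.\<close>
    have "(\<Sum>l\<in>I. real (\<beta> l + 1) / a l) \<noteq> 1" using no by (metis add_gr_0 zero_less_one)
    then have lt: "(\<Sum>l\<in>I. (real (\<beta> l) + 1) / a l) < 1" using \<beta> by (simp add: F_def add.commute)
    have "(\<lambda>k. \<Sum>l\<in>I. (real (\<beta> l) + 1) / dyadic_floor k (a l)) \<longlonglongrightarrow> (\<Sum>l\<in>I. (real (\<beta> l) + 1) / a l)"
      using a by (intro tendsto_sum tendsto_divide tendsto_const tendsto_dyadic_floor) auto
    then show "\<forall>\<^sub>F k in sequentially. (\<Sum>l\<in>I. (real (\<beta> l) + 1) / dyadic_floor k (a l)) < 1"
      using lt by (rule order_tendstoD(2))
  qed
  then have "\<forall>\<^sub>F k in sequentially. \<forall>\<beta>\<in>F. (\<Sum>l\<in>I. (real (\<beta> l) + 1) / dyadic_floor k (a l)) < 1"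
    by (rule eventually_ball_finite[OF fin])
  then show ?thesis
  proof eventually_elim
    case (elim k)
    show ?case
    proof (intro allI impI)
      fix \<alpha> :: "'n \<Rightarrow> nat" assume \<alpha>: "(\<Sum>l\<in>I. (real (\<alpha> l) + 1) / a l) \<le> 1"
      have "\<alpha> l \<le> N" if l: "l \<in> I" for l
      proof -
        have "(real (\<alpha> l) + 1) / a l \<le> (\<Sum>l\<in>I. (real (\<alpha> l) + 1) / a l)"
          using a l by (intro member_le_sum[of l I "\<lambda>l. (real (\<alpha> l) + 1) / a l"]) (auto simp: order_less_imp_le)
        then have "(real (\<alpha> l) + 1) / a l \<le> 1" using \<alpha> by linarith
        then have "real (\<alpha> l) + 1 \<le> a l" using a l by (simp add: divide_le_eq)
        moreover have "a l \<le> (\<Sum>l\<in>I. a l)" using a l by (intro member_le_sum) (auto simp: order_less_imp_le)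
        ultimately show ?thesis unfolding N_def by linarith
      qed
      then have "restrict \<alpha> I \<in> F" using \<alpha> by (auto simp: F_def cong: sum.cong)
      then have "(\<Sum>l\<in>I. (real (restrict \<alpha> I l) + 1) / dyadic_floor k (a l)) < 1" using elim by blast
      then show "(\<Sum>l\<in>I. (real (\<alpha> l) + 1) / dyadic_floor k (a l)) \<le> 1" by (simp cong: sum.cong)
    qed
  qed
qed

lemma toric_weight_equisingular_approx:
  fixes a :: "'n::finite \<Rightarrow> real"
  assumes a: "\<forall>l\<in>I. 0 < a l" and I: "I \<noteq> {}"
    and no: "\<not> (\<exists>x :: 'n \<Rightarrow> nat. (\<forall>l\<in>I. 0 < x l) \<and> (\<Sum>l\<in>I. real (x l) / a l) = 1)"
  shows "decreasing_equisingular_approx_near (toric_weight I a :: complex^'n \<Rightarrow> ereal) 0"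
proof -
  have "\<forall>l\<in>I. \<forall>\<^sub>F k in sequentially. 0 < dyadic_floor k (a l)"
    using a order_tendstoD(1)[OF tendsto_dyadic_floor] by blast
  then have "\<forall>\<^sub>F k in sequentially. \<forall>l\<in>I. 0 < dyadic_floor k (a l)"
    by (intro eventually_ball_finite) auto
  from eventually_conj[OF this eventually_dyadic_floor_sum_le[OF a no]]
  obtain k0 where k0: "\<And>k. k0 \<le> k \<Longrightarrow> \<forall>l\<in>I. 0 < dyadic_floor k (a l)"
    "\<And>k \<alpha>. k0 \<le> k \<Longrightarrow> (\<Sum>l\<in>I. (real (\<alpha> l) + 1) / a l) \<le> 1 \<Longrightarrow> (\<Sum>l\<in>I. (real (\<alpha> l) + 1) / dyadic_floor k (a l)) \<le> 1"
    unfolding eventually_sequentially by blast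
  \<comment> \<open>The shift by \<open>k0\<close> makes positivity and the threshold condition hold
    from the first term on, since the ideals must agree for every \<open>k\<close>.\<close>
  define b where "b k l = dyadic_floor (k + k0) (a l)" for k l
  have b0: "\<forall>l\<in>I. 0 < b k l" for k using k0(1)[of "k + k0"] by (simp add: b_def)
  have ba: "b k l \<le> a l" for k l by (simp add: b_def dyadic_floor_le)
  have bS: "b k l \<le> b (Suc k) l" for k l by (simp add: b_def dyadic_floor_Suc)
  have blim: "(\<lambda>k. b k l) \<longlonglongrightarrow> a l" for l
    unfolding b_def by (rule LIMSEQ_ignore_initial_segment[OF tendsto_dyadic_floor])
  have an: "analytic_singularities_near (toric_weight I (b k) :: complex^'n \<Rightarrow> ereal) 0" for k
  proof -
    have "\<forall>l\<in>I. b k l / 1 \<in> \<rat> \<and> 0 < b k l / 1" using b0[of k] by (simp add: b_def dyadic_floor_rational)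
    from rational_ratios_imp_integers[OF finite zero_less_one this]
    obtain c n where "0 < c" "\<forall>l\<in>I. b k l = c * real (n l) \<and> 0 < n l" by blast
    then show ?thesis using commensurable_imp_analytic_toric[of I "b k" c n] I by blast
  qed
  have lim: "(\<lambda>k. toric_weight I (b k) z) \<longlonglongrightarrow> toric_weight I a z" for z :: "complex^'n"
    unfolding toric_weight_def
  proof (intro tendsto_ext_ln tendsto_sum)
    fix l
    show "(\<lambda>k. norm (z $ l) powr b k l) \<longlonglongrightarrow> norm (z $ l) powr a l"
      by (cases "z $ l = 0") (auto intro!: tendsto_powr tendsto_const blim)
  qed
  have le1: "norm (z $ l) \<le> 1" if "z \<in> polydisc 0 1" for z :: "complex^'n" and l
    using that by (simp add: polydisc_def order_less_imp_le)
  show ?thesis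
    unfolding decreasing_equisingular_approx_near_def
  proof (intro exI conjI allI ballI)
    show "open (polydisc (0 :: complex^'n) 1)" by (rule open_polydisc)
    show "0 \<in> polydisc (0 :: complex^'n) 1" by (simp add: centre_in_polydisc)
    show "plurisubharmonic_on (polydisc (0 :: complex^'n) 1) (toric_weight I a)"
      by (rule plurisubharmonic_toric_weight[OF a])
    show "plurisubharmonic_on (polydisc (0 :: complex^'n) 1) (toric_weight I (b k))" for k
      by (rule plurisubharmonic_toric_weight[OF b0])
    show "toric_weight I (b (Suc k)) z \<le> toric_weight I (b k) z" if "z \<in> polydisc 0 1" for k and z :: "complex^'n"
      by (rule toric_weight_mono_exponent[OF bS le1[OF that]])
    show "multiplier_ideal (toric_weight I (b k)) y = multiplier_ideal (toric_weight I a) y"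
      if "y \<in> polydisc 0 1" for k and y :: "complex^'n"
      using k0(2)[of "k + k0"] by (intro multiplier_ideal_toric_eq[OF b0 ba I _ that]) (simp add: b_def)
  qed (rule an lim)+
qed

text \<open>The constant sequence is a decreasing equisingular approximation.\<close>

lemma analytic_imp_equisingular_approx:
  fixes \<phi> :: "complex^'n::finite \<Rightarrow> ereal"
  assumes "analytic_singularities_near \<phi> 0" "plurisubharmonic_on UNIV \<phi>"
  shows "decreasing_equisingular_approx_near \<phi> 0"
  unfolding decreasing_equisingular_approx_near_def
  using assms by (intro exI[of _ UNIV] exI[of _ "\<lambda>_. \<phi>"]) auto

lemma analytic_toric_iff:
  fixes I :: "'n::finite set"
  assumes A: "\<forall>l\<in>I. 0 < A l" and I: "I \<noteq> {}"
  shows "analytic_singularities_near (toric_weight I A :: complex^'n \<Rightarrow> ereal) 0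
     \<longleftrightarrow> (\<exists>c::real. 0 < c \<and> (\<forall>l\<in>I. A l / c \<in> \<rat> \<and> 0 < A l / c))"
proof
  assume "analytic_singularities_near (toric_weight I A :: complex^'n \<Rightarrow> ereal) 0"
  from analytic_toric_imp_commensurable[OF A this]
  obtain c :: real where "0 < c" "\<And>l. l \<in> I \<Longrightarrow> A l / c \<in> \<rat>" by blast
  then show "\<exists>c::real. 0 < c \<and> (\<forall>l\<in>I. A l / c \<in> \<rat> \<and> 0 < A l / c)" using A by auto
next
  assume "\<exists>c::real. 0 < c \<and> (\<forall>l\<in>I. A l / c \<in> \<rat> \<and> 0 < A l / c)"
  then obtain c :: real where c: "0 < c" "\<forall>l\<in>I. A l / c \<in> \<rat> \<and> 0 < A l / c" by blast
  from rational_ratios_imp_integers[OF finite c]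
  obtain c' n where "0 < c'" "\<forall>l\<in>I. A l = c' * real (n l) \<and> 0 < n l" by blast
  then show "analytic_singularities_near (toric_weight I A :: complex^'n \<Rightarrow> ereal) 0"
    using commensurable_imp_analytic_toric[of I A c' n] I by blast
qed

theorem theorem1p1:
  fixes idx :: "nat \<Rightarrow> 'n::finite" and m :: nat and a :: "nat \<Rightarrow> real"
  assumes "bij_betw idx {1..CARD('n)} UNIV"
    and "1 \<le> m" and "m \<le> CARD('n)"
    and "\<forall>i\<in>{1..m}. 0 < a i"
  shows "(decreasing_equisingular_approx_near (log_sum_weight idx m a) 0 \<longleftrightarrow>
            analytic_singularities_near (log_sum_weight idx m a) 0 \<or>
            \<not> (\<exists>x :: nat \<Rightarrow> nat. (\<forall>i\<in>{1..m}. 0 < x i) \<and> (\<Sum>i=1..m. real (x i) / a i) = 1))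
       \<and> (analytic_singularities_near (log_sum_weight idx m a) 0 \<longleftrightarrow>
            (\<exists>c::real. 0 < c \<and> (\<forall>i\<in>{1..m}. a i / c \<in> \<rat> \<and> 0 < a i / c)))"
proof -
  \<comment> \<open>The numbered data are transported to the index type of the coordinates; the
    values of \<open>A\<close> matter only on \<open>I\<close>, where the inverse of
    \<open>idx\<close> is determined.\<close>
  define I where "I = idx ` {1..m}"
  define A where "A l = a (the_inv_into {1..m} idx l)" for l
  have inj: "inj_on idx {1..m}"
    using assms(1,3) by (auto simp: bij_betw_def intro: inj_on_subset)
  have A_idx: "A (idx i) = a i" if "i \<in> {1..m}" for i
    unfolding A_def using the_inv_into_f_f[OF inj that] by simp
  have I: "I \<noteq> {}" using assms(2) by (auto simp: I_def)
  have A: "\<forall>l\<in>I. 0 < A l" using assms(4) A_idx by (auto simp: I_def)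
  have reindex: "(\<Sum>l\<in>I. g l) = (\<Sum>i=1..m. g (idx i))" for g :: "'n \<Rightarrow> real"
    unfolding I_def sum.reindex[OF inj] by simp
  have weight: "log_sum_weight idx m a = toric_weight I A"
    unfolding log_sum_weight_def toric_weight_def reindex by (intro ext arg_cong[where f=ext_ln] sum.cong refl) (simp add: A_idx)
  have solvable: "(\<exists>x :: nat \<Rightarrow> nat. (\<forall>i\<in>{1..m}. 0 < x i) \<and> (\<Sum>i=1..m. real (x i) / a i) = 1)
      \<longleftrightarrow> (\<exists>x :: 'n \<Rightarrow> nat. (\<forall>l\<in>I. 0 < x l) \<and> (\<Sum>l\<in>I. real (x l) / A l) = 1)"
  proof
    assume "\<exists>x :: nat \<Rightarrow> nat. (\<forall>i\<in>{1..m}. 0 < x i) \<and> (\<Sum>i=1..m. real (x i) / a i) = 1"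
    then obtain x :: "nat \<Rightarrow> nat" where x: "\<forall>i\<in>{1..m}. 0 < x i" "(\<Sum>i=1..m. real (x i) / a i) = 1" by blast
    define y where "y l = x (the_inv_into {1..m} idx l)" for l
    have y: "y (idx i) = x i" if "i \<in> {1..m}" for i
      unfolding y_def using the_inv_into_f_f[OF inj that] by simp
    have "(\<Sum>l\<in>I. real (y l) / A l) = (\<Sum>i=1..m. real (x i) / a i)"
      unfolding reindex by (intro sum.cong refl) (simp add: y A_idx)
    then show "\<exists>x :: 'n \<Rightarrow> nat. (\<forall>l\<in>I. 0 < x l) \<and> (\<Sum>l\<in>I. real (x l) / A l) = 1"
      using x y by (intro exI[of _ y]) (auto simp: I_def)
  next
    assume "\<exists>x :: 'n \<Rightarrow> nat. (\<forall>l\<in>I. 0 < x l) \<and> (\<Sum>l\<in>I. real (x l) / A l) = 1"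
    then obtain x :: "'n \<Rightarrow> nat" where x: "\<forall>l\<in>I. 0 < x l" "(\<Sum>l\<in>I. real (x l) / A l) = 1" by blast
    have "(\<Sum>i=1..m. real (x (idx i)) / a i) = (\<Sum>l\<in>I. real (x l) / A l)"
      unfolding reindex by (intro sum.cong refl) (simp add: A_idx)
    then show "\<exists>x :: nat \<Rightarrow> nat. (\<forall>i\<in>{1..m}. 0 < x i) \<and> (\<Sum>i=1..m. real (x i) / a i) = 1"
      using x by (intro exI[of _ "\<lambda>i. x (idx i)"]) (auto simp: I_def)
  qed
  have ratios: "(\<exists>c::real. 0 < c \<and> (\<forall>i\<in>{1..m}. a i / c \<in> \<rat> \<and> 0 < a i / c))
      \<longleftrightarrow> (\<exists>c::real. 0 < c \<and> (\<forall>l\<in>I. A l / c \<in> \<rat> \<and> 0 < A l / c))"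
    unfolding I_def using A_idx by simp
  let ?\<phi> = "toric_weight I A :: complex^'n \<Rightarrow> ereal"
  have "decreasing_equisingular_approx_near ?\<phi> 0 \<longleftrightarrow>
     analytic_singularities_near ?\<phi> 0 \<or> \<not> (\<exists>x :: 'n \<Rightarrow> nat. (\<forall>l\<in>I. 0 < x l) \<and> (\<Sum>l\<in>I. real (x l) / A l) = 1)"
  proof
    assume dec: "decreasing_equisingular_approx_near ?\<phi> 0"
    show "analytic_singularities_near ?\<phi> 0 \<or> \<not> (\<exists>x :: 'n \<Rightarrow> nat. (\<forall>l\<in>I. 0 < x l) \<and> (\<Sum>l\<in>I. real (x l) / A l) = 1)"
    proof (rule disjCI)
      assume "\<not> \<not> (\<exists>x :: 'n \<Rightarrow> nat. (\<forall>l\<in>I. 0 < x l) \<and> (\<Sum>l\<in>I. real (x l) / A l) = 1)"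
      then obtain x :: "'n \<Rightarrow> nat" where x: "\<forall>l\<in>I. 0 < x l" "(\<Sum>l\<in>I. real (x l) / A l) = 1" by blast
      from equisingular_imp_commensurable[OF A I dec x]
      obtain c :: real where "0 < c" "\<And>l. l \<in> I \<Longrightarrow> A l / c \<in> \<rat>" by blast
      then show "analytic_singularities_near ?\<phi> 0" unfolding analytic_toric_iff[OF A I] using A by auto
    qed
  next
    assume "analytic_singularities_near ?\<phi> 0 \<or> \<not> (\<exists>x :: 'n \<Rightarrow> nat. (\<forall>l\<in>I. 0 < x l) \<and> (\<Sum>l\<in>I. real (x l) / A l) = 1)"
    then show "decreasing_equisingular_approx_near ?\<phi> 0"
      using analytic_imp_equisingular_approx[OF _ plurisubharmonic_toric_weight[OF A]] toric_weight_equisingular_approx[OF A I] by blast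
  qed
  then show ?thesis unfolding weight solvable ratios using analytic_toric_iff[OF A I] by blast
qed

end
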